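(* Let $f \colon \mathbb{R}^p \to \mathbb{R}$ be continuously differentiable and semi-algebraic, and let $C \subset \mathbb{R}^p$ be closed and semi-algebraic. Then there exists a set $V \subset \mathbb{R}^p$, which is a finite union of semi-algebraic embedded submanifolds of $\mathbb{R}^p$ of dimension at most $p-1$, such that for all $v \in \mathbb{R}^p \setminus V$, every critical point on $C$ of the function $f_v \colon x \mapsto f(x) + \langle v, x\rangle$ is Fréchet stationary for $f_v$ on $C$.
   Context: $\langle\cdot,\cdot\rangle$ and $\|\cdot\|$ denote the Euclidean scalar product and norm on $\mathbb{R}^p$. Semi-algebraic: a basic semi-algebraic subset of $\mathbb{R}^n$ is a set of the form $\{x \in \mathbb{R}^n : P(x) = 0,\ Q_1(x) > 0, \ldots, Q_m(x) > 0\}$ with $m\in\mathbb{N}$ and $P, Q_1, \ldots, Q_m$ real polynomials in $n$ variables. A semi-algebraic set is a finite union of basic semi-algebraic sets. A function is semi-algebraic if its graph is a semi-algebraic set. "Embedded submanifold" means smooth embedded submanifold; it is semi-algebraic if it is a semi-algebraic subset of $\mathbb{R}^p$. Regular normal cone: for $x \in C$, $\hat N_C(x)$ is the set of $v \in \mathbb{R}^p$ such that $\langle v, y-x\rangle \le o(\|y-x\|)$ for $y \in C$, i.e. $\limsup_{y \to x,\ y \in C,\ y \ne x} \frac{\langle v, y-x\rangle}{\|y-x\|} \le 0$ (a condition that is vacuously true if $x$ is isolated in $C$). Normal cone: for $x \in C$, $N_C(x)$ is the set of $w \in \mathbb{R}^p$ for which there exist sequences $(x_k)$ in $C$ and $(v_k)$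 in $\mathbb{R}^p$ with $v_k \in \hat N_C(x_k)$ for all $k$, $x_k \to x$ and $v_k \to w$. For a $C^1$ function $h \colon \mathbb{R}^p \to \mathbb{R}$, a point $x \in C$ is called critical for $h$ on $C$ if $-\nabla h(x) \in N_C(x)$, and Fréchet stationary for $h$ on $C$ if $-\nabla h(x) \in \hat N_C(x)$. *)

theory Defs
  imports "HOL-Analysis.Analysis"
begin

section \<open>Semi-algebraic sets and functions\<close>

definition basic_semialgebraic :: "'a::euclidean_space set \<Rightarrow> bool" where
  "basic_semialgebraic S \<longleftrightarrow>
     (\<exists>P Qs. real_polynomial_function P \<and> finite Qs \<and> (\<forall>Q\<in>Qs. real_polynomial_function Q) \<and>
        S = {x. P x = 0 \<and> (\<forall>Q\<in>Qs. Q x > 0)})"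

definition semialgebraic :: "'a::euclidean_space set \<Rightarrow> bool" where
  "semialgebraic S \<longleftrightarrow> (\<exists>\<B>. finite \<B> \<and> (\<forall>B\<in>\<B>. basic_semialgebraic B) \<and> S = \<Union>\<B>)"

text \<open>The graph lives in the Euclidean space \<open>'a \<times> 'b\<close>, of dimension \<open>DIM('a) + DIM('b)\<close>.\<close>

definition semialgebraic_function :: "('a::euclidean_space \<Rightarrow> 'b::euclidean_space) \<Rightarrow> bool" where
  "semialgebraic_function f \<longleftrightarrow> semialgebraic (range (\<lambda>x. (x, f x)))"


section \<open>Smoothness and embedded submanifolds\<close>

text \<open>
  Only meant for open \<open>U\<close> in a finite-dimensional space: there, continuity of all iterated
  directional derivatives is the usual \<open>C\<^sup>k\<close> condition.
\<close>

primrec Ck_on :: "nat \<Rightarrow> ('a::euclidean_space \<Rightarrow> 'b::real_normed_vector) \<Rightarrow> 'a set \<Rightarrow> bool" where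
  "Ck_on 0 f U \<longleftrightarrow> continuous_on U f"
| "Ck_on (Suc k) f U \<longleftrightarrow>
     (\<forall>x\<in>U. f differentiable (at x)) \<and> (\<forall>v. Ck_on k (\<lambda>x. frechet_derivative f (at x) v) U)"

definition smooth_on :: "'a set \<Rightarrow> ('a::euclidean_space \<Rightarrow> 'b::real_normed_vector) \<Rightarrow> bool" where
  "smooth_on U f \<longleftrightarrow> (\<forall>k. Ck_on k f U)"

definition diffeomorphism :: "'a::euclidean_space set \<Rightarrow> 'b::euclidean_space set \<Rightarrow> ('a \<Rightarrow> 'b) \<Rightarrow> ('b \<Rightarrow> 'a) \<Rightarrow> bool" where
  "diffeomorphism U W \<phi> \<psi> \<longleftrightarrow>
     open U \<and> open W \<and> homeomorphism U W \<phi> \<psi> \<and> smooth_on U \<phi> \<and> smooth_on W \<psi>"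

text \<open>
  Every point of \<open>S\<close> has a smooth slice chart of the ambient space, flattening \<open>S\<close> to an open
  piece of a \<open>d\<close>-dimensional linear subspace. The dimension is the same at all points of \<open>S\<close>.
\<close>

definition embedded_submanifold :: "nat \<Rightarrow> 'a::euclidean_space set \<Rightarrow> bool" where
  "embedded_submanifold d S \<longleftrightarrow>
     (\<forall>x\<in>S. \<exists>U W \<phi> \<psi> L. x \<in> U \<and> diffeomorphism U W \<phi> \<psi> \<and>
        subspace (L :: 'a set) \<and> dim L = d \<and> \<phi> ` (U \<inter> S) = W \<inter> L)"


section \<open>Normal cones and stationarity\<close>

text \<open>
  The upper limit is taken in the extended reals. If \<open>x\<close> is isolated in \<open>C\<close> then
  \<open>at x within C\<close> is the trivial filter, the upper limit is \<open>-\<infinity>\<close>, and the condition is vacuous.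
\<close>

definition regular_normal_cone :: "'a::euclidean_space set \<Rightarrow> 'a \<Rightarrow> 'a set" where
  "regular_normal_cone C x =
     {v. Limsup (at x within C) (\<lambda>y. ereal (inner v (y - x) / norm (y - x))) \<le> 0}"

definition normal_cone :: "'a::euclidean_space set \<Rightarrow> 'a \<Rightarrow> 'a set" where
  "normal_cone C x =
     {w. \<exists>xs vs. (\<forall>k. xs k \<in> C \<and> vs k \<in> regular_normal_cone C (xs k)) \<and>
           xs \<longlonglongrightarrow> x \<and> vs \<longlonglongrightarrow> w}"

definition gradient :: "('a::euclidean_space \<Rightarrow> real) \<Rightarrow> 'a \<Rightarrow> 'a" where
  "gradient h x = (THE g. GDERIV h x :> g)"

definition critical_on :: "'a::euclidean_space set \<Rightarrow> ('a \<Rightarrow> real) \<Rightarrow> 'a \<Rightarrow> bool" where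
  "critical_on C h x \<longleftrightarrow> x \<in> C \<and> - gradient h x \<in> normal_cone C x"

definition frechet_stationary_on :: "'a::euclidean_space set \<Rightarrow> ('a \<Rightarrow> real) \<Rightarrow> 'a \<Rightarrow> bool" where
  "frechet_stationary_on C h x \<longleftrightarrow> x \<in> C \<and> - gradient h x \<in> regular_normal_cone C x"

end

theory Submission
  imports Defs "HOL-Library.Multiset_Order"
begin

text \<open>
  Let \<open>S\<close> be the set of pairs \<open>(v, x)\<close> such that \<open>x\<close> is Frechet stationary for \<open>f\<^sub>v\<close> on \<open>C\<close>. As the
  gradient of \<open>f\<close> is continuous, a critical point \<open>x\<close> of \<open>f\<^sub>v\<close> gives a point \<open>(v, x)\<close> in the closure
  of \<open>S\<close>. By Tarski-Seidenberg, \<open>S\<close> and the set of bad parameters, those \<open>v\<close> with some \<open>(v, x)\<close> in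
  the closure of \<open>S\<close> but not in \<open>S\<close>, are semialgebraic, so it is enough that the bad set has empty
  interior: it then lies in the zero set of a nonzero polynomial, which is covered by finitely many
  smooth hypersurfaces. Outside countably many hypersurfaces the fibre over \<open>v\<close> of the closure of
  \<open>S\<close> is the closure of the fibre of \<open>S\<close>, and the fibre of \<open>S\<close> is finite, hence closed. Finiteness
  is an envelope argument: otherwise some coordinate of the stationary points would fill an interval
  for all \<open>v\<close> in an open set, and along a Lipschitz section the critical value would be independent
  of that coordinate, although its derivative in \<open>v\<close> is the stationary point itself.
\<close>

section \<open>Matching the signs of two polynomials\<close>

text \<open>The exceptional parameters arise as countable unions, for which Baire's theorem yields
  no more than empty interior; semialgebraicity of the whole bad set is what upgrades this to
  containment in the zero set of one polynomial. Stationarity is expressed by comparing values of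
  \<open>f\<close>, so that the first-order formula for it involves the graph of \<open>f\<close>
  and no derivative. The envelope argument would be immediate along a differentiable family of
  stationary points, but here families are only Lipschitz and stationarity is only a lower bound, as
  \<open>C\<close> may be singular. Both suffice: the critical value, corrected by a linear term,
  satisfies a lower first-order bound of slope zero on both sides of each point, and a continuous
  function on an interval with this property is constant. Lipschitz families are also easy to get: a
  scalar implicit function for monotone polynomials, applied to one coordinate at a time, replaces
  stratification. The argument needs two independent parameters: moving \<open>v\<close> along a
  basis vector gives one, the interval assumed to be filled by a coordinate gives the other.\<close>

text \<open>For finite real \<open>Z\<close>, the points lie in the same cell of the partition of
  the line by \<open>Z\<close>: the same point of \<open>Z\<close> or the same component of its
  complement. Only comparisons with \<open>Z\<close> occur, so order isomorphisms transport the
  relation.\<close>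

definition same_gap :: "'a::linorder set \<Rightarrow> 'a \<Rightarrow> 'a \<Rightarrow> bool" where
  "same_gap Z s t \<longleftrightarrow> (\<forall>z\<in>Z. (z < s \<longleftrightarrow> z < t) \<and> (s < z \<longleftrightarrow> t < z))"

lemma same_gap_refl [simp]: "same_gap Z s s"
  and same_gap_sym: "same_gap Z s t \<Longrightarrow> same_gap Z t s"
  and same_gap_trans: "same_gap Z s t \<Longrightarrow> same_gap Z t u \<Longrightarrow> same_gap Z s u"
  by (auto simp: same_gap_def)

lemma same_gap_mem: "same_gap Z s t \<Longrightarrow> s \<in> Z \<longleftrightarrow> t \<in> Z"
  unfolding same_gap_def by (metis linorder_less_linear less_irrefl)

lemma same_gap_between:
  assumes "same_gap Z s t" "s \<le> u" "u \<le> t"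
  shows "same_gap Z s u"
  using assms unfolding same_gap_def by (metis order.strict_trans1 order.strict_trans2 order_less_le)

lemma same_gap_image:
  fixes h :: "'a::linorder \<Rightarrow> 'b::linorder"
  assumes "strict_mono h"
  shows "same_gap (h ` Z) (h s) (h t) \<longleftrightarrow> same_gap Z s t"
  using strict_mono_less[OF assms] by (auto simp: same_gap_def)

text \<open>A polynomial that stays positive on a half-line has a positive leading coefficient and
  is eventually at least as large as it; hence \<open>q\<close> grows at least linearly.\<close>

lemma poly_pos_at_right:
  fixes q :: "real poly"
  assumes "\<And>t. w \<le> t \<Longrightarrow> poly (pderiv q) t > 0"
  shows "\<exists>t>w. poly q t > 0"
proof -
  have ne: "pderiv q \<noteq> 0"
    using assms[of w] by auto
  have "lead_coeff (pderiv q) > 0"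
  proof (rule ccontr)
    assume "\<not> lead_coeff (pderiv q) > 0"
    then have "lead_coeff (- pderiv q) > 0"
      using ne by (simp add: order_less_le)
    then obtain n where "\<forall>x\<ge>n. poly (- pderiv q) x \<ge> lead_coeff (- pderiv q)"
      using poly_pinfty_gt_lc by blast
    then have "poly (- pderiv q) (max n w) > 0"
      using \<open>lead_coeff (- pderiv q) > 0\<close> by (metis max.cobounded1 order_less_le_trans)
    then show False
      using assms[of "max n w"] by simp
  qed
  then obtain n where n: "\<forall>x\<ge>n. poly (pderiv q) x \<ge> lead_coeff (pderiv q)"
    using poly_pinfty_gt_lc by blast
  define c where "c = lead_coeff (pderiv q)"
  have "c > 0" using \<open>lead_coeff (pderiv q) > 0\<close> by (simp add: c_def)
  define m where "m = max n w"
  \<comment> \<open>Over this length a slope of at least \<open>c\<close> gains one more than the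
    absolute value of \<open>poly q m\<close>.\<close>
  define t where "t = m + (\<bar>poly q m\<bar> + 1) / c"
  have "t > m" using \<open>c > 0\<close> by (simp add: t_def add_nonneg_pos)
  then obtain x where x: "m < x" "x < t" "poly q t - poly q m = (t - m) * poly (pderiv q) x"
    using poly_MVT by blast
  have "(t - m) * poly (pderiv q) x \<ge> (t - m) * c"
    using x n \<open>t > m\<close> by (intro mult_left_mono) (auto simp: c_def m_def)
  moreover have "(t - m) * c = \<bar>poly q m\<bar> + 1"
    using \<open>c > 0\<close> by (simp add: t_def)
  ultimately have "poly q t > 0" using x by linarith
  then show ?thesis
    using \<open>t > m\<close> by (intro exI[of _ t]) (auto simp: m_def)
qed

lemma poly_sgn_const:
  fixes q :: "real poly"
  assumes "\<And>u. \<lbrakk>min s t \<le> u; u \<le> max s t\<rbrakk> \<Longrightarrow> poly q u \<noteq> 0"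
  shows "sgn (poly q s) = sgn (poly q t)"
proof -
  have *: "sgn (poly q a) = sgn (poly q b)"
    if "a < b" and nz: "\<And>u. \<lbrakk>a \<le> u; u \<le> b\<rbrakk> \<Longrightarrow> poly q u \<noteq> 0" for a b
  proof -
    have "\<not> poly q a * poly q b < 0"
      using poly_IVT[OF \<open>a < b\<close>, of q] nz by force
    then show ?thesis
      using nz[of a] nz[of b] that(1) by (auto simp: sgn_if mult_less_0_iff not_less)
  qed
  show ?thesis
  proof (cases s t rule: linorder_cases)
    case less
    then have "min s t = s" "max s t = t" by auto
    then show ?thesis using *[OF less] assms by metis
  next
    case greater
    then have "min s t = t" "max s t = s" by auto
    then show ?thesis using *[OF greater] assms by metis
  qed simp
qed

text \<open>In the application \<open>p\<close> and \<open>q\<close> are one parametrised polynomial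
  at two parameters. The map \<open>h\<close> already matches the signs of the derivatives, and on
  \<open>Z\<close>, which contains the zeros of the derivative of \<open>p\<close> and of further
  polynomials, the signs of \<open>p\<close> and \<open>q\<close> are known to agree. The task is to
  move \<open>h\<close> inside the gaps of \<open>Z\<close> until they agree everywhere.\<close>

locale sign_matching =
  fixes p q :: "real poly" and Z :: "real set" and h :: "real \<Rightarrow> real"
  assumes h: "strict_mono h" "surj h" and fin: "finite Z"
    and deriv: "sgn (poly (pderiv p) t) = sgn (poly (pderiv q) (h t))"
    and zeros: "poly (pderiv p) t = 0 \<Longrightarrow> t \<in> Z"
    and signs: "z \<in> Z \<Longrightarrow> sgn (poly p z) = sgn (poly q (h z))"
begin

lemma zeros': "poly (pderiv q) w = 0 \<Longrightarrow> w \<in> h ` Z"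
proof -
  assume "poly (pderiv q) w = 0"
  moreover obtain t where t: "w = h t" using h by (metis surjD)
  ultimately have "poly (pderiv p) t = 0"
    using deriv[of t] by (simp add: sgn_0_0)
  then show ?thesis using zeros t by auto
qed

lemma uminus: "sign_matching (- p) (- q) Z h"
  by unfold_locales (use h fin deriv zeros signs in \<open>auto simp: pderiv_minus sgn_minus\<close>)

text \<open>Variable and value both change sign, so the derivative keeps its sign; statements about
  the right of a point thereby yield those about the left.\<close>

lemma reflect:
  "sign_matching (- pcompose p [:0, -1:]) (- pcompose q [:0, -1:]) (uminus ` Z) (\<lambda>t. - h (- t))"
proof
  have "\<exists>x. y = - h (- x)" for y
    using h(2) by (metis add.inverse_inverse surjD)
  then show "surj (\<lambda>t. - h (- t))" by (auto simp: surj_def)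
  fix t :: real
  show "sgn (poly (pderiv (- pcompose p [:0, - 1:])) t) =
        sgn (poly (pderiv (- pcompose q [:0, - 1:])) (- h (- t)))"
    using deriv[of "- t"] by (simp add: pderiv_minus pderiv_pcompose pderiv_pCons poly_pcompose)
  show "t \<in> uminus ` Z" if "poly (pderiv (- pcompose p [:0, - 1:])) t = 0"
    using that zeros[of "-t"]
    by (force simp: pderiv_minus pderiv_pcompose pderiv_pCons poly_pcompose)
qed (use h fin signs in \<open>auto simp: poly_pcompose sgn_minus strict_mono_def\<close>)

text \<open>The roles are exchanged because roots of \<open>q\<close> must be traced back to roots
  of \<open>p\<close> as well.\<close>

lemma inverse: "sign_matching q p (h ` Z) (inv h)"
proof -
  have hi: "h (inv h t) = t" "inv h (h t) = t" for t
    using h by (auto simp: surj_f_inv_f strict_mono_imp_inj_on)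
  show ?thesis
  proof
    show "strict_mono (inv h)"
      using h hi by (metis strict_mono_def strict_mono_less)
    show "surj (inv h)" using hi by (metis surjI)
    show "sgn (poly (pderiv q) t) = sgn (poly (pderiv p) (inv h t))" for t
      using deriv[of "inv h t"] hi by simp
  qed (use fin zeros' signs hi in auto)
qed

text \<open>\<open>p\<close> increases through the rest of the gap. If the gap ends at
  \<open>b\<close>, then \<open>p\<close> is positive at \<open>b\<close>, so \<open>q\<close> is
  positive at \<open>h b\<close> and just before it. If the gap is unbounded, the derivative of
  \<open>q\<close> stays positive and \<open>q\<close> must become positive.\<close>

lemma exists_pos_right:
  assumes "t \<notin> Z" "poly (pderiv p) t > 0" "poly p t \<ge> 0"
  shows "\<exists>w>h t. same_gap (h ` Z) (h t) w \<and> poly q w > 0"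
proof (cases "\<exists>z\<in>Z. t < z")
  case True
  define b where "b = Min {z\<in>Z. t < z}"
  have "b \<in> {z\<in>Z. t < z}"
    unfolding b_def using True fin by (intro Min_in) auto
  then have b: "b \<in> Z" "t < b" by auto
  have least: "b \<le> z" if "z \<in> Z" "t < z" for z
    using that fin by (simp add: b_def)
  have "poly p b > 0"
  proof -
    obtain x where x: "t < x" "x < b" "poly p b - poly p t = (b - t) * poly (pderiv p) x"
      using poly_MVT \<open>t < b\<close> by blast
    have "sgn (poly (pderiv p) t) = sgn (poly (pderiv p) x)"
    proof (rule poly_sgn_const)
      fix u assume "min t x \<le> u" "u \<le> max t x"
      then have "u \<notin> Z" using least[of u] x assms(1) by force
      then show "poly (pderiv p) u \<noteq> 0" using zeros by blast
    qed
    then have "poly (pderiv p) x > 0" using assms by (simp add: sgn_if split: if_splits)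
    then show ?thesis using x b assms by (smt (verit) mult_pos_pos)
  qed
  then have qb: "poly q (h b) > 0"
    using signs[OF b(1)] by (metis sgn_greater)
  have lt: "h t < h b" using b h by (simp add: strict_mono_def)
  have "(poly q \<longlongrightarrow> poly q (h b)) (at_left (h b))"
    by (intro tendsto_intros)
  then have "\<forall>\<^sub>F w in at_left (h b). poly q w > 0"
    using qb by (rule order_tendstoD)
  moreover have "\<forall>\<^sub>F w in at_left (h b). w \<in> {h t<..<h b}"
    using lt by (rule eventually_at_left_real)
  ultimately have "\<forall>\<^sub>F w in at_left (h b). poly q w > 0 \<and> w \<in> {h t<..<h b}"
    by (rule eventually_conj)
  then obtain w where w: "poly q w > 0" "h t < w" "w < h b"
    by (auto dest!: eventually_happens)
  have "same_gap (h ` Z) (h t) w"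
    unfolding same_gap_def
  proof safe
    fix z assume z: "z \<in> Z"
    have *: "z < t \<or> b \<le> z"
      using least[OF z] assms(1) z by (metis linorder_neqE_linordered_idom)
    then have **: "h z < h t \<or> h b \<le> h z"
      using h by (simp add: strict_mono_less strict_mono_less_eq)
    show "h z < h t \<Longrightarrow> h z < w" "h z < w \<Longrightarrow> h z < h t"
      "h t < h z \<Longrightarrow> w < h z" "w < h z \<Longrightarrow> h t < h z"
      using ** w lt by auto
  qed
  then show ?thesis using w by blast
next
  case False
  have "poly (pderiv q) w > 0" if "h t \<le> w" for w
  proof -
    obtain s where s: "w = h s" using h by (metis surjD)
    have "t \<le> s" using that s h by (simp add: strict_mono_less_eq)
    have "sgn (poly (pderiv p) t) = sgn (poly (pderiv p) s)"
    proof (rule poly_sgn_const)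
      fix u assume "min t s \<le> u" "u \<le> max t s"
      then have "u \<notin> Z" using False assms(1) \<open>t \<le> s\<close> by (metis min.absorb1 order_le_less)
      then show "poly (pderiv p) u \<noteq> 0" using zeros by blast
    qed
    then show ?thesis using deriv[of s] assms s by (simp add: sgn_if split: if_splits)
  qed
  then obtain w where w: "w > h t" "poly q w > 0"
    using poly_pos_at_right by blast
  moreover have "same_gap (h ` Z) (h t) w"
    unfolding same_gap_def
  proof safe
    fix z assume z: "z \<in> Z"
    then have "h z < h t"
      using False assms(1) h by (metis linorder_neqE_linordered_idom strict_mono_less)
    then show "h z < h t \<Longrightarrow> h z < w" "h z < w \<Longrightarrow> h z < h t"
      "h t < h z \<Longrightarrow> w < h z" "w < h z \<Longrightarrow> h t < h z"
      using w by auto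
  qed
  ultimately show ?thesis by blast
qed

text \<open>A nonnegative value of \<open>p\<close> lets \<open>q\<close> be positive to the right
  of \<open>h t\<close>, a nonpositive one lets it be negative to the left. At a root of
  \<open>p\<close> both apply, and a nonzero value of \<open>q\<close> at \<open>h t\<close> is
  paired with the side of opposite sign to enclose a root of \<open>q\<close> in the same
  gap.\<close>

lemma exists_sgn_pos:
  assumes "t \<notin> Z" "poly (pderiv p) t > 0"
  shows "\<exists>w. same_gap (h ` Z) (h t) w \<and> sgn (poly q w) = sgn (poly p t)"
proof -
  have right: "\<exists>w>h t. same_gap (h ` Z) (h t) w \<and> poly q w > 0" if "poly p t \<ge> 0"
    using exists_pos_right assms that by blast
  have left: "\<exists>w<h t. same_gap (h ` Z) (h t) w \<and> poly q w < 0" if "poly p t \<le> 0"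
  proof -
    interpret r: sign_matching "- pcompose p [:0, -1:]" "- pcompose q [:0, -1:]" "uminus ` Z"
      "\<lambda>t. - h (- t)"
      by (rule reflect)
    have "- t \<notin> uminus ` Z" using assms(1) by auto
    moreover have "poly (pderiv (- pcompose p [:0, -1:])) (- t) > 0"
      using assms(2) by (simp add: pderiv_minus pderiv_pcompose pderiv_pCons poly_pcompose)
    moreover have "poly (- pcompose p [:0, -1:]) (- t) \<ge> 0"
      using that by (simp add: poly_pcompose)
    ultimately obtain w where w: "w > - h (- (- t))"
      "same_gap ((\<lambda>t. - h (- t)) ` uminus ` Z) (- h (- (- t))) w"
      "poly (- pcompose q [:0, -1:]) w > 0"
      using r.exists_pos_right by blast
    have "(\<lambda>t. - h (- t)) ` uminus ` Z = uminus ` h ` Z"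
      by (simp add: image_image)
    then have gap: "same_gap (uminus ` h ` Z) (- h t) w" using w(2) by simp
    have "same_gap (h ` Z) (h t) (- w)"
      unfolding same_gap_def
    proof
      fix y assume "y \<in> h ` Z"
      then have "- y \<in> uminus ` h ` Z" by blast
      from bspec[OF gap[unfolded same_gap_def] this]
      show "(y < h t \<longleftrightarrow> y < - w) \<and> (h t < y \<longleftrightarrow> - w < y)"
        by (simp only: neg_less_iff_less minus_less_iff less_minus_iff) linarith
    qed
    then show ?thesis
      using w by (intro exI[of _ "- w"]) (auto simp: poly_pcompose)
  qed
  consider "poly p t > 0" | "poly p t < 0" | "poly p t = 0" "poly q (h t) > 0"
    | "poly p t = 0" "poly q (h t) < 0" | "poly p t = 0" "poly q (h t) = 0"
    by linarith
  then show ?thesis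
  proof cases
    case 3
    then obtain w where w: "w < h t" "same_gap (h ` Z) (h t) w" "poly q w < 0"
      using left by auto
    then obtain x where "w < x" "x < h t" "poly q x = 0"
      using poly_IVT_pos 3 by blast
    moreover have "same_gap (h ` Z) (h t) x"
      using same_gap_between[OF same_gap_sym[OF w(2)], of x] calculation w(2)
      by (meson less_imp_le same_gap_trans)
    ultimately show ?thesis using 3 by (metis)
  next
    case 4
    then obtain w where w: "w > h t" "same_gap (h ` Z) (h t) w" "poly q w > 0"
      using right by auto
    then obtain x where "h t < x" "x < w" "poly q x = 0"
      using poly_IVT_pos 4 by blast
    moreover have "same_gap (h ` Z) (h t) x"
      using same_gap_between[OF w(2), of x] calculation by auto
    ultimately show ?thesis using 4 by (metis)
  next
    case 1 then show ?thesis using right by (metis less_imp_le sgn_pos)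
  next
    case 2 then show ?thesis using left by (metis less_imp_le sgn_neg)
  next
    case 5 then show ?thesis by (metis same_gap_refl)
  qed
qed

lemma exists_sgn: "\<exists>w. same_gap (h ` Z) (h t) w \<and> sgn (poly q w) = sgn (poly p t)"
proof (cases "t \<in> Z")
  case True
  then show ?thesis using signs by (metis same_gap_refl)
next
  case False
  then consider "poly (pderiv p) t > 0" | "poly (pderiv (- p)) t > 0"
    using zeros by (force simp: pderiv_minus)
  then show ?thesis
  proof cases
    case 1 then show ?thesis using exists_sgn_pos False by blast
  next
    case 2
    then show ?thesis
      using sign_matching.exists_sgn_pos[OF uminus, of t] False by (simp add: sgn_minus)
  qed
qed

text \<open>Rolle: two roots enclose a zero of the derivative, which belongs to \<open>Z\<close> and
  separates them.\<close>

lemma gap_root_unique: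
  assumes "poly p s = 0" "poly p t = 0" "same_gap Z s t"
  shows "s = t"
proof -
  have "False" if "s < t" "poly p s = 0" "poly p t = 0" "same_gap Z s t" for s t
  proof -
    obtain x where x: "s < x" "x < t" "poly p t - poly p s = (t - s) * poly (pderiv p) x"
      using poly_MVT[OF \<open>s < t\<close>] by blast
    then have "x \<in> Z" using that zeros by auto
    then show False using x that by (auto simp: same_gap_def)
  qed
  then show ?thesis using assms same_gap_sym by (metis linorder_neqE_linordered_idom)
qed

lemma gap_sgn_deriv:
  assumes "same_gap Z s t" "s \<notin> Z"
  shows "sgn (poly (pderiv p) s) = sgn (poly (pderiv p) t)"
proof (rule poly_sgn_const)
  fix u assume u: "min s t \<le> u" "u \<le> max s t"
  have "same_gap Z s u"
    using same_gap_between[OF assms(1), of u] same_gap_between[OF same_gap_sym[OF assms(1)], of u] u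
      same_gap_trans[OF assms(1)] by (auto simp: min_def max_def split: if_splits)
  then have "u \<notin> Z" using assms(2) same_gap_mem by blast
  then show "poly (pderiv p) u \<noteq> 0" using zeros by blast
qed

text \<open>\<open>p\<close> is monotone on a gap, so the side of the root and the sign of the
  derivative fix the sign of \<open>p\<close>. On a gap that contains a root, matching the roots
  therefore matches the signs.\<close>

lemma gap_sgn_from_root:
  assumes "same_gap Z s t" "s \<notin> Z" "poly p s = 0"
  shows "sgn (poly p t) = sgn (t - s) * sgn (poly (pderiv p) t)"
proof -
  have "\<exists>x. same_gap Z t x \<and> poly p t - poly p s = (t - s) * poly (pderiv p) x"
  proof (cases s t rule: linorder_cases)
    case less
    then obtain x where x: "s < x" "x < t" "poly p t - poly p s = (t - s) * poly (pderiv p) x"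
      using poly_MVT by blast
    then show ?thesis
      using same_gap_between[OF assms(1), of x] assms(1) same_gap_sym same_gap_trans
      by (metis less_imp_le)
  next
    case greater
    then obtain x where x: "t < x" "x < s" "poly p s - poly p t = (s - t) * poly (pderiv p) x"
      using poly_MVT by blast
    then have "same_gap Z t x"
      using same_gap_between[OF same_gap_sym[OF assms(1)], of x] by auto
    then show ?thesis using x(3) by (intro exI[of _ x]) (auto simp: algebra_simps)
  next
    case equal
    then show ?thesis by (intro exI[of _ t]) auto
  qed
  then obtain x where x: "same_gap Z t x" "poly p t = (t - s) * poly (pderiv p) x"
    using assms by auto
  have "t \<notin> Z" using assms same_gap_mem by blast
  then show ?thesis using gap_sgn_deriv[OF x(1)] x(2) by (simp add: sgn_mult)
qed

end

text \<open>Induction on the largest point: the bijection for the smaller points is kept up to their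
  maximum and continued by a ray.\<close>

lemma strict_mono_on_finite_extends:
  fixes k :: "real \<Rightarrow> real"
  assumes "finite A" "strict_mono_on A k"
  shows "\<exists>g. strict_mono g \<and> surj g \<and> (\<forall>a\<in>A. g a = k a)"
  using assms
proof (induction A rule: finite_linorder_max_induct)
  case empty
  show ?case by (intro exI[of _ id]) (auto simp: strict_mono_def)
next
  case (insert b A)
  then obtain g where g: "strict_mono g" "surj g" "\<forall>a\<in>A. g a = k a"
    by (auto simp: strict_mono_on_def)
  show ?case
  proof (cases "A = {}")
    case True
    have "surj (\<lambda>t. t + (k b - b))" by (rule surjI[of _ "\<lambda>t. t - (k b - b)"]) auto
    then show ?thesis
      using True by (intro exI[of _ "\<lambda>t. t + (k b - b)"]) (auto simp: strict_mono_def)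
  next
    case False
    define m where "m = Max A"
    have m: "m \<in> A" "\<forall>a\<in>A. a \<le> m" using False insert.hyps by (auto simp: m_def)
    have "m < b" using m insert.hyps by auto
    have "k m < k b" using insert.prems m \<open>m < b\<close> by (auto simp: strict_mono_on_def)
    \<comment> \<open>The slope of the ray from \<open>(m, k m)\<close> through
      \<open>(b, k b)\<close>.\<close>
    define c where "c = (k b - k m) / (b - m)"
    have "c > 0" using \<open>m < b\<close> \<open>k m < k b\<close> by (simp add: c_def)
    define g' where "g' t = (if t \<le> m then g t else g m + c * (t - m))" for t
    have "strict_mono g'"
    proof (rule strict_monoI)
      fix s t :: real assume "s < t"
      have "g s \<le> g m" if "s \<le> m" using g(1) that by (simp add: strict_mono_less_eq)
      then show "g' s < g' t"
        using \<open>s < t\<close> \<open>c > 0\<close> g(1) unfolding g'_def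
        by (auto simp: strict_mono_less intro!: add_le_less_mono[of _ _ 0, simplified])
          (smt (verit) mult_pos_pos)
    qed
    moreover have "\<exists>t. y = g' t" for y
    proof (cases "y \<le> g m")
      case True
      obtain t where "y = g t" using g by (metis surjD)
      then have "t \<le> m" using True g by (simp add: strict_mono_less_eq)
      then show ?thesis using \<open>y = g t\<close> by (intro exI[of _ t]) (auto simp: g'_def)
    next
      case False
      then show ?thesis
        using \<open>c > 0\<close> by (intro exI[of _ "m + (y - g m) / c"]) (auto simp: g'_def field_simps)
    qed
    then have "surj g'" by (auto simp: surj_def)
    moreover have "\<forall>a\<in>insert b A. g' a = k a"
      using m g \<open>m < b\<close> insert.hyps by (auto simp: g'_def c_def)
    ultimately show ?thesis by blast
  qed
qed

context sign_matching
begin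

text \<open>\<open>h'\<close> keeps \<open>h\<close> on \<open>Z\<close> and sends each other root
  of \<open>p\<close> to a root of \<open>q\<close> in the matched gap, which
  \<open>exists_sgn\<close> provides. Since \<open>Z\<close> separates the roots of
  \<open>p\<close>, this assignment is increasing and extends to the whole line.\<close>

lemma exists_refined_matching:
  "\<exists>h'. strict_mono h' \<and> surj h' \<and> (\<forall>z\<in>Z. h' z = h z) \<and>
              (\<forall>t. same_gap (h ` Z) (h t) (h' t) \<and> sgn (poly p t) = sgn (poly q (h' t)))"
proof -
  have "p \<noteq> 0"
  proof
    assume "p = 0"
    then have "Z = UNIV" using zeros by auto
    then show False using fin infinite_UNIV_char_0 by auto
  qed
  define R where "R = {t. poly p t = 0}"
  have "finite R" unfolding R_def using \<open>p \<noteq> 0\<close> by (rule poly_roots_finite)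
  have "\<exists>w. same_gap (h ` Z) (h r) w \<and> poly q w = 0" if "r \<in> R" for r
    using exists_sgn[of r] that by (auto simp: R_def sgn_0_0)
  then obtain k0 where k0: "\<And>r. r \<in> R \<Longrightarrow> same_gap (h ` Z) (h r) (k0 r) \<and> poly q (k0 r) = 0"
    by metis
  define k where "k t = (if t \<in> Z then h t else k0 t)" for t
  have kgap: "same_gap (h ` Z) (h t) (k t)" if "t \<in> Z \<union> R" for t
    using that k0 by (auto simp: k_def)
  have less: "h z < h t \<longleftrightarrow> z < t" for z t using h(1) by (rule strict_mono_less)
  have "strict_mono_on (Z \<union> R) k"
  proof (rule strict_mono_onI)
    fix s t assume st: "s \<in> Z \<union> R" "t \<in> Z \<union> R" "s < t"
    \<comment> \<open>Two roots outside \<open>Z\<close> lie in different gaps, so a point of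
      \<open>Z\<close> falls between them.\<close>
    have "\<exists>z\<in>Z. s \<le> z \<and> z \<le> t"
    proof (cases "s \<in> Z \<or> t \<in> Z")
      case True then show ?thesis using less_imp_le[OF st(3)] by blast
    next
      case False
      then show ?thesis
        using gap_root_unique[of s t] st unfolding R_def same_gap_def
        by (smt (verit) UnE mem_Collect_eq)
    qed
    then obtain z where z: "z \<in> Z" "s \<le> z" "z \<le> t" by blast
    have "k s \<le> h z"
      using kgap[OF st(1)] z less unfolding same_gap_def by (meson imageI not_less)
    moreover have "h z \<le> k t"
      using kgap[OF st(2)] z less unfolding same_gap_def by (meson imageI not_less)
    moreover have "k s < h z \<or> h z < k t"
      using kgap[OF st(1)] kgap[OF st(2)] z less \<open>s < t\<close> unfolding same_gap_def
      by (metis imageI order_le_less)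
    ultimately show "k s < k t" by linarith
  qed
  then obtain h' where h': "strict_mono h'" "surj h'" "\<And>a. a \<in> Z \<union> R \<Longrightarrow> h' a = k a"
    using strict_mono_on_finite_extends[of "Z \<union> R" k] fin \<open>finite R\<close> by auto
  have h'Z: "\<forall>z\<in>Z. h' z = h z" using h' by (auto simp: k_def)
  then have im: "h' ` Z = h ` Z" by (auto simp: image_iff)
  have gap: "same_gap (h ` Z) (h t) (h' t)" for t
    unfolding same_gap_def
  proof safe
    fix z assume z: "z \<in> Z"
    then have "h z = h' z" using h'Z by auto
    then show "h z < h t \<Longrightarrow> h z < h' t" "h z < h' t \<Longrightarrow> h z < h t"
      "h t < h z \<Longrightarrow> h' t < h z" "h' t < h z \<Longrightarrow> h t < h z"
      using less h'(1) by (metis strict_mono_less)+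
  qed
  interpret inv: sign_matching q p "h ` Z" "inv h" by (rule inverse)
  have hi: "h (inv h t) = t" "inv h (h t) = t" for t
    using h by (auto simp: surj_f_inv_f strict_mono_imp_inj_on)
  have root: "poly q (h' r) = 0" if "r \<in> R" for r
  proof (cases "r \<in> Z")
    case True
    then show ?thesis using signs[OF True] that h' by (auto simp: k_def R_def sgn_0_0)
  next
    case False
    then show ?thesis using k0 that h' by (auto simp: k_def)
  qed
  \<comment> \<open>Suppose the signs differ at \<open>t\<close>. Somewhere in the matched gap, at
    \<open>w\<close>, \<open>q\<close> does have the sign of \<open>p\<close> at \<open>t\<close>,
    so \<open>q\<close> has a root \<open>u\<close> there. It comes from a root \<open>s\<close> of
    \<open>p\<close> in the gap of \<open>t\<close> with \<open>h' s = u\<close>, and both signs can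
    now be computed from the root and the matched derivatives.\<close>
  have "sgn (poly p t) = sgn (poly q (h' t))" for t
  proof (rule ccontr)
    assume ne: "sgn (poly p t) \<noteq> sgn (poly q (h' t))"
    have "t \<notin> Z" using ne signs[of t] h'Z by auto
    have "t \<notin> R" using ne root[of t] by (auto simp: R_def)
    obtain w where w: "same_gap (h ` Z) (h t) w" "sgn (poly q w) = sgn (poly p t)"
      using exists_sgn by blast
    have "\<exists>u. min w (h' t) \<le> u \<and> u \<le> max w (h' t) \<and> poly q u = 0"
      using poly_sgn_const[of w "h' t" q] ne w(2) by metis
    then obtain u where u: "min w (h' t) \<le> u" "u \<le> max w (h' t)" "poly q u = 0"
      by blast
    have wt: "same_gap (h ` Z) w (h' t)"
      using w(1) gap same_gap_sym same_gap_trans by blast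
    have ut: "same_gap (h ` Z) (h' t) u"
      using same_gap_between[OF wt, of u] same_gap_between[OF same_gap_sym[OF wt], of u] u
        same_gap_trans[OF same_gap_sym[OF wt]] by (auto simp: min_def max_def split: if_splits)
    have ZZ: "inv h ` h ` Z = Z" by (auto simp: image_image hi)
    obtain s where s: "same_gap Z (inv h u) s" "poly p s = 0"
      using inv.exists_sgn[of u] u(3) unfolding ZZ by (auto simp: sgn_0_0)
    have "s \<in> R" using s by (simp add: R_def)
    have "same_gap (h ` Z) u (h s)"
      using s(1) same_gap_image[OF h(1), of Z "inv h u" s] by (simp add: hi)
    then have us: "same_gap (h ` Z) u (h' s)" using gap same_gap_trans by blast
    have "h' s = u"
      using inv.gap_root_unique[OF _ u(3), of "h' s"] root[OF \<open>s \<in> R\<close>] us same_gap_sym by blast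
    have st: "same_gap Z s t"
      using us ut gap same_gap_image[OF h(1), of Z s t] by (meson same_gap_sym same_gap_trans)
    have "s \<notin> Z" using st \<open>t \<notin> Z\<close> same_gap_mem by blast
    have 1: "sgn (poly p t) = sgn (t - s) * sgn (poly (pderiv p) t)"
      using gap_sgn_from_root[OF st \<open>s \<notin> Z\<close> s(2)] .
    have nin: "h' t \<notin> h ` Z"
      using gap[of t] \<open>t \<notin> Z\<close> same_gap_mem h(1) by (metis hi(2) imageE)
    have 2: "sgn (poly q (h' t)) = sgn (h' t - h' s) * sgn (poly (pderiv q) (h' t))"
      using inv.gap_sgn_from_root[of "h' s" "h' t"] ut \<open>h' s = u\<close> u(3) nin same_gap_mem same_gap_sym
      by blast
    have 3: "sgn (poly (pderiv q) (h' t)) = sgn (poly (pderiv p) t)"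
      using inv.gap_sgn_deriv[OF same_gap_sym[OF gap] nin] deriv[of t] by simp
    have "sgn (h' t - h' s) = sgn (t - s)"
      using strict_mono_less[OF h'(1), of s t] strict_mono_less[OF h'(1), of t s]
      by (auto simp: sgn_if)
    then show False using 1 2 3 ne by simp
  qed
  then show ?thesis using h' h'Z gap by blast
qed

end

section \<open>The Boolean algebra of semialgebraic sets\<close>

lemma basic_semialgebraic_Int:
  assumes "basic_semialgebraic S" "basic_semialgebraic T"
  shows "basic_semialgebraic (S \<inter> T)"
proof -
  obtain P Qs where S: "real_polynomial_function P" "finite Qs" "\<forall>Q\<in>Qs. real_polynomial_function Q"
    "S = {x. P x = 0 \<and> (\<forall>Q\<in>Qs. Q x > 0)}"
    using assms(1) unfolding basic_semialgebraic_def by blast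
  obtain P' Qs' where T: "real_polynomial_function P'" "finite Qs'" "\<forall>Q\<in>Qs'. real_polynomial_function Q"
    "T = {x. P' x = 0 \<and> (\<forall>Q\<in>Qs'. Q x > 0)}"
    using assms(2) unfolding basic_semialgebraic_def by blast
  show ?thesis
    unfolding basic_semialgebraic_def
    by (rule exI[of _ "\<lambda>x. P x * P x + P' x * P' x"], rule exI[of _ "Qs \<union> Qs'"])
      (use S T in \<open>auto simp: sum_squares_eq_zero_iff\<close>)
qed

lemma semialgebraic_basic: "basic_semialgebraic S \<Longrightarrow> semialgebraic S"
  unfolding semialgebraic_def by (rule exI[of _ "{S}"]) auto

lemma semialgebraic_empty [simp]: "semialgebraic {}"
  unfolding semialgebraic_def by (rule exI[of _ "{}"]) auto

lemma semialgebraic_Un: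
  assumes "semialgebraic S" "semialgebraic T" shows "semialgebraic (S \<union> T)"
proof -
  obtain A B where "finite A" "\<forall>X\<in>A. basic_semialgebraic X" "S = \<Union>A"
    "finite B" "\<forall>X\<in>B. basic_semialgebraic X" "T = \<Union>B"
    using assms unfolding semialgebraic_def by blast
  then show ?thesis
    unfolding semialgebraic_def by (intro exI[of _ "A \<union> B"]) auto
qed

lemma semialgebraic_UN:
  assumes "finite I" "\<And>i. i \<in> I \<Longrightarrow> semialgebraic (A i)" shows "semialgebraic (\<Union>i\<in>I. A i)"
  using assms by (induction I) (auto intro: semialgebraic_Un)

lemma semialgebraic_Int:
  assumes "semialgebraic S" "semialgebraic T" shows "semialgebraic (S \<inter> T)"
proof -
  obtain A B where AB: "finite A" "\<forall>X\<in>A. basic_semialgebraic X" "S = \<Union>A"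
    "finite B" "\<forall>X\<in>B. basic_semialgebraic X" "T = \<Union>B"
    using assms unfolding semialgebraic_def by blast
  have "S \<inter> T = (\<Union>X\<in>A. \<Union>Y\<in>B. X \<inter> Y)" using AB by auto
  moreover have "semialgebraic (\<Union>X\<in>A. \<Union>Y\<in>B. X \<inter> Y)"
    using AB(1,2,4,5)
    by (intro semialgebraic_UN semialgebraic_basic basic_semialgebraic_Int) auto
  ultimately show ?thesis by simp
qed

lemma semialgebraic_eq_0: "real_polynomial_function P \<Longrightarrow> semialgebraic {x. P x = 0}"
  by (rule semialgebraic_basic, unfold basic_semialgebraic_def,
      rule exI[of _ P], rule exI[of _ "{}"]) auto

lemma semialgebraic_gt_0: "real_polynomial_function P \<Longrightarrow> semialgebraic {x. P x > 0}"
  by (rule semialgebraic_basic, unfold basic_semialgebraic_def,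
      rule exI[of _ "\<lambda>x. 0"], rule exI[of _ "{P}"]) auto

lemma semialgebraic_lt_0:
  assumes "real_polynomial_function P" shows "semialgebraic {x. P x < 0}"
  using semialgebraic_gt_0[OF real_polynomial_function_minus[OF assms]] by simp

lemma semialgebraic_UNIV [simp]: "semialgebraic UNIV"
  using semialgebraic_eq_0[of "\<lambda>x. 0"] by auto

lemma semialgebraic_INT:
  assumes "finite I" "\<And>i. i \<in> I \<Longrightarrow> semialgebraic (A i)" shows "semialgebraic (\<Inter>i\<in>I. A i)"
  using assms by (induction I) (auto intro: semialgebraic_Int)

lemma semialgebraic_Compl:
  assumes "semialgebraic S" shows "semialgebraic (- S)"
proof -
  have basic: "semialgebraic (- B)" if B0: "basic_semialgebraic B" for B :: "'a set"
  proof -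
    obtain P Qs where B: "real_polynomial_function P" "finite Qs" "\<forall>Q\<in>Qs. real_polynomial_function Q"
      "B = {x. P x = 0 \<and> (\<forall>Q\<in>Qs. Q x > 0)}"
      using B0 unfolding basic_semialgebraic_def by blast
    have "- B = {x. P x < 0} \<union> {x. P x > 0} \<union> (\<Union>Q\<in>Qs. {x. Q x < 0} \<union> {x. Q x = 0})"
      unfolding B(4) by (auto simp: not_less order_le_less)
    then show ?thesis
      using B by (auto intro!: semialgebraic_Un semialgebraic_UN semialgebraic_eq_0
          semialgebraic_gt_0 semialgebraic_lt_0)
  qed
  obtain A where A: "finite A" "\<forall>X\<in>A. basic_semialgebraic X" "S = \<Union>A"
    using assms unfolding semialgebraic_def by blast
  then have "- S = (\<Inter>X\<in>A. - X)" by auto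
  then show ?thesis using A basic by (auto intro!: semialgebraic_INT)
qed

text \<open>Only finitely many sign vectors occur, and \<open>A\<close> is the union of their cells.
  Quantifier elimination can thus be proved by comparing two points, without producing a
  formula.\<close>

lemma semialgebraic_sign_determined:
  fixes \<Phi> :: "('a::euclidean_space \<Rightarrow> real) set"
  assumes "finite \<Phi>" "\<And>\<phi>. \<phi> \<in> \<Phi> \<Longrightarrow> real_polynomial_function \<phi>"
    and det: "\<And>x y. \<lbrakk>\<And>\<phi>. \<phi> \<in> \<Phi> \<Longrightarrow> sgn (\<phi> x) = sgn (\<phi> y); x \<in> A\<rbrakk> \<Longrightarrow> y \<in> A"
  shows "semialgebraic A"
proof -
  define vec where "vec x = (\<lambda>\<phi>\<in>\<Phi>. sgn (\<phi> x))" for x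
  define cell where "cell s = (\<Inter>\<phi>\<in>\<Phi>. {x. sgn (\<phi> x) = s \<phi>})" for s
  have "vec x \<in> \<Phi> \<rightarrow>\<^sub>E {-1, 0, 1}" for x
    by (auto simp: vec_def sgn_if)
  then have "finite (vec ` A)"
    using finite_PiE[OF assms(1), of "\<lambda>_. {-1, 0, 1::real}"] by (auto intro: finite_subset)
  have "semialgebraic {x. sgn (\<phi> x) = c}" if "\<phi> \<in> \<Phi>" for \<phi> and c :: real
  proof -
    note \<phi> = assms(2)[OF that]
    consider "c = 1" | "c = -1" | "c = 0" | "c \<noteq> 1" "c \<noteq> -1" "c \<noteq> 0" by blast
    then show ?thesis
    proof cases
      case 1 then show ?thesis using semialgebraic_gt_0[OF \<phi>] by (simp add: sgn_1_pos)
    next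
      case 2 then show ?thesis using semialgebraic_lt_0[OF \<phi>] by (simp add: sgn_1_neg)
    next
      case 3 then show ?thesis using semialgebraic_eq_0[OF \<phi>] by (simp add: sgn_0_0)
    next
      case 4
      then have "{x. sgn (\<phi> x) = c} = {}" by (auto simp: sgn_if)
      then show ?thesis by simp
    qed
  qed
  then have "semialgebraic (cell s)" for s
    unfolding cell_def by (intro semialgebraic_INT assms)
  moreover have "A = (\<Union>s\<in>vec ` A. cell s)"
  proof safe
    fix x assume "x \<in> A"
    then show "x \<in> (\<Union>s\<in>vec ` A. cell s)" by (auto simp: cell_def vec_def)
  next
    fix x y assume "x \<in> A" "y \<in> cell (vec x)"
    then show "y \<in> A" using det[of x y] by (auto simp: cell_def vec_def)
  qed
  ultimately show ?thesis
    using semialgebraic_UN[OF \<open>finite (vec ` A)\<close>] by metis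
qed


section \<open>The Tarski-Seidenberg theorem\<close>

text \<open>The size \<open>n\<close> counts formal coefficients: the degree is below
  \<open>n\<close>, and size 0 forces the zero polynomial. The formal top coefficient, of index
  \<open>n - 1\<close>, may vanish at some parameters.\<close>

definition param_poly :: "nat \<Rightarrow> ('a::euclidean_space \<Rightarrow> real poly) \<Rightarrow> bool" where
  "param_poly n p \<longleftrightarrow> (\<forall>i. real_polynomial_function (\<lambda>x. coeff (p x) i)) \<and>
     (\<forall>i\<ge>n. \<forall>x. coeff (p x) i = 0)"

lemma param_polyD:
  assumes "param_poly n p"
  shows "real_polynomial_function (\<lambda>x. coeff (p x) i)" "n \<le> i \<Longrightarrow> coeff (p x) i = 0"
  using assms by (auto simp: param_poly_def)

lemma param_poly_const:
  assumes "param_poly n p" "n \<le> 1"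
  shows "poly (p x) t = coeff (p x) 0"
proof -
  have "p x = [:coeff (p x) 0:]"
    using param_polyD(2)[OF assms(1)] assms(2)
    by (intro poly_eqI) (auto simp: coeff_pCons split: nat.split)
  then show ?thesis by (metis mult_zero_right add.right_neutral poly_0 poly_pCons)
qed

lemma param_poly_pderiv:
  assumes "param_poly n p" shows "param_poly (n - 1) (\<lambda>x. pderiv (p x))"
  unfolding param_poly_def coeff_pderiv
  using param_polyD[OF assms] by (auto simp: le_diff_conv)

lemma param_poly_mult:
  assumes "param_poly n p" "param_poly m q"
  shows "param_poly (n + m) (\<lambda>x. p x * q x)"
  unfolding param_poly_def
proof safe
  show "real_polynomial_function (\<lambda>x. coeff (p x * q x) i)" for i
    unfolding coeff_mult using param_polyD(1)[OF assms(1)] param_polyD(1)[OF assms(2)]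
    by (intro real_polynomial_function_sum real_polynomial_function.intros(4)) auto
  show "coeff (p x * q x) i = 0" if "n + m \<le> i" for i x
    unfolding coeff_mult
  proof (rule sum.neutral, safe)
    fix j assume "j \<le> i"
    then have "n \<le> j \<or> m \<le> i - j" using that by linarith
    then show "coeff (p x) j * coeff (q x) (i - j) = 0"
      using param_polyD(2)[OF assms(1)] param_polyD(2)[OF assms(2)] by auto
  qed
qed

text \<open>The truncation has smaller size and agrees with \<open>p\<close> at the parameters where
  the formal top coefficient vanishes.\<close>

lemma param_poly_truncate:
  assumes "param_poly (Suc n) p"
  shows "param_poly n (\<lambda>x. p x - monom (coeff (p x) n) n)"
  unfolding param_poly_def
proof safe
  show "real_polynomial_function (\<lambda>x. coeff (p x - monom (coeff (p x) n) n) i)" for i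
    using param_polyD[OF assms] by (cases "i = n") (auto simp: real_polynomial_function.intros(2))
  show "coeff (p x - monom (coeff (p x) n) n) i = 0" if "n \<le> i" for i x
    using param_polyD(2)[OF assms, of i] that by (cases "i = n") auto
qed

lemma param_poly_along_line:
  fixes P :: "'a::euclidean_space \<Rightarrow> real"
  assumes "real_polynomial_function P"
  shows "\<exists>n p. param_poly n p \<and> (\<forall>x t. P (x + t *\<^sub>R b) = poly (p x) t)"
  using assms
proof induction
  case (linear f)
  have "param_poly 2 (\<lambda>x. [:f x, f b:])"
    unfolding param_poly_def
  proof safe
    show "real_polynomial_function (\<lambda>x. coeff [:f x, f b:] i)" for i
    proof (cases i)
      case 0
      then show ?thesis using linear by (simp add: real_polynomial_function.intros(1))
    next
      case (Suc j)
      then show ?thesis using real_polynomial_function.intros(2) by (cases j) auto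
    qed
    show "coeff [:f x, f b:] i = 0" if "2 \<le> i" for i x
      using that by (auto simp: coeff_pCons split: nat.split)
  qed
  moreover have "f (x + t *\<^sub>R b) = poly [:f x, f b:] t" for x t
    using linear by (simp add: linear_simps)
  ultimately show ?case by blast
next
  case (const c)
  have "param_poly 1 (\<lambda>x. [:c:])"
    unfolding param_poly_def by (auto simp: coeff_pCons split: nat.split)
  then show ?case by (intro exI[of _ 1] exI[of _ "\<lambda>x. [:c:]"]) auto
next
  case (add f g)
  then obtain n p m q where *: "param_poly n p" "\<And>x t. f (x + t *\<^sub>R b) = poly (p x) t"
    "param_poly m q" "\<And>x t. g (x + t *\<^sub>R b) = poly (q x) t" by blast
  have "param_poly (max n m) (\<lambda>x. p x + q x)"
    using *(1,3) unfolding param_poly_def by auto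
  then show ?case using * by (intro exI[of _ "max n m"] exI[of _ "\<lambda>x. p x + q x"]) auto
next
  case (mult f g)
  then obtain n p m q where *: "param_poly n p" "\<And>x t. f (x + t *\<^sub>R b) = poly (p x) t"
    "param_poly m q" "\<And>x t. g (x + t *\<^sub>R b) = poly (q x) t" by blast
  then show ?case
    using param_poly_mult[OF *(1,3)] by (intro exI[of _ "n + m"] exI[of _ "\<lambda>x. p x * q x"]) auto
qed

text \<open>The leading coefficient enters with an even power, so that it does not affect signs.\<close>

lemma param_poly_pseudo_remainder:
  assumes "param_poly n c" "param_poly (Suc m) d"
  shows "\<exists>r k. param_poly m r \<and>
    (\<forall>x t. poly (d x) t = 0 \<longrightarrow> (coeff (d x) m ^ 2) ^ k * poly (c x) t = poly (r x) t)"
  using assms(1)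
proof (induction n arbitrary: c)
  case 0
  then have "param_poly m c" by (auto simp: param_poly_def)
  then show ?case by (intro exI[of _ c] exI[of _ 0]) auto
next
  case (Suc n)
  show ?case
  proof (cases "Suc n \<le> m")
    case True
    then have "param_poly m c" using Suc.prems by (auto simp: param_poly_def)
    then show ?thesis by (intro exI[of _ c] exI[of _ 0]) auto
  next
    case False
    define l where "l x = coeff (d x) m" for x
    \<comment> \<open>One division step: the two products cancel in the coefficient of index
      \<open>n\<close>, because \<open>l\<close> is the coefficient of index \<open>m\<close> of
      \<open>d\<close>.\<close>
    define c1 where "c1 x = smult (l x ^ 2) (c x) - smult (l x * coeff (c x) n) (monom 1 (n - m) * d x)" for x
    have c1: "coeff (c1 x) i = l x ^ 2 * coeff (c x) i -
        (if n - m \<le> i then l x * coeff (c x) n * coeff (d x) (i - (n - m)) else 0)" for x i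
      by (simp add: c1_def coeff_monom_mult)
    have "param_poly n c1"
      unfolding param_poly_def
    proof safe
      show "real_polynomial_function (\<lambda>x. coeff (c1 x) i)" for i
        unfolding c1 using param_polyD(1)[OF Suc.prems] param_polyD(1)[OF assms(2)]
        by (cases "n - m \<le> i") (auto simp: l_def intro!: real_polynomial_function_diff
            real_polynomial_function.intros(4) real_polynomial_function_power)
      show "coeff (c1 x) i = 0" if "n \<le> i" for i x
      proof (cases "i = n")
        case True
        then show ?thesis using False by (simp add: c1 l_def power2_eq_square)
      next
        case ne: False
        then show ?thesis
          using that param_polyD(2)[OF Suc.prems, of i x] param_polyD(2)[OF assms(2), of "i - (n - m)" x] False
          by (simp add: c1)
      qed
    qed
    then obtain r k where r: "param_poly m r"
      "\<And>x t. poly (d x) t = 0 \<Longrightarrow> (l x ^ 2) ^ k * poly (c1 x) t = poly (r x) t"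
      using Suc.IH unfolding l_def by metis
    have "(l x ^ 2) ^ Suc k * poly (c x) t = poly (r x) t" if "poly (d x) t = 0" for x t
      using r(2)[OF that] that by (simp add: c1_def algebra_simps)
    then show ?thesis using r(1) unfolding l_def by blast
  qed
qed

text \<open>
  The order isomorphism \<open>h\<close> replaces the table of roots and signs in Hormander's elimination method.
\<close>

definition sign_equiv :: "('a \<Rightarrow> real poly) set \<Rightarrow> 'a \<Rightarrow> 'a \<Rightarrow> bool" where
  "sign_equiv P x y \<longleftrightarrow> (\<exists>h. strict_mono h \<and> surj h \<and>
     (\<forall>p\<in>P. \<forall>t. sgn (poly (p x) t) = sgn (poly (p y) (h t))))"

text \<open>At a zero of \<open>p\<close> the polynomial \<open>c\<close> equals, up to a positive
  factor, its remainder \<open>r\<close>, whose signs \<open>h\<close> already matches. This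
  supplies the signs of \<open>c\<close> on \<open>Z\<close>. The refined map stays in the gaps of
  \<open>Z\<close>, so it crosses no zero of the polynomials in \<open>P\<close>; the remainders in
  \<open>R\<close> are then discarded.\<close>

lemma sign_equiv_insert:
  assumes "sign_equiv (insert (\<lambda>x. pderiv (c x)) (P \<union> R)) x y"
    and fin: "finite P" and nz: "pderiv (c x) \<noteq> 0"
    and rem: "\<And>p. \<lbrakk>p \<in> insert (\<lambda>x. pderiv (c x)) P; p x \<noteq> 0\<rbrakk> \<Longrightarrow> \<exists>r\<in>R. \<exists>C>0. \<exists>D>0.
       (\<forall>t. poly (p x) t = 0 \<longrightarrow> C * poly (c x) t = poly (r x) t) \<and>
       (\<forall>t. poly (p y) t = 0 \<longrightarrow> D * poly (c y) t = poly (r y) t)"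
  shows "sign_equiv (insert c P) x y"
proof -
  define c' where "c' = (\<lambda>x. pderiv (c x))"
  obtain h where h: "strict_mono h" "surj h"
    and sg0: "\<forall>p\<in>insert c' (P \<union> R). \<forall>t. sgn (poly (p x) t) = sgn (poly (p y) (h t))"
    using assms(1) unfolding sign_equiv_def c'_def[symmetric] by (elim exE conjE)
  then have sg: "sgn (poly (p x) t) = sgn (poly (p y) (h t))" if "p \<in> insert c' (P \<union> R)" for p t
    using that by blast
  \<comment> \<open>Polynomials that are identically zero at the parameter \<open>x\<close> are left
    out, which keeps \<open>Z\<close> finite.\<close>
  define Z where "Z = (\<Union>p\<in>{p\<in>insert c' P. p x \<noteq> 0}. {t. poly (p x) t = 0})"
  have "finite Z" unfolding Z_def using fin by (auto intro: poly_roots_finite)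
  interpret sign_matching "c x" "c y" Z h
  proof
    show "sgn (poly (pderiv (c x)) t) = sgn (poly (pderiv (c y)) (h t))" for t
      using sg[of c' t] by (simp add: c'_def)
    show "t \<in> Z" if "poly (pderiv (c x)) t = 0" for t
      using that nz by (auto simp: Z_def c'_def)
    fix z assume "z \<in> Z"
    then obtain p where p: "p \<in> insert c' P" "p x \<noteq> 0" "poly (p x) z = 0"
      by (auto simp: Z_def)
    obtain r C D where r: "r \<in> R" "C > 0" "D > 0"
      "\<forall>t. poly (p x) t = 0 \<longrightarrow> C * poly (c x) t = poly (r x) t"
      "\<forall>t. poly (p y) t = 0 \<longrightarrow> D * poly (c y) t = poly (r y) t"
      using rem[of p] p(1,2) unfolding c'_def by blast
    have "poly (p y) (h z) = 0"
      using sg[of p z] p by (auto simp: sgn_0_0)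
    then have "sgn (C * poly (c x) z) = sgn (D * poly (c y) (h z))"
      using r p sg[of r z] by auto
    then show "sgn (poly (c x) z) = sgn (poly (c y) (h z))"
      using r by (simp add: sgn_mult)
  qed (use h \<open>finite Z\<close> in auto)
  obtain h' where h': "strict_mono h'" "surj h'" "\<And>z. z \<in> Z \<Longrightarrow> h' z = h z"
    "\<And>t. same_gap (h ` Z) (h t) (h' t)" "\<And>t. sgn (poly (c x) t) = sgn (poly (c y) (h' t))"
    using exists_refined_matching by blast
  have "sgn (poly (p x) t) = sgn (poly (p y) (h' t))" if "p \<in> P" for p t
  proof -
    note sgp = sg[of p, OF insertI2, OF UnI1, OF that]
    have "sgn (poly (p y) (h t)) = sgn (poly (p y) (h' t))"
    proof (cases "p x = 0")
      case True
      then have "poly (p y) (h s) = 0" for s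
        using sgp[of s] by (simp add: sgn_0_0)
      then have "poly (p y) s = 0" for s using h(2) by (metis surjD)
      then show ?thesis by simp
    next
      case False
      show ?thesis
      proof (cases "t \<in> Z")
        case True then show ?thesis using h' by simp
      next
        case nZ: False
        show ?thesis
        proof (rule poly_sgn_const, rule notI)
          fix u assume u: "min (h t) (h' t) \<le> u" "u \<le> max (h t) (h' t)" "poly (p y) u = 0"
          obtain z where z: "u = h z" using h(2) by (metis surjD)
          then have "poly (p x) z = 0" using sgp[of z] u by (simp add: sgn_0_0)
          then have "u \<in> h ` Z" using z False that by (auto simp: Z_def)
          moreover have "same_gap (h ` Z) (h t) u"
            using same_gap_between[OF h'(4)[of t], of u]
              same_gap_between[OF same_gap_sym[OF h'(4)[of t]], of u] u
              same_gap_trans[OF h'(4)[of t]] by (auto simp: min_def max_def split: if_splits)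
          ultimately have "h t \<in> h ` Z" using same_gap_mem by blast
          then have "t \<in> Z" using h(1) by (metis imageE strict_mono_eq)
          then show False using nZ by simp
        qed
      qed
    qed
    then show ?thesis using sgp by simp
  qed
  then show ?thesis unfolding sign_equiv_def using h' by blast
qed

definition sign_determined :: "('a::euclidean_space \<Rightarrow> real poly) set \<Rightarrow> bool" where
  "sign_determined P \<longleftrightarrow> (\<exists>\<Phi>. finite \<Phi> \<and> (\<forall>\<phi>\<in>\<Phi>. real_polynomial_function \<phi>) \<and>
     (\<forall>x y. (\<forall>\<phi>\<in>\<Phi>. sgn (\<phi> x) = sgn (\<phi> y)) \<longrightarrow> sign_equiv P x y))"

text \<open>Induction on the multiset of sizes. A polynomial \<open>c\<close> of largest size is
  exchanged for its derivative and its pseudo-remainders modulo the derivative and the other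
  polynomials, all smaller than \<open>c\<close>. Where some top coefficient vanishes, the
  polynomial concerned is truncated instead.\<close>

lemma sign_determined_param_poly:
  fixes F :: "(nat \<times> ('a::euclidean_space \<Rightarrow> real poly)) list"
  assumes "\<And>n p. (n, p) \<in> set F \<Longrightarrow> param_poly n p"
  shows "sign_determined (snd ` set F)"
  using assms
proof (induction "image_mset fst (mset F)" arbitrary: F rule: less_induct)
  case (less F)
  show ?case
  proof (cases "\<forall>(n, p)\<in>set F. n \<le> 1")
    case True
    \<comment> \<open>All polynomials are constant in the variable, so their constant coefficients
      are the tests and the identity matches the signs.\<close>
    define \<Phi> where "\<Phi> = (\<lambda>(n, p) x. coeff (p x) 0) ` set F"
    have "sign_equiv (snd ` set F) x y" if "\<forall>\<phi>\<in>\<Phi>. sgn (\<phi> x) = sgn (\<phi> y)" for x y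
      unfolding sign_equiv_def
    proof (intro exI[of _ id] conjI ballI allI)
      fix p t assume "p \<in> snd ` set F"
      then obtain n where np: "(n, p) \<in> set F" by auto
      then have "(\<lambda>x. coeff (p x) 0) \<in> \<Phi>" by (force simp: \<Phi>_def)
      from bspec[OF that this] have "sgn (coeff (p x) 0) = sgn (coeff (p y) 0)" .
      moreover have "n \<le> 1" using True np by blast
      ultimately show "sgn (poly (p x) t) = sgn (poly (p y) (id t))"
        by (simp only: param_poly_const[OF less.prems[OF np]])
    qed (auto simp: strict_mono_def)
    moreover have "finite \<Phi>" "\<forall>\<phi>\<in>\<Phi>. real_polynomial_function \<phi>"
      using less.prems by (auto simp: \<Phi>_def param_poly_def)
    ultimately show ?thesis unfolding sign_determined_def by blast
  next
    case False
    define n where "n = Max (fst ` set F)"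
    have "F \<noteq> []" using False by auto
    then have "n \<in> fst ` set F" unfolding n_def by (intro Max_in) auto
    then obtain c where c: "(n, c) \<in> set F" by auto
    have nmax: "m \<le> n" if "(m, p) \<in> set F" for m p
    proof -
      have "m \<in> fst ` set F" using that by force
      then show ?thesis by (simp add: n_def)
    qed
    have "n \<ge> 2" using False nmax by force
    define rest where "rest = remove1 (n, c) F"
    have mF: "mset F = add_mset (n, c) (mset rest)"
      using c by (simp add: rest_def)
    have sF: "set F = insert (n, c) (set rest)"
      using mF by (metis set_mset_add_mset_insert set_mset_mset)
    note pc = less.prems[OF c]

    \<comment> \<open>Tests that settle the case where the top coefficient of \<open>d\<close>
      vanishes at both parameters; they come from the family with \<open>d\<close>
      truncated.\<close>
    define good where "good m d \<Phi> \<longleftrightarrow> finite \<Phi> \<and> (\<forall>\<phi>\<in>\<Phi>. real_polynomial_function \<phi>) \<and>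
        (\<forall>x y. (\<forall>\<phi>\<in>\<Phi>. sgn (\<phi> x) = sgn (\<phi> y)) \<longrightarrow> coeff (d x) m = 0 \<longrightarrow> coeff (d y) m = 0 \<longrightarrow>
           sign_equiv (snd ` set F) x y)" for m and d :: "'a \<Rightarrow> real poly" and \<Phi>
    have ex_good: "\<exists>\<Phi>. good m d \<Phi>"
      if d: "(Suc m, d) \<in> set F" for m d
    proof -
      define tr where "tr = (\<lambda>x. d x - monom (coeff (d x) m) m)"
      define G where "G = remove1 (Suc m, d) F"
      define F' where "F' = (m, tr) # G"
      have mF': "mset F = add_mset (Suc m, d) (mset G)"
        using d by (simp add: G_def)
      have sF': "set F = insert (Suc m, d) (set G)"
        using mF' by (metis set_mset_add_mset_insert set_mset_mset)
      have "image_mset fst (mset F') < image_mset fst (mset F)"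
        unfolding less_multiset_def mF' F'_def
        using one_step_implies_multp[of "{#Suc m#}" "{#m#}" "(<)" "image_mset fst (mset G)"]
        by simp
      moreover have "param_poly k p" if "(k, p) \<in> set F'" for k p
        using that param_poly_truncate[OF less.prems[OF d]] less.prems sF'
        unfolding F'_def tr_def by auto
      ultimately have "sign_determined (snd ` set F')" by (rule less.hyps)
      then obtain \<Phi> where \<Phi>: "finite \<Phi>" "\<forall>\<phi>\<in>\<Phi>. real_polynomial_function \<phi>"
        "\<forall>x y. (\<forall>\<phi>\<in>\<Phi>. sgn (\<phi> x) = sgn (\<phi> y)) \<longrightarrow> sign_equiv (snd ` set F') x y"
        unfolding sign_determined_def by (elim exE conjE)
      have "sign_equiv (snd ` set F) x y"
        if "sign_equiv (snd ` set F') x y" "coeff (d x) m = 0" "coeff (d y) m = 0" for x y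
      proof -
        have "tr x = d x" "tr y = d y" using that by (auto simp: tr_def)
        then show ?thesis using that(1) unfolding sign_equiv_def sF' F'_def by simp
      qed
      then show ?thesis using \<Phi> unfolding good_def by meson
    qed
    define \<Phi>1 where "\<Phi>1 m d = (SOME \<Phi>. good m d \<Phi>)" for m d
    have "good m d (\<Phi>1 m d)" if "(Suc m, d) \<in> set F" for m d
      unfolding \<Phi>1_def by (rule someI_ex[OF ex_good[OF that]])
    then have \<Phi>1: "(Suc m, d) \<in> set F \<Longrightarrow> finite (\<Phi>1 m d)"
      "(Suc m, d) \<in> set F \<Longrightarrow> \<phi> \<in> \<Phi>1 m d \<Longrightarrow> real_polynomial_function \<phi>"
      "\<lbrakk>(Suc m, d) \<in> set F; \<forall>\<phi>\<in>\<Phi>1 m d. sgn (\<phi> x) = sgn (\<phi> y); coeff (d x) m = 0; coeff (d y) m = 0\<rbrakk>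
          \<Longrightarrow> sign_equiv (snd ` set F) x y" for m d x y \<phi>
      unfolding good_def by simp_all

    define c' where "c' = (\<lambda>x. pderiv (c x))"
    have pc': "param_poly (n - 1) c'"
      using param_poly_pderiv[OF pc] by (simp add: c'_def)
    define D where "D = (n - 1, c') # rest"
    have pD: "param_poly m d" if "(m, d) \<in> set D" for m d
      using that pc' less.prems sF by (auto simp: D_def)
    define is_rem where "is_rem m d r \<longleftrightarrow> param_poly m r \<and> (\<exists>k. \<forall>x t. poly (d x) t = 0 \<longrightarrow>
        (coeff (d x) m ^ 2) ^ k * poly (c x) t = poly (r x) t)" for m and d r :: "'a \<Rightarrow> real poly"
    define rm where "rm m d = (SOME r. is_rem m d r)" for m d
    have ex_rem: "\<exists>r. is_rem m d r" if "(Suc m, d) \<in> set D" for m d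
      using param_poly_pseudo_remainder[OF pc pD[OF that]] unfolding is_rem_def by blast
    have "is_rem m d (rm m d)" if "(Suc m, d) \<in> set D" for m d
      unfolding rm_def by (rule someI_ex[OF ex_rem[OF that]])
    then have rm: "(Suc m, d) \<in> set D \<Longrightarrow> param_poly m (rm m d)"
      "(Suc m, d) \<in> set D \<Longrightarrow> \<exists>k. \<forall>x t. poly (d x) t = 0 \<longrightarrow>
        (coeff (d x) m ^ 2) ^ k * poly (c x) t = poly (rm m d x) t" for m d
      unfolding is_rem_def by simp_all
    \<comment> \<open>Divisors of size 0 are the zero polynomial and are skipped. A remainder is
      smaller than its divisor, and no divisor is larger than \<open>n\<close>, so all remainders
      are smaller than the removed \<open>c\<close>.\<close>
    define Rs where "Rs = map (\<lambda>(m, d). (m - 1, rm (m - 1) d)) (filter (\<lambda>(m, d). m > 0) D)"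
    define F2 where "F2 = rest @ (n - 1, c') # Rs"
    have Rs: "\<exists>k d. (Suc k, d) \<in> set D \<and> m = k \<and> r = rm k d" if "(m, r) \<in> set Rs" for m r
      using that unfolding Rs_def by (auto simp: gr0_conv_Suc)
    have "image_mset fst (mset F2) < image_mset fst (mset F)"
    proof -
      have "multp (<) (image_mset fst (mset rest) + image_mset fst (mset ((n - 1, c') # Rs)))
         (image_mset fst (mset rest) + {#n#})"
      proof (rule one_step_implies_multp)
        show "\<forall>k\<in>#image_mset fst (mset ((n - 1, c') # Rs)). \<exists>j\<in>#{#n#}. k < j"
        proof safe
          fix k assume "k \<in># image_mset fst (mset ((n - 1, c') # Rs))"
          then consider "k = n - 1" | r where "(k, r) \<in> set Rs" by auto
          then have "k < n"
          proof cases
            case 1 then show ?thesis using \<open>n \<ge> 2\<close> by simp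
          next
            case 2
            then obtain d where "(Suc k, d) \<in> set D" using Rs by blast
            then have "Suc k \<le> n" using nmax sF by (auto simp: D_def)
            then show ?thesis by simp
          qed
          then show "\<exists>j\<in>#{#n#}. k < j" by simp
        qed
      qed simp
      then show ?thesis unfolding less_multiset_def F2_def mF by simp
    qed
    moreover have "param_poly m p" if "(m, p) \<in> set F2" for m p
      using that pc' less.prems sF Rs[of m p] rm(1) by (auto simp: F2_def)
    ultimately have "sign_determined (snd ` set F2)" by (rule less.hyps)
    then obtain \<Phi>2 where \<Phi>2: "finite \<Phi>2" "\<forall>\<phi>\<in>\<Phi>2. real_polynomial_function \<phi>"
      "\<forall>x y. (\<forall>\<phi>\<in>\<Phi>2. sgn (\<phi> x) = sgn (\<phi> y)) \<longrightarrow> sign_equiv (snd ` set F2) x y"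
      unfolding sign_determined_def by (elim exE conjE)

    \<comment> \<open>The signs of the top coefficients in \<open>\<Phi>0\<close> tell whether a
      truncation applies; \<open>\<Phi>3\<close> collects the tests for the truncated families, and
      \<open>\<Phi>2\<close> those for the family with \<open>c\<close> exchanged.\<close>
    define \<Phi>0 where "\<Phi>0 = (\<lambda>(m, d) x. coeff (d x) (m - 1)) ` set F"
    define \<Phi>3 where "\<Phi>3 = (\<Union>z\<in>{z\<in>set F. fst z > 0}. \<Phi>1 (fst z - 1) (snd z))"
    have \<Phi>3: "\<phi> \<in> \<Phi>3 \<longleftrightarrow> (\<exists>m d. (Suc m, d) \<in> set F \<and> \<phi> \<in> \<Phi>1 m d)" for \<phi>
    proof
      assume "\<phi> \<in> \<Phi>3"
      then obtain z where z: "z \<in> set F" "fst z > 0" "\<phi> \<in> \<Phi>1 (fst z - 1) (snd z)"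
        by (auto simp: \<Phi>3_def)
      then have "(Suc (fst z - 1), snd z) \<in> set F" by simp
      then show "\<exists>m d. (Suc m, d) \<in> set F \<and> \<phi> \<in> \<Phi>1 m d" using z(3) by blast
    qed (force simp: \<Phi>3_def)
    have "finite \<Phi>0" by (simp add: \<Phi>0_def)
    moreover have "finite \<Phi>3"
      unfolding \<Phi>3_def
    proof (rule finite_UN_I)
      fix z assume "z \<in> {z \<in> set F. fst z > 0}"
      then have "(Suc (fst z - 1), snd z) \<in> set F" by simp
      then show "finite (\<Phi>1 (fst z - 1) (snd z))" by (rule \<Phi>1(1))
    qed simp
    moreover have "real_polynomial_function \<phi>" if \<phi>: "\<phi> \<in> \<Phi>0 \<union> \<Phi>2 \<union> \<Phi>3" for \<phi>
    proof -
      consider "\<phi> \<in> \<Phi>0" | "\<phi> \<in> \<Phi>2" | "\<phi> \<in> \<Phi>3" using \<phi> by blast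
      then show ?thesis
      proof cases
        case 1
        then show ?thesis using less.prems by (auto simp: \<Phi>0_def param_poly_def)
      next
        case 2
        then show ?thesis using \<Phi>2(2) by blast
      next
        case 3
        then show ?thesis using \<Phi>1(2) \<Phi>3 by blast
      qed
    qed
    moreover have "sign_equiv (snd ` set F) x y"
      if eq: "\<forall>\<phi>\<in>\<Phi>0 \<union> \<Phi>2 \<union> \<Phi>3. sgn (\<phi> x) = sgn (\<phi> y)" for x y
    proof (cases "\<exists>m d. (Suc m, d) \<in> set F \<and> coeff (d x) m = 0")
      case True
      then obtain m d where md: "(Suc m, d) \<in> set F" "coeff (d x) m = 0" by blast
      then have "(\<lambda>x. coeff (d x) m) \<in> \<Phi>0 \<union> \<Phi>2 \<union> \<Phi>3" by (force simp: \<Phi>0_def)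
      from bspec[OF eq this] have "sgn (coeff (d x) m) = sgn (coeff (d y) m)" .
      then have "coeff (d y) m = 0" using md by (simp add: sgn_0_0)
      moreover have "\<Phi>1 m d \<subseteq> \<Phi>3" using md \<Phi>3 by blast
      ultimately show ?thesis using \<Phi>1(3)[OF md(1) _ md(2)] eq by blast
    next
      case False
      have leadF: "coeff (d x) m \<noteq> 0 \<and> coeff (d y) m \<noteq> 0" if "(Suc m, d) \<in> set F" for m d
      proof -
        have "(\<lambda>x. coeff (d x) m) \<in> \<Phi>0 \<union> \<Phi>2 \<union> \<Phi>3" using that by (force simp: \<Phi>0_def)
        from bspec[OF eq this] have "sgn (coeff (d x) m) = sgn (coeff (d y) m)" .
        then show ?thesis using False that by (metis sgn_0_0)
      qed
      have lead: "coeff (d x) m \<noteq> 0 \<and> coeff (d y) m \<noteq> 0" if "(Suc m, d) \<in> set D" for m d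
      proof (cases "(Suc m, d) \<in> set rest")
        case True then show ?thesis using leadF sF by auto
      next
        case False
        then have "d = c'" "n = Suc (Suc m)" using that \<open>n \<ge> 2\<close> by (auto simp: D_def)
        then show ?thesis using leadF[of "Suc m" c] c by (auto simp: c'_def coeff_pderiv)
      qed
      have "sign_equiv (snd ` set F2) x y" using \<Phi>2(3) eq by blast
      moreover have "snd ` set F2 = insert (\<lambda>x. pderiv (c x)) (snd ` set rest \<union> snd ` set Rs)"
        by (auto simp: F2_def c'_def)
      ultimately have "sign_equiv (insert (\<lambda>x. pderiv (c x)) (snd ` set rest \<union> snd ` set Rs)) x y"
        by simp
      then have "sign_equiv (insert c (snd ` set rest)) x y"
      proof (rule sign_equiv_insert)
        \<comment> \<open>As \<open>n\<close> is at least 2, the formal top coefficient of the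
          derivative is \<open>n - 1\<close> times that of \<open>c\<close>, hence nonzero.\<close>
        have "(Suc (n - 2), c') \<in> set D" using \<open>n \<ge> 2\<close> by (simp add: D_def numeral_2_eq_2 Suc_diff_Suc)
        then show "pderiv (c x) \<noteq> 0" using lead unfolding c'_def by fastforce
        fix p assume p: "p \<in> insert (\<lambda>x. pderiv (c x)) (snd ` set rest)" "p x \<noteq> 0"
        then have "p \<in> snd ` set D" by (auto simp: D_def c'_def)
        then obtain m0 where m0: "(m0, p) \<in> set D" by auto
        have "m0 \<noteq> 0"
        proof
          assume "m0 = 0"
          then have "p x = 0" using param_polyD(2)[OF pD[OF m0]] by (intro poly_eqI) auto
          then show False using p by simp
        qed
        then obtain m where m: "m0 = Suc m" by (cases m0) auto
        then have mD: "(Suc m, p) \<in> set D" using m0 by simp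
        then obtain k where k: "\<forall>x t. poly (p x) t = 0 \<longrightarrow>
            (coeff (p x) m ^ 2) ^ k * poly (c x) t = poly (rm m p x) t"
          using rm(2) by blast
        have "(m, rm m p) \<in> set Rs"
          using mD unfolding Rs_def by (force simp: image_iff)
        then have "rm m p \<in> snd ` set Rs" by force
        moreover have "(coeff (p x) m ^ 2) ^ k > 0" "(coeff (p y) m ^ 2) ^ k > 0"
          using lead[OF mD] by auto
        ultimately show "\<exists>r\<in>snd ` set Rs. \<exists>C>0. \<exists>D>0.
             (\<forall>t. poly (p x) t = 0 \<longrightarrow> C * poly (c x) t = poly (r x) t) \<and>
             (\<forall>t. poly (p y) t = 0 \<longrightarrow> D * poly (c y) t = poly (r y) t)"
          using k by blast
      qed simp
      then show ?thesis by (simp add: sF)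
    qed
    ultimately show ?thesis
      using \<Phi>2(1) unfolding sign_determined_def
      by (intro exI[of _ "\<Phi>0 \<union> \<Phi>2 \<union> \<Phi>3"] conjI finite_UnI ballI allI impI) blast+
  qed
qed

text \<open>On the line through \<open>x\<close>, membership in a basic set depends only on signs of
  polynomials in \<open>t\<close>. A matching of these signs between \<open>x\<close> and
  \<open>y\<close> carries a witness \<open>t\<close> for \<open>x\<close> to the witness
  \<open>h t\<close> for \<open>y\<close>.\<close>

theorem semialgebraic_ex_line:
  fixes S :: "'a::euclidean_space set"
  assumes "semialgebraic S"
  shows "semialgebraic {x. \<exists>t. x + t *\<^sub>R b \<in> S}"
proof -
  have basic: "semialgebraic {x. \<exists>t. x + t *\<^sub>R b \<in> B}" if B0: "basic_semialgebraic B" for B :: "'a set"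
  proof -
    obtain P Qs where B: "real_polynomial_function P" "finite Qs" "\<forall>Q\<in>Qs. real_polynomial_function Q"
      "B = {x. P x = 0 \<and> (\<forall>Q\<in>Qs. Q x > 0)}"
      using B0 unfolding basic_semialgebraic_def by blast
    have "\<exists>n p. param_poly n p \<and> (\<forall>x t. Q (x + t *\<^sub>R b) = poly (p x) t)" if "Q \<in> insert P Qs" for Q
      using that B(1,3) param_poly_along_line by blast
    then obtain n p where np: "\<And>Q. Q \<in> insert P Qs \<Longrightarrow> param_poly (n Q) (p Q)"
      "\<And>Q x t. Q \<in> insert P Qs \<Longrightarrow> Q (x + t *\<^sub>R b) = poly (p Q x) t"
      by metis
    obtain L where L: "set L = insert P Qs" using B(2) finite_list by blast
    define F where "F = map (\<lambda>Q. (n Q, p Q)) L"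
    have "param_poly m q" if "(m, q) \<in> set F" for m q
      using that np L by (auto simp: F_def)
    then have "sign_determined (snd ` set F)" by (rule sign_determined_param_poly)
    then obtain \<Phi> where \<Phi>: "finite \<Phi>" "\<forall>\<phi>\<in>\<Phi>. real_polynomial_function \<phi>"
      "\<forall>x y. (\<forall>\<phi>\<in>\<Phi>. sgn (\<phi> x) = sgn (\<phi> y)) \<longrightarrow> sign_equiv (snd ` set F) x y"
      unfolding sign_determined_def by (elim exE conjE)
    show ?thesis
    proof (rule semialgebraic_sign_determined[OF \<Phi>(1)])
      fix x y assume "\<And>\<phi>. \<phi> \<in> \<Phi> \<Longrightarrow> sgn (\<phi> x) = sgn (\<phi> y)" and "x \<in> {x. \<exists>t. x + t *\<^sub>R b \<in> B}"
      then obtain t h where t: "x + t *\<^sub>R b \<in> B"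
        and h: "\<forall>q\<in>snd ` set F. \<forall>t. sgn (poly (q x) t) = sgn (poly (q y) (h t))"
        using \<Phi>(3) unfolding sign_equiv_def by blast
      have "sgn (Q (x + t *\<^sub>R b)) = sgn (Q (y + h t *\<^sub>R b))" if "Q \<in> insert P Qs" for Q
      proof -
        have "p Q \<in> snd ` set F" using that L by (force simp: F_def)
        then show ?thesis using bspec[OF h] np(2)[OF that] by metis
      qed
      then have "y + h t *\<^sub>R b \<in> B"
        using t unfolding B(4) by (auto simp: sgn_0_0) (metis sgn_0_0, metis sgn_greater)
      then show "y \<in> {x. \<exists>t. x + t *\<^sub>R b \<in> B}" by blast
    qed (use \<Phi> in auto)
  qed
  obtain A where A: "finite A" "\<forall>X\<in>A. basic_semialgebraic X" "S = \<Union>A"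
    using assms unfolding semialgebraic_def by blast
  have "{x. \<exists>t. x + t *\<^sub>R b \<in> S} = (\<Union>X\<in>A. {x. \<exists>t. x + t *\<^sub>R b \<in> X})"
    using A by auto
  then show ?thesis using A basic by (auto intro!: semialgebraic_UN)
qed

section \<open>Projections and first-order definable sets\<close>

lemma polynomial_function_bounded_linear_compose:
  assumes "bounded_linear h" "polynomial_function g"
  shows "polynomial_function (\<lambda>x. h (g x))"
  using polynomial_function_compose[OF assms(2) polynomial_function_bounded_linear[OF assms(1)]]
  by (simp add: o_def)

lemma polynomial_function_fst [intro]: "polynomial_function g \<Longrightarrow> polynomial_function (\<lambda>x. fst (g x))"
  and polynomial_function_snd [intro]: "polynomial_function g \<Longrightarrow> polynomial_function (\<lambda>x. snd (g x))"
  by (rule polynomial_function_bounded_linear_compose[OF bounded_linear_fst]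
      polynomial_function_bounded_linear_compose[OF bounded_linear_snd]; assumption)+

lemma polynomial_function_Pair [intro]:
  fixes f :: "'a::real_normed_vector \<Rightarrow> 'b::euclidean_space" and g :: "'a \<Rightarrow> 'c::euclidean_space"
  assumes "polynomial_function f" "polynomial_function g"
  shows "polynomial_function (\<lambda>x. (f x, g x))"
  using assms by (auto simp: polynomial_function_iff_Basis_inner Basis_prod_def)

lemma real_polynomial_function_inner [intro]:
  fixes f g :: "'a::real_normed_vector \<Rightarrow> 'b::euclidean_space"
  assumes "polynomial_function f" "polynomial_function g"
  shows "real_polynomial_function (\<lambda>x. inner (f x) (g x))"
proof -
  have "(\<lambda>x. inner (f x) (g x)) = (\<lambda>x. \<Sum>b\<in>Basis. inner (f x) b * inner (g x) b)"
    by (intro ext euclidean_inner)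
  moreover have "real_polynomial_function (\<lambda>x. \<Sum>b\<in>Basis. inner (f x) b * inner (g x) b)"
    using assms unfolding polynomial_function_iff_Basis_inner
    by (intro real_polynomial_function_sum real_polynomial_function.intros(4)) auto
  ultimately show ?thesis by simp
qed

lemma semialgebraic_vimage:
  fixes g :: "'a::euclidean_space \<Rightarrow> 'b::euclidean_space"
  assumes "polynomial_function g" "semialgebraic S"
  shows "semialgebraic {x. g x \<in> S}"
proof -
  have basic: "semialgebraic {x. g x \<in> B}" if B0: "basic_semialgebraic B" for B
  proof -
    obtain P Qs where B: "real_polynomial_function P" "finite Qs" "\<forall>Q\<in>Qs. real_polynomial_function Q"
      "B = {x. P x = 0 \<and> (\<forall>Q\<in>Qs. Q x > 0)}"
      using B0 unfolding basic_semialgebraic_def by blast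
    have "basic_semialgebraic {x. g x \<in> B}"
      unfolding basic_semialgebraic_def
      using B real_polynomial_function_compose[OF assms(1)]
      by (intro exI[of _ "P \<circ> g"] exI[of _ "(\<lambda>Q. Q \<circ> g) ` Qs"]) auto
    then show ?thesis by (rule semialgebraic_basic)
  qed
  obtain A where A: "finite A" "\<forall>X\<in>A. basic_semialgebraic X" "S = \<Union>A"
    using assms unfolding semialgebraic_def by blast
  have "{x. g x \<in> S} = (\<Union>X\<in>A. {x. g x \<in> X})" using A by auto
  then show ?thesis using A basic by (auto intro!: semialgebraic_UN)
qed

lemma semialgebraic_not: "semialgebraic {x. P x} \<Longrightarrow> semialgebraic {x. \<not> P x}"
  using semialgebraic_Compl[of "{x. P x}"] by (simp add: Collect_neg_eq)

lemma semialgebraic_conj: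
  "semialgebraic {x. P x} \<Longrightarrow> semialgebraic {x. Q x} \<Longrightarrow> semialgebraic {x. P x \<and> Q x}"
  using semialgebraic_Int[of "{x. P x}" "{x. Q x}"] by (simp add: Collect_conj_eq)

lemma semialgebraic_imp:
  "semialgebraic {x. P x} \<Longrightarrow> semialgebraic {x. Q x} \<Longrightarrow> semialgebraic {x. P x \<longrightarrow> Q x}"
  using semialgebraic_not[OF semialgebraic_conj[of P "\<lambda>x. \<not> Q x"]] semialgebraic_not[of Q] by simp

lemma semialgebraic_less:
  assumes "real_polynomial_function f" "real_polynomial_function g"
  shows "semialgebraic {x. f x < g x}"
  using semialgebraic_gt_0[OF real_polynomial_function_diff[OF assms(2,1)]] by simp

lemma semialgebraic_le:
  assumes "real_polynomial_function f" "real_polynomial_function g"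
  shows "semialgebraic {x. f x \<le> g x}"
  using semialgebraic_not[OF semialgebraic_less[OF assms(2,1)]] by (simp add: not_less)

lemma semialgebraic_eq:
  assumes "real_polynomial_function f" "real_polynomial_function g"
  shows "semialgebraic {x. f x = g x}"
  using semialgebraic_eq_0[OF real_polynomial_function_diff[OF assms]] by simp

text \<open>The second component is shifted by the span of a growing set of basis vectors, each of
  which costs one elimination along a line. The outcome is sliced at second component 0.\<close>

theorem semialgebraic_ex:
  fixes P :: "'a::euclidean_space \<Rightarrow> 'b::euclidean_space \<Rightarrow> bool"
  assumes "semialgebraic {z. P (fst z) (snd z)}"
  shows "semialgebraic {x. \<exists>y. P x y}"
proof -
  define S where "S = {z. P (fst z) (snd z)}"
  have "semialgebraic {z. \<exists>w\<in>span B. z + (0, w) \<in> S}" if "finite B" for B :: "'b set"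
    using that
  proof induction
    case empty
    show ?case using assms by (simp add: S_def flip: zero_prod_def)
  next
    case (insert b B)
    have "{z. \<exists>w\<in>span (insert b B). z + (0, w) \<in> S} =
          {z. \<exists>t. z + t *\<^sub>R (0, b) \<in> {z. \<exists>w\<in>span B. z + (0, w) \<in> S}}" (is "?L = ?R")
    proof (intro set_eqI iffI)
      fix z assume "z \<in> ?L"
      then obtain w where w: "w \<in> span (insert b B)" "z + (0, w) \<in> S" by blast
      then obtain t where t: "w - t *\<^sub>R b \<in> span B" using span_breakdown_eq by metis
      have "z + t *\<^sub>R (0, b) + (0, w - t *\<^sub>R b) = z + (0, w)"
        by (simp add: add.assoc)
      then show "z \<in> ?R" using w(2) t by (metis (mono_tags, lifting) mem_Collect_eq)
    next
      fix z assume "z \<in> ?R"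
      then obtain t w where w: "w \<in> span B" "z + t *\<^sub>R (0, b) + (0, w) \<in> S" by blast
      then have "w + t *\<^sub>R b \<in> span (insert b B)"
        using span_breakdown_eq[of "w + t *\<^sub>R b" b B] by (metis add_diff_cancel_right')
      moreover have "z + t *\<^sub>R (0, b) + (0, w) = z + (0, w + t *\<^sub>R b)"
        by (simp add: add.assoc add.commute)
      ultimately show "z \<in> ?L" using w(2) by (metis (mono_tags, lifting) mem_Collect_eq)
    qed
    then show ?case using semialgebraic_ex_line[OF insert.IH, of "(0, b)"] by simp
  qed
  from this[of Basis] have "semialgebraic {z :: 'a \<times> 'b. \<exists>w. z + (0, w) \<in> S}"
    by simp
  then have "semialgebraic {x :: 'a. (x, 0 :: 'b) \<in> {z. \<exists>w. z + (0, w) \<in> S}}"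
    by (rule semialgebraic_vimage[rotated]) auto
  then show ?thesis by (simp add: S_def)
qed

lemma semialgebraic_all:
  fixes P :: "'a::euclidean_space \<Rightarrow> 'b::euclidean_space \<Rightarrow> bool"
  assumes "semialgebraic {z. P (fst z) (snd z)}"
  shows "semialgebraic {x. \<forall>y. P x y}"
  using semialgebraic_not[OF semialgebraic_ex[OF semialgebraic_not[OF assms]]] by simp

lemma semialgebraic_fst_image:
  fixes S :: "('a::euclidean_space \<times> 'b::euclidean_space) set"
  assumes "semialgebraic S" shows "semialgebraic (fst ` S)"
proof -
  have "fst ` S = {x. \<exists>y. (x, y) \<in> S}" by force
  then show ?thesis using semialgebraic_ex[of "\<lambda>x y. (x, y) \<in> S"] assms by simp
qed

text \<open>A set given by a first-order formula over polynomial equations and inequalities is shown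
  semialgebraic by following the syntax of the formula.\<close>

lemmas semialgebraic_intros =
  semialgebraic_not semialgebraic_conj semialgebraic_imp semialgebraic_ex semialgebraic_all
  semialgebraic_less semialgebraic_le semialgebraic_eq

lemma real_polynomial_function_fst: "polynomial_function g \<Longrightarrow> real_polynomial_function (\<lambda>x. fst (g x))"
  and real_polynomial_function_snd: "polynomial_function h \<Longrightarrow> real_polynomial_function (\<lambda>x. snd (h x))"
  and real_polynomial_function_id: "real_polynomial_function (\<lambda>x. x)"
  using polynomial_function_fst[of g] polynomial_function_snd[of h]
  by (auto simp: real_polynomial_function_eq)

lemmas polynomial_intros =
  polynomial_function_fst polynomial_function_snd polynomial_function_Pair
  polynomial_function_add polynomial_function_diff polynomial_function_const polynomial_function_id
  polynomial_function_minus polynomial_function_mult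
  real_polynomial_function_inner real_polynomial_function_diff real_polynomial_function_power
  real_polynomial_function.intros(2-4) real_polynomial_function_minus
  real_polynomial_function_fst real_polynomial_function_snd real_polynomial_function_id

lemma dist_less_iff_inner:
  fixes x y :: "'a::real_inner"
  assumes "r > 0"
  shows "dist x y < r \<longleftrightarrow> inner (x - y) (x - y) < r^2"
proof -
  have "dist x y < r \<longleftrightarrow> norm (x - y) ^ 2 < r ^ 2"
    using assms power2_less_imp_less[of "norm (x - y)" r] power_strict_mono[of "norm (x - y)" r 2]
    by (auto simp: dist_norm)
  then show ?thesis by (simp add: power2_norm_eq_inner)
qed

lemma semialgebraic_ball:
  assumes "r > 0"
  shows "semialgebraic (ball x r :: 'a::euclidean_space set)"
proof -
  have "ball x r = {y. inner (x - y) (x - y) < r^2}"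
    by (simp add: ball_def dist_less_iff_inner[OF assms])
  moreover have "semialgebraic {y. inner (x - y) (x - y) < r^2}"
    by (intro semialgebraic_less polynomial_intros)
  ultimately show ?thesis by simp
qed

lemma semialgebraic_closure:
  fixes S :: "'a::euclidean_space set"
  assumes "semialgebraic S" shows "semialgebraic (closure S)"
proof -
  have "closure S = {x. \<forall>r::real. 0 < r \<longrightarrow> (\<exists>y. y \<in> S \<and> inner (y - x) (y - x) < r^2)}"
    by (auto simp: closure_approachable dist_less_iff_inner Bex_def)
  moreover have "semialgebraic {x. \<forall>r::real. 0 < r \<longrightarrow> (\<exists>y. y \<in> S \<and> inner (y - x) (y - x) < r^2)}"
    by (intro semialgebraic_intros semialgebraic_vimage[OF _ assms] polynomial_intros)
  ultimately show ?thesis by simp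
qed

section \<open>Thin semialgebraic sets\<close>

text \<open>On the line from a point of \<open>U\<close> through \<open>y\<close> the polynomial has
  infinitely many roots near that point, so it vanishes on the whole line.\<close>

lemma real_polynomial_function_eq_0_on_open:
  fixes P :: "'a::euclidean_space \<Rightarrow> real"
  assumes P: "real_polynomial_function P" and "open U" "U \<noteq> {}" and z: "\<And>x. x \<in> U \<Longrightarrow> P x = 0"
  shows "P y = 0"
proof -
  obtain x where "x \<in> U" using assms by blast
  obtain e where e: "e > 0" "ball x e \<subseteq> U" using \<open>x \<in> U\<close> \<open>open U\<close> openE by blast
  obtain n p where p: "\<And>w t. P (w + t *\<^sub>R (y - x)) = poly (p w) t"
    using param_poly_along_line[OF P, of "y - x"] by blast
  \<comment> \<open>Keeps the points of the line inside the ball; the added 1 covers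
    \<open>y = x\<close>.\<close>
  define d where "d = e / (norm (y - x) + 1)"
  have "d > 0" using e by (simp add: d_def add_nonneg_pos)
  have "{0<..<d} \<subseteq> {t. poly (p x) t = 0}"
  proof safe
    fix t :: real assume t: "t \<in> {0<..<d}"
    have "t * norm (y - x) \<le> t * (norm (y - x) + 1)" using t by (simp add: mult_left_mono)
    also have "\<dots> < e" using t by (simp add: d_def pos_less_divide_eq add_nonneg_pos)
    finally have "x + t *\<^sub>R (y - x) \<in> ball x e" using t by (simp add: dist_norm)
    then show "poly (p x) t = 0" using p z e by (metis subsetD)
  qed
  then have "infinite {t. poly (p x) t = 0}"
    using \<open>d > 0\<close> finite_subset infinite_Ioo by blast
  then have "p x = 0" using poly_roots_finite by blast
  then show ?thesis using p[of x 1] by simp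
qed

text \<open>For a semialgebraic set this is equivalent to empty interior; it is the form of
  smallness from which a cover by hypersurfaces can be built.\<close>

definition thin :: "'a::euclidean_space set \<Rightarrow> bool" where
  "thin A \<longleftrightarrow> (\<exists>P. real_polynomial_function P \<and> (\<exists>x. P x \<noteq> 0) \<and> A \<subseteq> {x. P x = 0})"

lemma thin_subset: "thin B \<Longrightarrow> A \<subseteq> B \<Longrightarrow> thin A"
  unfolding thin_def by blast

lemma thin_empty [simp]: "thin {}"
  unfolding thin_def by (rule exI[of _ "\<lambda>x. 1"]) auto

lemma thin_eq_0:
  assumes "real_polynomial_function P" "P x \<noteq> 0" shows "thin {x. P x = 0}"
  using assms unfolding thin_def by blast

lemma continuous_real_polynomial: "real_polynomial_function P \<Longrightarrow> continuous_on S P"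
  for P :: "'a::euclidean_space \<Rightarrow> real"
  by (simp add: continuous_on_polymonial_function real_polynomial_function_eq)

lemma open_gt_0: "real_polynomial_function P \<Longrightarrow> open {x. P x > 0}"
  and closed_eq_0: "real_polynomial_function P \<Longrightarrow> closed {x. P x = 0}"
  and open_ne_0: "real_polynomial_function P \<Longrightarrow> open {x. P x \<noteq> 0}"
  for P :: "'a::euclidean_space \<Rightarrow> real"
  using continuous_real_polynomial[of P UNIV]
  by (auto intro!: open_Collect_less closed_Collect_eq open_Collect_neq)

lemma thin_interior: "thin A \<Longrightarrow> interior A = {}"
  unfolding thin_def
  using real_polynomial_function_eq_0_on_open[OF _ open_interior] interior_subset
  by (metis (mono_tags, lifting) mem_Collect_eq subset_iff)

lemma thin_Un:
  assumes "thin A" "thin B" shows "thin (A \<union> B)"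
proof -
  obtain P Q x y where P: "real_polynomial_function P" "P x \<noteq> 0" "A \<subseteq> {x. P x = 0}"
    and Q: "real_polynomial_function Q" "Q y \<noteq> 0" "B \<subseteq> {x. Q x = 0}"
    using assms unfolding thin_def by blast
  have "\<exists>z. P z * Q z \<noteq> 0"
  proof (rule ccontr)
    assume "\<not> (\<exists>z. P z * Q z \<noteq> 0)"
    then have "Q z = 0" if "z \<in> {z. P z \<noteq> 0}" for z using that by auto
    then have "Q y = 0"
      using real_polynomial_function_eq_0_on_open[OF Q(1) open_ne_0[OF P(1)]] P(2) by blast
    then show False using Q by simp
  qed
  then show ?thesis
    unfolding thin_def using P Q by (intro exI[of _ "\<lambda>x. P x * Q x"]) auto
qed

lemma thin_UN: "finite I \<Longrightarrow> (\<And>i. i \<in> I \<Longrightarrow> thin (A i)) \<Longrightarrow> thin (\<Union>i\<in>I. A i)"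
  by (induction I rule: finite_induct) (auto intro: thin_Un)

text \<open>A basic piece whose equation is trivial is open, hence empty; any other piece lies in
  the zero set of its equation.\<close>

lemma semialgebraic_empty_interior_thin:
  fixes A :: "'a::euclidean_space set"
  assumes "semialgebraic A" "interior A = {}" shows "thin A"
proof -
  have basic: "thin B" if B0: "basic_semialgebraic B" and BA: "B \<subseteq> A" for B
  proof -
    obtain P Qs where B: "real_polynomial_function P" "finite Qs" "\<forall>Q\<in>Qs. real_polynomial_function Q"
      "B = {x. P x = 0 \<and> (\<forall>Q\<in>Qs. Q x > 0)}"
      using B0 unfolding basic_semialgebraic_def by blast
    show ?thesis
    proof (cases "\<forall>x. P x = 0")
      case True
      then have "B = (\<Inter>Q\<in>Qs. {x. Q x > 0})" using B by auto
      moreover have "open (\<Inter>Q\<in>Qs. {x. Q x > 0})"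
        using B(2,3) open_gt_0 by (intro open_INT) auto
      ultimately have "open B" by simp
      then have "B = {}" using BA assms(2) interior_maximal by blast
      then show ?thesis by simp
    next
      case False
      then show ?thesis using B unfolding thin_def by blast
    qed
  qed
  obtain F where F: "finite F" "\<forall>X\<in>F. basic_semialgebraic X" "A = \<Union>F"
    using assms unfolding semialgebraic_def by blast
  then show ?thesis using thin_UN[of F "\<lambda>X. X"] basic by auto
qed

text \<open>A limit of points of a basic set still satisfies the equation and the weak inequalities,
  so if it leaves the set, some strict inequality has become an equality. A polynomial that is
  positive somewhere is not zero, so this equality describes a thin set.\<close>

lemma semialgebraic_thin_boundary:
  fixes A :: "'a::euclidean_space set"
  assumes "semialgebraic A" shows "thin (closure A - A)"
proof -
  have basic: "thin (closure B - B)" if B0: "basic_semialgebraic B" for B :: "'a set"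
  proof (cases "B = {}")
    case False
    obtain P Qs where B: "real_polynomial_function P" "finite Qs" "\<forall>Q\<in>Qs. real_polynomial_function Q"
      "B = {x. P x = 0 \<and> (\<forall>Q\<in>Qs. Q x > 0)}"
      using B0 unfolding basic_semialgebraic_def by blast
    have cP: "closure B \<subseteq> {x. P x = 0}"
      using B closed_eq_0[OF B(1)] by (intro closure_minimal) auto
    have "thin {x. Q x = 0}" if "Q \<in> Qs" for Q
      using thin_eq_0 that B False by fastforce
    then have "thin (\<Union>Q\<in>Qs. {x. Q x = 0})" by (rule thin_UN[OF B(2)])
    moreover have "closure B - B \<subseteq> (\<Union>Q\<in>Qs. {x. Q x = 0})"
    proof safe
      fix x assume x: "x \<in> closure B" "x \<notin> B"
      have "Q x \<ge> 0" if "Q \<in> Qs" for Q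
      proof -
        have "closed {x. 0 \<le> Q x}"
          using B(3) that continuous_real_polynomial[of Q UNIV] by (auto intro!: closed_Collect_le)
        then have "closure B \<subseteq> {x. 0 \<le> Q x}"
          using B that by (intro closure_minimal) (auto intro: less_imp_le)
        then show ?thesis using x by auto
      qed
      moreover obtain Q where "Q \<in> Qs" "\<not> Q x > 0" using x cP B(4) by auto
      ultimately show "x \<in> (\<Union>Q\<in>Qs. {x. Q x = 0})" by (force simp: not_less)
    qed
    ultimately show ?thesis using thin_subset by blast
  qed simp
  obtain F where F: "finite F" "\<forall>X\<in>F. basic_semialgebraic X" "A = \<Union>F"
    using assms unfolding semialgebraic_def by blast
  have "closure A \<subseteq> (\<Union>X\<in>F. closure X)"
    using F closure_subset by (intro closure_minimal closed_UN) auto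
  then have "closure A - A \<subseteq> (\<Union>X\<in>F. closure X - X)"
    using F by blast
  moreover have "thin (\<Union>X\<in>F. closure X - X)" using F basic by (intro thin_UN) auto
  ultimately show ?thesis using thin_subset by blast
qed

section \<open>Countable unions of thin sets\<close>

lemma countable_Union_thin_interior:
  fixes \<T> :: "'a::euclidean_space set set"
  assumes "countable \<T>" "\<And>T. T \<in> \<T> \<Longrightarrow> thin T"
  shows "interior (\<Union>\<T>) = {}"
proof -
  have "\<exists>Z. closed Z \<and> interior Z = {} \<and> T \<subseteq> Z" if T: "T \<in> \<T>" for T
  proof -
    obtain P x where P: "real_polynomial_function P" "P x \<noteq> 0" "T \<subseteq> {x. P x = 0}"
      using assms(2)[OF T] unfolding thin_def by blast
    then show ?thesis using closed_eq_0[OF P(1)] thin_interior[OF thin_eq_0[OF P(1,2)]] by blast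
  qed
  then obtain Z where Z: "\<And>T. T \<in> \<T> \<Longrightarrow> closed (Z T) \<and> interior (Z T) = {} \<and> T \<subseteq> Z T"
    by metis
  have "UNIV \<subseteq> closure (\<Inter>((\<lambda>T. - Z T) ` \<T>))"
    using assms(1) Z by (intro Baire) (auto simp: closure_complement)
  then have "interior (\<Union>T\<in>\<T>. Z T) = {}"
    by (auto simp: closure_complement simp flip: Compl_UN)
  moreover have "\<Union>\<T> \<subseteq> (\<Union>T\<in>\<T>. Z T)" using Z by blast
  ultimately show ?thesis using interior_mono by blast
qed

text \<open>Stronger than topological meagreness. Countable covers are needed because exceptional
  parameters are collected over a countable family of balls and over all rational intervals.\<close>

definition meagre :: "'a::euclidean_space set \<Rightarrow> bool" where
  "meagre A \<longleftrightarrow> (\<exists>\<T>. countable \<T> \<and> (\<forall>T\<in>\<T>. thin T) \<and> A \<subseteq> \<Union>\<T>)"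

lemma meagre_interior: "meagre A \<Longrightarrow> interior A = {}"
  unfolding meagre_def using countable_Union_thin_interior interior_mono by blast

lemma meagre_subset: "meagre B \<Longrightarrow> A \<subseteq> B \<Longrightarrow> meagre A"
  unfolding meagre_def by (meson order_trans)

lemma meagre_countable_UN:
  assumes "countable I" "\<And>i. i \<in> I \<Longrightarrow> thin (A i)"
  shows "meagre (\<Union>i\<in>I. A i)"
  unfolding meagre_def using assms by (intro exI[of _ "A ` I"]) auto

lemma meagre_Un:
  assumes "meagre A" "meagre B" shows "meagre (A \<union> B)"
proof -
  obtain S where S: "countable S" "\<forall>X\<in>S. thin X" "A \<subseteq> \<Union>S"
    using assms(1) unfolding meagre_def by (elim exE conjE)
  obtain T where T: "countable T" "\<forall>X\<in>T. thin X" "B \<subseteq> \<Union>T"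
    using assms(2) unfolding meagre_def by (elim exE conjE)
  show ?thesis
    unfolding meagre_def
  proof (intro exI[of _ "S \<union> T"] conjI)
    show "A \<union> B \<subseteq> \<Union>(S \<union> T)" using S(3) T(3) by blast
  qed (use S T in auto)
qed

section \<open>Closures commute with generic fibres\<close>

text \<open>If \<open>x\<close> has positive distance from the fibre over \<open>v\<close>, some
  small ball of a countable family contains \<open>x\<close> and misses that fibre. The projection
  of the part of \<open>S\<close> over this ball then has \<open>v\<close> in its closure but not in
  itself, which confines \<open>v\<close> to a thin set.\<close>

lemma meagre_closure_fibre:
  fixes S :: "('a::euclidean_space \<times> 'b::euclidean_space) set"
  assumes "semialgebraic S"
  shows "meagre {v. \<exists>x. (v, x) \<in> closure S \<and> x \<notin> closure {x. (v, x) \<in> S}}"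
proof -
  obtain D :: "'b set" where D: "countable D" "\<And>X. open X \<Longrightarrow> X \<noteq> {} \<Longrightarrow> \<exists>d\<in>D. d \<in> X"
    using countable_dense_setE by blast
  define A where "A z = fst ` (S \<inter> UNIV \<times> ball (fst z) (1 / real (Suc (snd z))))" for z :: "'b \<times> nat"
  have "semialgebraic (UNIV \<times> ball d r :: ('a \<times> 'b) set)" if "r > 0" for d r
  proof -
    have "semialgebraic {z :: 'a \<times> 'b. snd z \<in> ball d r}"
      by (rule semialgebraic_vimage[OF polynomial_function_snd[OF polynomial_function_id] semialgebraic_ball[OF that]])
    moreover have "{z :: 'a \<times> 'b. snd z \<in> ball d r} = UNIV \<times> ball d r" by auto
    ultimately show ?thesis by simp
  qed
  then have "semialgebraic (A z)" for z
    unfolding A_def by (intro semialgebraic_fst_image semialgebraic_Int assms) auto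
  then have "meagre (\<Union>z\<in>D \<times> UNIV. closure (A z) - A z)"
    using D by (intro meagre_countable_UN semialgebraic_thin_boundary) auto
  moreover have "{v. \<exists>x. (v, x) \<in> closure S \<and> x \<notin> closure {x. (v, x) \<in> S}} \<subseteq>
      (\<Union>z\<in>D \<times> UNIV. closure (A z) - A z)"
  proof safe
    fix v x assume v: "(v, x) \<in> closure S" "x \<notin> closure {x. (v, x) \<in> S}"
    then obtain e where e: "e > 0" "\<And>y. (v, y) \<in> S \<Longrightarrow> \<not> dist y x < e"
      unfolding closure_approachable by auto
    \<comment> \<open>A ball of radius below \<open>e / 2\<close> that contains \<open>x\<close>
      lies within distance \<open>e\<close> of \<open>x\<close>.\<close>
    obtain n where n: "1 / real (Suc n) < e / 2" using e(1) nat_approx_posE[of "e / 2"] by auto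
    obtain d where d: "d \<in> D" "d \<in> ball x (1 / real (Suc n))"
      using D(2)[of "ball x (1 / real (Suc n))"] by auto
    have "v \<notin> A (d, n)"
    proof
      assume "v \<in> A (d, n)"
      then obtain y where y: "(v, y) \<in> S" "dist d y < 1 / real (Suc n)" by (auto simp: A_def)
      have "dist y x \<le> dist d y + dist x d" using dist_triangle[of y x d] by (simp add: dist_commute)
      then have "dist y x < e" using y d n by auto
      then show False using e y by blast
    qed
    moreover have "v \<in> closure (A (d, n))"
    proof -
      let ?U = "UNIV \<times> ball d (1 / real (Suc n)) :: ('a \<times> 'b) set"
      have "(v, x) \<in> ?U \<inter> closure S" using v(1) d by (auto simp: dist_commute)
      then have "(v, x) \<in> closure (?U \<inter> S)"
        using open_Int_closure_subset[of ?U S] by (auto simp: open_Times)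
      then have "fst (v, x) \<in> closure (fst ` (?U \<inter> S))"
        using closure_bounded_linear_image_subset[OF bounded_linear_fst] by blast
      then show ?thesis by (simp add: A_def Int_commute)
    qed
    ultimately show "v \<in> (\<Union>z\<in>D \<times> UNIV. closure (A z) - A z)" using d by blast
  qed
  ultimately show ?thesis using meagre_subset by blast
qed

section \<open>Lipschitz sections of projections\<close>

lemma real_polynomial_function_lipschitz_on:
  fixes P :: "'a::euclidean_space \<Rightarrow> real"
  assumes "real_polynomial_function P" "compact K"
  shows "\<exists>L. L-lipschitz_on K P"
  using assms(1)
proof induction
  case (linear f)
  then obtain B where B: "\<And>x. norm (f x) \<le> norm x * B" "B > 0"
    using bounded_linear.pos_bounded by blast
  have "B-lipschitz_on K f"
  proof (rule lipschitz_onI)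
    show "dist (f x) (f y) \<le> B * dist x y" for x y
      using B(1)[of "x - y"] linear by (simp add: dist_norm linear_diff bounded_linear.linear mult.commute)
  qed (use B in auto)
  then show ?case by blast
next
  case (const c)
  then show ?case by (metis lipschitz_on_constant)
next
  case (add f g)
  then obtain L M where "L-lipschitz_on K f" "M-lipschitz_on K g" by blast
  from lipschitz_on_add[OF this] show ?case by blast
next
  case (mult f g)
  then obtain Lf Lg where L: "Lf-lipschitz_on K f" "Lg-lipschitz_on K g" by blast
  have bd: "\<exists>M\<ge>0. \<forall>x\<in>K. \<bar>h x\<bar> \<le> M" if "real_polynomial_function h" for h
  proof -
    have "bounded (h ` K)"
      using compact_continuous_image[OF continuous_real_polynomial[OF that] assms(2)]
      by (rule compact_imp_bounded)
    then obtain M where "\<forall>y\<in>h ` K. \<bar>y\<bar> \<le> M" unfolding bounded_iff by auto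
    then show ?thesis by (intro exI[of _ "max 0 M"]) auto
  qed
  obtain M N where M: "M \<ge> 0" "\<And>x. x \<in> K \<Longrightarrow> \<bar>f x\<bar> \<le> M" and N: "N \<ge> 0" "\<And>x. x \<in> K \<Longrightarrow> \<bar>g x\<bar> \<le> N"
    using bd[OF mult.hyps(1)] bd[OF mult.hyps(2)] by blast
  have "(M * Lg + N * Lf)-lipschitz_on K (\<lambda>x. f x * g x)"
  proof (rule lipschitz_onI)
    fix x y assume xy: "x \<in> K" "y \<in> K"
    have "\<bar>f x * g x - f y * g y\<bar> = \<bar>f x * (g x - g y) + g y * (f x - f y)\<bar>"
      by (simp add: algebra_simps)
    also have "\<dots> \<le> \<bar>f x\<bar> * \<bar>g x - g y\<bar> + \<bar>g y\<bar> * \<bar>f x - f y\<bar>"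
      by (metis abs_mult abs_triangle_ineq)
    also have "\<dots> \<le> M * (Lg * dist x y) + N * (Lf * dist x y)"
      using xy M N lipschitz_onD[OF L(1) xy] lipschitz_onD[OF L(2) xy]
      by (intro add_mono mult_mono) (auto simp: dist_real_def)
    finally show "dist (f x * g x) (f y * g y) \<le> (M * Lg + N * Lf) * dist x y"
      by (simp add: dist_real_def algebra_simps)
  next
    show "0 \<le> M * Lg + N * Lf"
      using M N L lipschitz_on_nonneg by (metis add_nonneg_nonneg mult_nonneg_nonneg)
  qed
  then show ?case by blast
qed

text \<open>On a box where \<open>D\<close> exceeds half its value at the base point,
  \<open>P\<close> grows in \<open>t\<close> with slope at least \<open>c\<close>. This yields a
  root between ends of opposite sign, its uniqueness, and the Lipschitz constant. Uniqueness within
  the window is part of the conclusion because it later describes the graph by polynomial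
  conditions.\<close>

lemma scalar_implicit_function_pos:
  fixes P D :: "'a::euclidean_space \<times> real \<Rightarrow> real"
  assumes P: "real_polynomial_function P" and D: "real_polynomial_function D"
    and der: "\<And>u t. ((\<lambda>t. P (u, t)) has_real_derivative D (u, t)) (at t)"
    and z: "P (u0, t0) = 0" and pos: "D (u0, t0) > 0" and W: "open W" "(u0, t0) \<in> W"
  shows "\<exists>\<delta>>0. \<exists>\<epsilon>>0. \<exists>\<phi> L. L-lipschitz_on (ball u0 \<delta>) \<phi> \<and>
    (\<forall>u\<in>ball u0 \<delta>. (u, \<phi> u) \<in> W \<and> P (u, \<phi> u) = 0 \<and> \<bar>\<phi> u - t0\<bar> < \<epsilon> \<and>
       (\<forall>t. \<bar>t - t0\<bar> < \<epsilon> \<longrightarrow> P (u, t) = 0 \<longrightarrow> t = \<phi> u))"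
proof -
  define c where "c = D (u0, t0) / 2"
  have "c > 0" using pos by (simp add: c_def)
  have "open {z. D z > c}"
    using continuous_real_polynomial[OF D, of UNIV] by (intro open_Collect_less) auto
  then have "open (W \<inter> {z. D z > c})" using W by blast
  moreover have "(u0, t0) \<in> W \<inter> {z. D z > c}" using W pos by (simp add: c_def)
  ultimately obtain A B where AB: "open A" "open B" "u0 \<in> A" "t0 \<in> B" "A \<times> B \<subseteq> W \<inter> {z. D z > c}"
    by (metis open_prod_elim mem_Sigma_iff)
  obtain \<epsilon> where \<epsilon>: "\<epsilon> > 0" "cball t0 \<epsilon> \<subseteq> B" using AB open_contains_cball by blast
  obtain \<delta>1 where \<delta>1: "\<delta>1 > 0" "cball u0 \<delta>1 \<subseteq> A" using AB open_contains_cball by blast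
  have box: "(u, t) \<in> W" "D (u, t) > c" if "u \<in> cball u0 \<delta>1" "t \<in> cball t0 \<epsilon>" for u t
  proof -
    have "(u, t) \<in> A \<times> B" using that \<epsilon>(2) \<delta>1(2) by blast
    then show "(u, t) \<in> W" "D (u, t) > c" using AB(5) by blast+
  qed
  have mvt: "P (u, t) - P (u, s) \<ge> c * (t - s)"
    if u: "u \<in> cball u0 \<delta>1" and st: "s \<in> cball t0 \<epsilon>" "t \<in> cball t0 \<epsilon>" "s \<le> t" for u s t
  proof (cases "s = t")
    case False
    then have "s < t" using st by simp
    then obtain r where r: "s < r" "r < t" "P (u, t) - P (u, s) = (t - s) * D (u, r)"
      using MVT2[of s t "\<lambda>t. P (u, t)" "\<lambda>t. D (u, t)"] der by auto
    have "r \<in> cball t0 \<epsilon>" using r st by (auto simp: dist_real_def)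
    then have "D (u, r) \<ge> c" using box(2)[OF u] by (meson less_imp_le)
    then have "(t - s) * c \<le> (t - s) * D (u, r)" using \<open>s < t\<close> by (intro mult_left_mono) auto
    then show ?thesis using r(3) by (simp add: mult.commute)
  qed simp
  have ends: "t0 - \<epsilon> \<in> cball t0 \<epsilon>" "t0 + \<epsilon> \<in> cball t0 \<epsilon>" "t0 \<in> cball t0 \<epsilon>" "u0 \<in> cball u0 \<delta>1"
    using \<epsilon>(1) \<delta>1(1) by (auto simp: dist_real_def)
  have "c * \<epsilon> > 0" using \<open>c > 0\<close> \<epsilon>(1) by simp
  then have "u0 \<in> {u. P (u, t0 + \<epsilon>) > 0}" "u0 \<in> {u. P (u, t0 - \<epsilon>) < 0}"
    using mvt[OF ends(4,3,2)] mvt[OF ends(4,1,3)] z \<epsilon>(1) by auto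
  moreover have "open {u. P (u, t0 + \<epsilon>) > 0}" "open {u. P (u, t0 - \<epsilon>) < 0}"
    by (intro open_Collect_less continuous_intros continuous_on_compose2[OF continuous_real_polynomial[OF P, of UNIV]]; simp)+
  ultimately have "\<exists>\<delta>>0. ball u0 \<delta> \<subseteq> {u. P (u, t0 + \<epsilon>) > 0}" "\<exists>\<delta>>0. ball u0 \<delta> \<subseteq> {u. P (u, t0 - \<epsilon>) < 0}"
    by (metis openE)+
  then obtain \<delta>2 \<delta>3 where \<delta>2: "\<delta>2 > 0" "ball u0 \<delta>2 \<subseteq> {u. P (u, t0 + \<epsilon>) > 0}"
    and \<delta>3: "\<delta>3 > 0" "ball u0 \<delta>3 \<subseteq> {u. P (u, t0 - \<epsilon>) < 0}"
    by (elim exE conjE)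
  define \<delta> where "\<delta> = Min {\<delta>1, \<delta>2, \<delta>3}"
  have \<delta>: "\<delta> > 0" using \<delta>1 \<delta>2 \<delta>3 by (simp add: \<delta>_def)
  have sub: "u \<in> cball u0 \<delta>1" "P (u, t0 + \<epsilon>) > 0" "P (u, t0 - \<epsilon>) < 0" if "u \<in> ball u0 \<delta>" for u
    using that \<delta>2(2) \<delta>3(2) by (auto simp: \<delta>_def)
  have "\<exists>t. \<bar>t - t0\<bar> < \<epsilon> \<and> P (u, t) = 0" if u: "u \<in> ball u0 \<delta>" for u
  proof -
    have "\<exists>t. t0 - \<epsilon> \<le> t \<and> t \<le> t0 + \<epsilon> \<and> P (u, t) = 0"
      using sub[OF u] \<epsilon>(1) der
      by (intro IVT') (auto intro!: DERIV_continuous_on intro: has_field_derivative_at_within)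
    then obtain t where t: "t0 - \<epsilon> \<le> t" "t \<le> t0 + \<epsilon>" "P (u, t) = 0" by blast
    moreover have "t \<noteq> t0 - \<epsilon>" "t \<noteq> t0 + \<epsilon>" using sub[OF u] t(3) by auto
    ultimately show ?thesis by (intro exI[of _ t]) auto
  qed
  then obtain \<phi> where \<phi>: "\<And>u. u \<in> ball u0 \<delta> \<Longrightarrow> \<bar>\<phi> u - t0\<bar> < \<epsilon> \<and> P (u, \<phi> u) = 0"
    by metis
  have in_box: "t \<in> cball t0 \<epsilon>" if "\<bar>t - t0\<bar> < \<epsilon>" for t
    using that by (auto simp: dist_real_def)
  have est: "c * \<bar>t - s\<bar> \<le> \<bar>P (u, t) - P (u, s)\<bar>"
    if "u \<in> ball u0 \<delta>" "\<bar>s - t0\<bar> < \<epsilon>" "\<bar>t - t0\<bar> < \<epsilon>" for u s t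
    using mvt[OF sub(1)[OF that(1)] in_box[OF that(2)] in_box[OF that(3)]]
      mvt[OF sub(1)[OF that(1)] in_box[OF that(3)] in_box[OF that(2)]]
    by (cases "s \<le> t") (auto simp: abs_if)
  have unique: "t = \<phi> u" if "u \<in> ball u0 \<delta>" "\<bar>t - t0\<bar> < \<epsilon>" "P (u, t) = 0" for u t
    using est[OF that(1) _ that(2), of "\<phi> u"] \<phi>[OF that(1)] that(3) \<open>c > 0\<close>
    by (simp add: mult_le_0_iff)
  have "compact (cball u0 \<delta>1 \<times> cball t0 \<epsilon>)" by (intro compact_Times compact_cball)
  then obtain L where L: "L-lipschitz_on (cball u0 \<delta>1 \<times> cball t0 \<epsilon>) P"
    using real_polynomial_function_lipschitz_on[OF P] by blast
  \<comment> \<open>As \<open>P\<close> vanishes at \<open>(u, \<phi> u)\<close> and at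
    \<open>(v, \<phi> v)\<close>, its change in \<open>t\<close> over \<open>u\<close> equals in
    size its change from \<open>u\<close> to \<open>v\<close> at \<open>\<phi> v\<close>. The former
    is at least \<open>c\<close> times the difference of the roots, the latter at most
    \<open>L\<close> times the distance.\<close>
  have "(L / c)-lipschitz_on (ball u0 \<delta>) \<phi>"
  proof (rule lipschitz_onI)
    fix u v assume uv: "u \<in> ball u0 \<delta>" "v \<in> ball u0 \<delta>"
    have "c * \<bar>\<phi> u - \<phi> v\<bar> \<le> \<bar>P (u, \<phi> u) - P (u, \<phi> v)\<bar>"
      using est uv \<phi> by blast
    also have "\<dots> = dist (P (u, \<phi> v)) (P (v, \<phi> v))"
      using \<phi> uv by (simp add: dist_real_def)
    also have "\<dots> \<le> L * dist (u, \<phi> v) (v, \<phi> v)"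
      using uv \<phi> sub in_box by (intro lipschitz_onD[OF L]) auto
    finally show "dist (\<phi> u) (\<phi> v) \<le> L / c * dist u v"
      using \<open>c > 0\<close> by (simp add: dist_real_def dist_Pair_Pair field_simps)
  next
    show "0 \<le> L / c" using lipschitz_on_nonneg[OF L] \<open>c > 0\<close> by simp
  qed
  then show ?thesis
    using \<delta> \<epsilon>(1) \<phi> unique sub(1) in_box box(1) by meson
qed

lemma scalar_implicit_function:
  fixes P D :: "'a::euclidean_space \<times> real \<Rightarrow> real"
  assumes P: "real_polynomial_function P" and D: "real_polynomial_function D"
    and der: "\<And>u t. ((\<lambda>t. P (u, t)) has_real_derivative D (u, t)) (at t)"
    and z: "P (u0, t0) = 0" and nz: "D (u0, t0) \<noteq> 0" and W: "open W" "(u0, t0) \<in> W"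
  shows "\<exists>\<delta>>0. \<exists>\<epsilon>>0. \<exists>\<phi> L. L-lipschitz_on (ball u0 \<delta>) \<phi> \<and>
    (\<forall>u\<in>ball u0 \<delta>. (u, \<phi> u) \<in> W \<and> P (u, \<phi> u) = 0 \<and> \<bar>\<phi> u - t0\<bar> < \<epsilon> \<and>
       (\<forall>t. \<bar>t - t0\<bar> < \<epsilon> \<longrightarrow> P (u, t) = 0 \<longrightarrow> t = \<phi> u))"
proof (cases "D (u0, t0) > 0")
  case True
  show ?thesis by (rule scalar_implicit_function_pos[OF P D der z True W])
next
  case False
  have "((\<lambda>t. - P (u, t)) has_real_derivative - D (u, t)) (at t)" for u t
    using der by (auto intro!: derivative_eq_intros)
  from scalar_implicit_function_pos[OF real_polynomial_function_minus[OF P]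
      real_polynomial_function_minus[OF D] this _ _ W]
  show ?thesis using False nz z by simp
qed

section \<open>Sections with values in the real line\<close>

lemma param_poly_prod:
  fixes P :: "'a::euclidean_space \<times> real \<Rightarrow> real"
  assumes "real_polynomial_function P"
  shows "\<exists>n p. param_poly n p \<and> (\<forall>u t. P (u, t) = poly (p u) t)"
proof -
  obtain n p where p: "param_poly n p" "\<And>x t. P (x + t *\<^sub>R (0, 1)) = poly (p x) t"
    using param_poly_along_line[OF assms] by blast
  have "real_polynomial_function (\<lambda>u. coeff (p (u, 0)) i)" for i
    using real_polynomial_function_compose[OF polynomial_function_Pair[OF polynomial_function_id
          polynomial_function_const] param_polyD(1)[OF p(1)]]
    by (simp add: o_def)
  then have "param_poly n (\<lambda>u. p (u, 0))"
    using p(1) by (auto simp: param_poly_def)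
  moreover have "P (u, t) = poly (p (u, 0)) t" for u t
    using p(2)[of "(u, 0)" t] by simp
  ultimately show ?thesis by blast
qed

lemma real_polynomial_function_param_poly:
  fixes p :: "'a::euclidean_space \<Rightarrow> real poly"
  assumes "param_poly n p"
  shows "real_polynomial_function (\<lambda>z. poly (p (fst z)) (snd z))"
proof -
  have "poly (p u) t = (\<Sum>i<n. coeff (p u) i * t ^ i)" for u t
  proof -
    have "degree (p u) < n \<or> p u = 0"
      using param_polyD(2)[OF assms, of "degree (p u)" u] by (metis leading_coeff_0_iff not_less)
    then show ?thesis
    proof
      assume d: "degree (p u) < n"
      have "poly (p u) t = (\<Sum>i\<le>degree (p u). coeff (p u) i * t ^ i)" by (rule poly_altdef)
      also have "\<dots> = (\<Sum>i<n. coeff (p u) i * t ^ i)"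
        using d by (intro sum.mono_neutral_left) (auto simp: not_le coeff_eq_0)
      finally show ?thesis .
    qed simp
  qed
  moreover have "real_polynomial_function (\<lambda>z :: 'a \<times> real. coeff (p (fst z)) i)" for i
    using real_polynomial_function_compose[OF polynomial_function_fst[OF polynomial_function_id] param_polyD(1)[OF assms]]
    by (simp add: o_def)
  ultimately show ?thesis
    by (auto intro!: real_polynomial_function_sum real_polynomial_function.intros(4)
        real_polynomial_function_power real_polynomial_function_snd)
qed

lemma semialgebraic_param_poly_eq_0:
  "param_poly n p \<Longrightarrow> semialgebraic {z. poly (p (fst z)) (snd z) = 0}"
  by (intro semialgebraic_eq_0 real_polynomial_function_param_poly)

lemma interior_fst_image_finite_Union:
  fixes \<F> :: "('a::euclidean_space \<times> 'b::euclidean_space) set set"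
  assumes "finite \<F>" "\<And>B. B \<in> \<F> \<Longrightarrow> semialgebraic B" "interior (fst ` \<Union>\<F>) \<noteq> {}"
  shows "\<exists>B\<in>\<F>. interior (fst ` B) \<noteq> {}"
proof (rule ccontr)
  assume "\<not> ?thesis"
  then have "thin (\<Union>B\<in>\<F>. fst ` B)"
    using assms by (intro thin_UN semialgebraic_empty_interior_thin semialgebraic_fst_image) auto
  then show False using thin_interior assms(3) by (metis image_Union)
qed

text \<open>
  Among the polynomials in the last variable that vanish on a part of the set with large projection,
  one of least degree generates, up to a power of its leading coefficient, all the others. Hence
  near a generic point it alone defines the set, and it is not tangent to the fibre.
\<close>

lemma lipschitz_section_real:
  fixes X :: "('a::euclidean_space \<times> real) set"
  assumes "semialgebraic X" "interior (fst ` X) \<noteq> {}"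
  shows "\<exists>U \<phi> L. open U \<and> U \<noteq> {} \<and> L-lipschitz_on U \<phi> \<and>
    semialgebraic ((\<lambda>u. (u, \<phi> u)) ` U) \<and> (\<forall>u\<in>U. (u, \<phi> u) \<in> X)"
proof -
  obtain F where F: "finite F" "\<forall>B\<in>F. basic_semialgebraic B" "X = \<Union>F"
    using assms(1) unfolding semialgebraic_def by blast
  then obtain B where "B \<in> F" and Bint: "interior (fst ` B) \<noteq> {}"
    using interior_fst_image_finite_Union[of F] assms(2) semialgebraic_basic by blast
  then have "B \<subseteq> X" "basic_semialgebraic B" using F by auto
  then obtain P Qs where B: "real_polynomial_function P" "finite Qs" "\<forall>Q\<in>Qs. real_polynomial_function Q"
    "B = {x. P x = 0 \<and> (\<forall>Q\<in>Qs. Q x > 0)}"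
    unfolding basic_semialgebraic_def by blast
  define W where "W = (\<Inter>Q\<in>Qs. {z. Q z > 0})"
  have "open W" unfolding W_def using B(2,3) open_gt_0 by (intro open_INT) auto
  have BW: "B = {z. P z = 0} \<inter> W" using B(4) by (auto simp: W_def)
  show ?thesis
  proof (cases "\<forall>z. P z = 0")
    \<comment> \<open>With a trivial equation \<open>B\<close> is open, and a constant section
      exists.\<close>
    case True
    then have "B = W" using BW by auto
    then have "open B" using \<open>open W\<close> by simp
    obtain u0 t0 where "(u0, t0) \<in> B" using Bint by (metis interior_empty image_is_empty ex_in_conv surj_pair)
    then obtain U T where U: "open U" "open T" "(u0, t0) \<in> U \<times> T" "U \<times> T \<subseteq> B"
      using \<open>open B\<close> open_prod_elim by metis
    then obtain r where r: "r > 0" "ball u0 r \<subseteq> U" by (metis mem_Sigma_iff open_contains_ball)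
    have "(\<lambda>u. (u, t0)) ` ball u0 r = {z. fst z \<in> ball u0 r \<and> snd z = t0}"
      by (auto simp: image_iff)
    moreover have "semialgebraic {z. fst z \<in> ball u0 r \<and> snd z = t0}"
      by (intro semialgebraic_conj semialgebraic_eq polynomial_intros
          semialgebraic_vimage[OF polynomial_function_fst semialgebraic_ball] r)
    moreover have "0-lipschitz_on (ball u0 r) (\<lambda>u. t0)" by (rule lipschitz_on_constant)
    moreover have "\<forall>u\<in>ball u0 r. (u, t0) \<in> X" using U r \<open>B \<subseteq> X\<close> by blast
    ultimately show ?thesis using r(1)
      by (intro exI[of _ "ball u0 r"] exI[of _ "\<lambda>u. t0"] exI[of _ 0]) auto
  next
    case False
    \<comment> \<open>\<open>Y\<close> may be any semialgebraic part of \<open>B\<close> with large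
      projection; the size \<open>n\<close> is then minimised over \<open>Y\<close> and
      \<open>p\<close> together, so that passing to a smaller part cannot lower it further.\<close>
    define vanishing where "vanishing n Y p \<longleftrightarrow> Y \<subseteq> B \<and> semialgebraic Y \<and> interior (fst ` Y) \<noteq> {} \<and>
       param_poly n p \<and> (\<exists>u t. poly (p u) t \<noteq> 0) \<and> (\<forall>u t. (u, t) \<in> Y \<longrightarrow> poly (p u) t = 0)"
      for n Y and p :: "'a \<Rightarrow> real poly"
    obtain n0 P0 where P0: "param_poly n0 P0" "\<And>u t. P (u, t) = poly (P0 u) t"
      using param_poly_prod[OF B(1)] by blast
    have "vanishing n0 B P0"
      unfolding vanishing_def
      using P0 False Bint BW semialgebraic_basic[OF \<open>basic_semialgebraic B\<close>] by auto
    then have "\<exists>n Y p. vanishing n Y p" by blast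
    define n where "n = (LEAST n. \<exists>Y p. vanishing n Y p)"
    have "\<exists>Y p. vanishing n Y p"
      unfolding n_def using \<open>\<exists>n Y p. vanishing n Y p\<close> by (rule LeastI_ex)
    then obtain Y p where Yp: "vanishing n Y p" by blast
    have least: "n \<le> k" if "vanishing k Z q" for k Z q
      unfolding n_def using that by (intro Least_le) blast
    have Y: "Y \<subseteq> B" "semialgebraic Y" "interior (fst ` Y) \<noteq> {}" "param_poly n p"
      "\<exists>u t. poly (p u) t \<noteq> 0" "\<And>u t. (u, t) \<in> Y \<Longrightarrow> poly (p u) t = 0"
      using Yp unfolding vanishing_def by auto
    have lower: "interior (fst ` Z) = {}" if "Z \<subseteq> Y" "semialgebraic Z" "param_poly k q" "k < n"
      "\<exists>u t. poly (q u) t \<noteq> 0" "\<And>u t. (u, t) \<in> Z \<Longrightarrow> poly (q u) t = 0" for Z k q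
      using least[of k Z q] that Y(1) unfolding vanishing_def by auto
    obtain m where m: "n = Suc m"
    proof (cases n)
      case 0
      then have "p u = 0" for u using param_polyD(2)[OF Y(4)] by (intro poly_eqI) auto
      then show ?thesis using Y(5) by simp
    qed
    have pm: "param_poly (Suc m) p" using Y(4) m by simp
    define l where "l u = coeff (p u) m" for u
    have l: "real_polynomial_function l" unfolding l_def by (rule param_polyD(1)[OF Y(4)])
    \<comment> \<open>If the formal top coefficient vanished identically, \<open>p\<close> would
      have a smaller size, against minimality.\<close>
    obtain u1 where u1: "l u1 \<noteq> 0"
    proof (cases "\<forall>u. l u = 0")
      case True
      then have "param_poly m p"
        unfolding param_poly_def
        using param_polyD[OF Y(4)] m by (metis l_def le_antisym not_less_eq_eq)
      then show ?thesis using lower[of Y m p] Y m by auto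
    qed blast
    have "m \<noteq> 0"
    proof
      assume "m = 0"
      then have "poly (p u) t = l u" for u t
        using param_poly_const[OF Y(4)] m by (simp add: l_def)
      then have "fst ` Y \<subseteq> {u. l u = 0}" using Y(6) by auto
      then show False using thin_interior[OF thin_subset[OF thin_eq_0[OF l u1]]] Y(3) by blast
    qed
    define p' where "p' = (\<lambda>u. pderiv (p u))"
    have p': "param_poly m p'" using param_poly_pderiv[OF Y(4)] m by (simp add: p'_def)
    have "p' u1 \<noteq> 0"
    proof -
      have "coeff (p' u1) (m - 1) = of_nat m * l u1"
        using \<open>m \<noteq> 0\<close> by (simp add: p'_def coeff_pderiv l_def)
      then show ?thesis using u1 \<open>m \<noteq> 0\<close> by auto
    qed
    then have p'ne: "\<exists>u t. poly (p' u) t \<noteq> 0" using poly_all_0_iff_0 by blast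
    \<comment> \<open>The derivative is nonzero and smaller than \<open>p\<close>, so by minimality
      its zeros on \<open>Y\<close> project to a thin set. The base point \<open>u0\<close> is
      chosen off this set and off the zeros of \<open>l\<close>.\<close>
    define Y1 where "Y1 = Y \<inter> {z. poly (p' (fst z)) (snd z) = 0}"
    have sY1: "semialgebraic Y1"
      unfolding Y1_def by (intro semialgebraic_Int Y semialgebraic_param_poly_eq_0[OF p'])
    have "interior (fst ` Y1) = {}"
      using sY1 p' p'ne m by (intro lower[of Y1 m p']) (auto simp: Y1_def)
    then have "thin (fst ` Y1)" using sY1 by (intro semialgebraic_empty_interior_thin semialgebraic_fst_image)
    then have "thin (fst ` Y1 \<union> {u. l u = 0})" using thin_Un thin_eq_0[OF l u1] by blast
    then have "\<not> interior (fst ` Y) \<subseteq> fst ` Y1 \<union> {u. l u = 0}"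
      using thin_interior interior_maximal[OF _ open_interior] Y(3) by (metis subset_empty)
    then obtain u0 where u0: "u0 \<in> interior (fst ` Y)" "u0 \<notin> fst ` Y1" "l u0 \<noteq> 0" by blast
    then obtain t0 where t0: "(u0, t0) \<in> Y" using interior_subset by fastforce
    have d0: "poly (p' u0) t0 \<noteq> 0"
    proof
      assume "poly (p' u0) t0 = 0"
      then have "(u0, t0) \<in> Y1" using t0 by (simp add: Y1_def)
      then show False using u0(2) by force
    qed
    \<comment> \<open>The remainder of \<open>P\<close> modulo \<open>p\<close> vanishes on
      \<open>Y\<close> and is smaller than \<open>p\<close>, so minimality forces it to be zero.
      Hence zeros of \<open>p\<close> are zeros of \<open>P\<close> wherever \<open>l\<close> is
      nonzero.\<close>
    obtain r k where r: "param_poly m r"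
      "\<And>u t. poly (p u) t = 0 \<Longrightarrow> (l u ^ 2) ^ k * poly (P0 u) t = poly (r u) t"
      using param_poly_pseudo_remainder[OF P0(1) pm] unfolding l_def by blast
    have rz: "poly (r u) t = 0" for u t
    proof (rule ccontr)
      assume "poly (r u) t \<noteq> 0"
      moreover have "poly (r u) t = 0" if "(u, t) \<in> Y" for u t
        using r(2)[OF Y(6)[OF that]] Y(1) BW that P0(2)[of u t] by auto
      ultimately have "interior (fst ` Y) = {}"
        using Y(2) r(1) m by (intro lower[of Y m r]) auto
      then show False using Y(3) by simp
    qed
    have PB: "(u, t) \<in> B" if "poly (p u) t = 0" "l u \<noteq> 0" "(u, t) \<in> W" for u t
      using r(2)[OF that(1)] rz that P0(2)[of u t] BW by auto
    define W' where "W' = W \<inter> {u. l u \<noteq> 0} \<times> UNIV"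
    have "open W'"
      unfolding W'_def using \<open>open W\<close> open_ne_0[OF l] by (intro open_Int open_Times) auto
    moreover have "(u0, t0) \<in> W'" using t0 u0 Y(1) BW by (auto simp: W'_def)
    ultimately have "\<exists>\<delta>>0. \<exists>\<epsilon>>0. \<exists>\<phi> L. L-lipschitz_on (ball u0 \<delta>) \<phi> \<and>
      (\<forall>u\<in>ball u0 \<delta>. (u, \<phi> u) \<in> W' \<and> (\<lambda>z. poly (p (fst z)) (snd z)) (u, \<phi> u) = 0 \<and> \<bar>\<phi> u - t0\<bar> < \<epsilon> \<and>
       (\<forall>t. \<bar>t - t0\<bar> < \<epsilon> \<longrightarrow> (\<lambda>z. poly (p (fst z)) (snd z)) (u, t) = 0 \<longrightarrow> t = \<phi> u))"
      using Y(6)[OF t0] d0 poly_DERIV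
      by (intro scalar_implicit_function[OF real_polynomial_function_param_poly[OF Y(4)]
            real_polynomial_function_param_poly[OF p']]) (auto simp: p'_def)
    then obtain \<delta> \<epsilon> \<phi> L where \<phi>: "\<delta> > 0" "\<epsilon> > 0" "L-lipschitz_on (ball u0 \<delta>) \<phi>"
      "\<And>u. u \<in> ball u0 \<delta> \<Longrightarrow> (u, \<phi> u) \<in> W' \<and> poly (p u) (\<phi> u) = 0 \<and> \<bar>\<phi> u - t0\<bar> < \<epsilon>"
      "\<And>u t. \<lbrakk>u \<in> ball u0 \<delta>; \<bar>t - t0\<bar> < \<epsilon>; poly (p u) t = 0\<rbrakk> \<Longrightarrow> t = \<phi> u"
      by auto
    \<comment> \<open>Uniqueness of the root within \<open>\<epsilon>\<close> of \<open>t0\<close>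
      lets \<open>p\<close> alone cut out the graph.\<close>
    have "(\<lambda>u. (u, \<phi> u)) ` ball u0 \<delta> =
        {z. fst z \<in> ball u0 \<delta> \<and> snd z \<in> ball t0 \<epsilon> \<and> poly (p (fst z)) (snd z) = 0}"
      using \<phi>(4,5) by (force simp: image_iff dist_real_def abs_minus_commute)
    moreover have "semialgebraic
        {z. fst z \<in> ball u0 \<delta> \<and> snd z \<in> ball t0 \<epsilon> \<and> poly (p (fst z)) (snd z) = 0}"
      by (intro semialgebraic_conj semialgebraic_param_poly_eq_0[OF Y(4)] polynomial_intros
          semialgebraic_vimage[OF polynomial_function_fst semialgebraic_ball]
          semialgebraic_vimage[OF polynomial_function_snd semialgebraic_ball] \<phi>)
    moreover have "(u, \<phi> u) \<in> X" if "u \<in> ball u0 \<delta>" for u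
      using PB[of u "\<phi> u"] \<phi>(4)[OF that] \<open>B \<subseteq> X\<close> by (auto simp: W'_def)
    ultimately show ?thesis
      using \<phi>(1,3) by (intro exI[of _ "ball u0 \<delta>"] exI[of _ \<phi>] exI[of _ L]) auto
  qed
qed

text \<open>The coordinates of the section are chosen one after another over shrinking open sets.
  Semialgebraicity of each graph keeps the part of \<open>X\<close> with these coordinates
  semialgebraic, so the scalar case applies again.\<close>

theorem lipschitz_section:
  fixes X :: "('a::euclidean_space \<times> 'b::euclidean_space) set"
  assumes "semialgebraic X" "interior (fst ` X) \<noteq> {}"
  shows "\<exists>U \<phi> L. open U \<and> U \<noteq> {} \<and> L-lipschitz_on U \<phi> \<and> (\<forall>u\<in>U. (u, \<phi> u) \<in> X)"
proof -
  define Y where "Y B U \<psi> = X \<inter> {z. fst z \<in> U \<and> (\<forall>b\<in>B. inner (snd z) b = \<psi> b (fst z))}"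
    for B U and \<psi> :: "'b \<Rightarrow> 'a \<Rightarrow> real"
  have "\<exists>U \<psi>. open U \<and> U \<noteq> {} \<and> (\<forall>b\<in>B. \<exists>L. L-lipschitz_on U (\<psi> b)) \<and>
      semialgebraic (Y B U \<psi>) \<and> U \<subseteq> fst ` Y B U \<psi>" if "finite B" for B
    using that
  proof induction
    case empty
    obtain u0 where "u0 \<in> interior (fst ` X)" using assms by blast
    then obtain r where r: "r > 0" "ball u0 r \<subseteq> fst ` X"
      by (meson interior_subset mem_interior)
    have "semialgebraic (Y {} (ball u0 r) undefined)"
      unfolding Y_def
      by (simp only: Ball_def empty_iff simp_thms)
        (intro semialgebraic_Int assms(1) r(1)
          semialgebraic_vimage[OF polynomial_function_fst[OF polynomial_function_id] semialgebraic_ball])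
    moreover have "ball u0 r \<subseteq> fst ` Y {} (ball u0 r) undefined"
      using r(2) by (force simp: Y_def)
    ultimately show ?case using r(1)
      by (intro exI[of _ "ball u0 r"] exI[of _ undefined]) auto
  next
    case (insert b B)
    then obtain U \<psi> where U: "open U" "U \<noteq> {}" "\<forall>b\<in>B. \<exists>L. L-lipschitz_on U (\<psi> b)"
      "semialgebraic (Y B U \<psi>)" "U \<subseteq> fst ` Y B U \<psi>" by blast
    \<comment> \<open>The next coordinate is a scalar problem: \<open>X'\<close> records the values
      it can take once the earlier coordinates are fixed.\<close>
    define X' where "X' = {w. \<exists>y. (fst w, y) \<in> Y B U \<psi> \<and> inner y b = snd w}"
    have "semialgebraic X'"
      unfolding X'_def
      by (intro semialgebraic_ex semialgebraic_conj semialgebraic_vimage[OF _ U(4)] semialgebraic_eq polynomial_intros)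
    moreover have "U \<subseteq> fst ` X'"
    proof
      fix u assume "u \<in> U"
      then obtain y where "(u, y) \<in> Y B U \<psi>" using U(5) by fastforce
      then have "(u, inner y b) \<in> X'" by (auto simp: X'_def)
      then show "u \<in> fst ` X'" by (metis fst_conv image_eqI)
    qed
    then have "U \<subseteq> interior (fst ` X')" using U(1) interior_maximal by blast
    then have "interior (fst ` X') \<noteq> {}" using U by auto
    ultimately obtain U' \<phi> L where \<phi>: "open U'" "U' \<noteq> {}" "L-lipschitz_on U' \<phi>"
      "semialgebraic ((\<lambda>u. (u, \<phi> u)) ` U')" "\<And>u. u \<in> U' \<Longrightarrow> (u, \<phi> u) \<in> X'"
      using lipschitz_section_real by metis
    have "U' \<subseteq> U"
    proof
      fix u assume "u \<in> U'"
      then show "u \<in> U" using \<phi>(5)[of u] by (auto simp: X'_def Y_def)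
    qed
    define \<psi>' where "\<psi>' = \<psi>(b := \<phi>)"
    have Y': "Y (insert b B) U' \<psi>' = Y B U \<psi> \<inter> {z. (fst z, inner (snd z) b) \<in> (\<lambda>u. (u, \<phi> u)) ` U'}"
      using \<open>U' \<subseteq> U\<close> insert.hyps by (auto simp: Y_def \<psi>'_def image_iff)
    have "semialgebraic (Y (insert b B) U' \<psi>')"
      unfolding Y' by (intro semialgebraic_Int U(4) semialgebraic_vimage[OF _ \<phi>(4)] polynomial_intros
          polynomial_function_inner)
    moreover have "U' \<subseteq> fst ` Y (insert b B) U' \<psi>'"
    proof
      fix u assume u: "u \<in> U'"
      then obtain y where y: "(u, y) \<in> Y B U \<psi>" "inner y b = \<phi> u"
        using \<phi>(5)[OF u] by (auto simp: X'_def)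
      then have "(u, y) \<in> Y (insert b B) U' \<psi>'" unfolding Y' using u by auto
      then show "u \<in> fst ` Y (insert b B) U' \<psi>'" by force
    qed
    moreover have "\<forall>c\<in>insert b B. \<exists>L. L-lipschitz_on U' (\<psi>' c)"
    proof
      fix c assume c: "c \<in> insert b B"
      show "\<exists>L. L-lipschitz_on U' (\<psi>' c)"
      proof (cases "c = b")
        case True
        then show ?thesis using \<phi>(3) by (auto simp: \<psi>'_def)
      next
        case False
        then obtain M where "M-lipschitz_on U (\<psi> c)" using U(3) c by blast
        from lipschitz_on_subset[OF this \<open>U' \<subseteq> U\<close>] show ?thesis using False by (auto simp: \<psi>'_def)
      qed
    qed
    ultimately show ?case using \<phi>(1,2) by blast
  qed
  from this[of Basis] obtain U \<psi> where U: "open U" "U \<noteq> {}" "\<And>b. b \<in> Basis \<Longrightarrow> \<exists>L. L-lipschitz_on U (\<psi> b)"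
    "U \<subseteq> fst ` Y Basis U \<psi>" by auto
  obtain L where L: "\<And>b. b \<in> Basis \<Longrightarrow> (L b)-lipschitz_on U (\<psi> b)" using U(3) by metis
  define \<phi> where "\<phi> u = (\<Sum>b\<in>Basis. \<psi> b u *\<^sub>R b)" for u
  have "(\<Sum>b\<in>Basis. L b)-lipschitz_on U \<phi>"
  proof (rule lipschitz_onI)
    fix u v assume uv: "u \<in> U" "v \<in> U"
    have "dist (\<phi> u) (\<phi> v) = norm (\<Sum>b\<in>Basis. (\<psi> b u - \<psi> b v) *\<^sub>R b)"
      by (simp add: \<phi>_def dist_norm sum_subtractf scaleR_diff_left)
    also have "\<dots> \<le> (\<Sum>b\<in>Basis. \<bar>\<psi> b u - \<psi> b v\<bar>)"
      by (rule order_trans[OF norm_sum]) simp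
    also have "\<dots> \<le> (\<Sum>b\<in>Basis. L b * dist u v)"
      using lipschitz_onD[OF L uv] by (intro sum_mono) (auto simp: dist_real_def)
    finally show "dist (\<phi> u) (\<phi> v) \<le> sum L Basis * dist u v" by (simp add: sum_distrib_right)
  next
    show "0 \<le> sum L Basis" by (intro sum_nonneg lipschitz_on_nonneg[OF L])
  qed
  moreover have "(u, \<phi> u) \<in> X" if u: "u \<in> U" for u
  proof -
    obtain y where y: "(u, y) \<in> Y Basis U \<psi>" using u U(4) by fastforce
    then have "y = \<phi> u"
      unfolding \<phi>_def by (subst euclidean_representation[symmetric]) (auto simp: Y_def)
    then show ?thesis using y by (auto simp: Y_def)
  qed
  ultimately show ?thesis using U(1,2) by blast
qed

section \<open>Hypersurfaces\<close>

lemma real_polynomial_function_has_derivative: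
  fixes P :: "'a::euclidean_space \<Rightarrow> real"
  assumes "real_polynomial_function P"
  shows "\<exists>D. (\<forall>x. (P has_derivative D x) (at x)) \<and> (\<forall>v. real_polynomial_function (\<lambda>x. D x v))"
  using assms
proof induction
  case (linear f)
  then have "(f has_derivative f) (at x)" for x by (rule bounded_linear_imp_has_derivative)
  then show ?case by (intro exI[of _ "\<lambda>x. f"]) auto
next
  case (const c)
  show ?case by (intro exI[of _ "\<lambda>x v. 0"]) auto
next
  case (add f g)
  then obtain D E where "\<And>x. (f has_derivative D x) (at x)" "\<And>v. real_polynomial_function (\<lambda>x. D x v)"
    "\<And>x. (g has_derivative E x) (at x)" "\<And>v. real_polynomial_function (\<lambda>x. E x v)" by metis
  then show ?case
    by (intro exI[of _ "\<lambda>x v. D x v + E x v"]) (auto intro!: has_derivative_add)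
next
  case (mult f g)
  then obtain D E where "\<And>x. (f has_derivative D x) (at x)" "\<And>v. real_polynomial_function (\<lambda>x. D x v)"
    "\<And>x. (g has_derivative E x) (at x)" "\<And>v. real_polynomial_function (\<lambda>x. E x v)" by metis
  then show ?case
    by (intro exI[of _ "\<lambda>x v. f x * E x v + D x v * g x"] conjI allI has_derivative_mult
        real_polynomial_function.intros(3,4) mult.hyps)
qed

lemma polynomial_function_has_derivative:
  fixes A :: "'a::euclidean_space \<Rightarrow> 'b::euclidean_space"
  assumes "polynomial_function A"
  shows "\<exists>D. (\<forall>x. (A has_derivative D x) (at x)) \<and> (\<forall>v. polynomial_function (\<lambda>x. D x v))"
proof -
  have "\<exists>D. (\<forall>x. ((\<lambda>x. inner (A x) b) has_derivative D x) (at x)) \<and> (\<forall>v. real_polynomial_function (\<lambda>x. D x v))"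
    if "b \<in> Basis" for b
    using assms that real_polynomial_function_has_derivative
    unfolding polynomial_function_iff_Basis_inner by blast
  then obtain D where D: "\<And>b x. b \<in> Basis \<Longrightarrow> ((\<lambda>x. inner (A x) b) has_derivative D b x) (at x)"
    "\<And>b v. b \<in> Basis \<Longrightarrow> real_polynomial_function (\<lambda>x. D b x v)" by metis
  define D' where "D' x v = (\<Sum>b\<in>Basis. D b x v *\<^sub>R b)" for x v
  have D': "inner (D' x v) b = D b x v" if "b \<in> Basis" for x v b
    using that by (simp add: D'_def)
  have "(A has_derivative D' x) (at x)" for x
    using D(1) D' by (subst has_derivative_componentwise_within) auto
  moreover have "polynomial_function (\<lambda>x. D' x v)" for v
    using D(2) D' by (auto simp: polynomial_function_iff_Basis_inner)
  ultimately show ?thesis by blast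
qed

text \<open>Generated so that derivatives stay in the class, with powers of \<open>q\<close> as the
  only denominators. At zeros of \<open>q\<close> the values are defaults, and derivatives are
  claimed only elsewhere.\<close>

inductive rational_function :: "('a::euclidean_space \<Rightarrow> real) \<Rightarrow> ('a \<Rightarrow> 'b::euclidean_space) \<Rightarrow> bool" for q where
  rational_poly: "polynomial_function A \<Longrightarrow> rational_function q A"
| rational_add: "rational_function q G \<Longrightarrow> rational_function q H \<Longrightarrow> rational_function q (\<lambda>x. G x + H x)"
| rational_mult: "real_polynomial_function c \<Longrightarrow> rational_function q G \<Longrightarrow> rational_function q (\<lambda>x. c x *\<^sub>R G x)"
| rational_divide: "rational_function q G \<Longrightarrow> rational_function q (\<lambda>x. inverse (q x) *\<^sub>R G x)"

lemma rational_function_has_derivative: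
  assumes "rational_function q G" and q: "real_polynomial_function q"
  shows "\<exists>D. (\<forall>x. q x \<noteq> 0 \<longrightarrow> (G has_derivative D x) (at x)) \<and> (\<forall>v. rational_function q (\<lambda>x. D x v))"
  using assms(1)
proof induction
  case (rational_poly A)
  then show ?case using polynomial_function_has_derivative rational_function.rational_poly by metis
next
  case (rational_add G H)
  then obtain D E where DE: "\<And>x. q x \<noteq> 0 \<Longrightarrow> (G has_derivative D x) (at x)" "\<And>v. rational_function q (\<lambda>x. D x v)"
    "\<And>x. q x \<noteq> 0 \<Longrightarrow> (H has_derivative E x) (at x)" "\<And>v. rational_function q (\<lambda>x. E x v)" by metis
  show ?case
    by (intro exI[of _ "\<lambda>x v. D x v + E x v"] conjI allI impI has_derivative_add
        rational_function.rational_add DE)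
next
  case (rational_mult c G)
  then obtain D E where DE: "\<And>x. q x \<noteq> 0 \<Longrightarrow> (G has_derivative D x) (at x)" "\<And>v. rational_function q (\<lambda>x. D x v)"
    "\<And>x. (c has_derivative E x) (at x)" "\<And>v. real_polynomial_function (\<lambda>x. E x v)"
    using real_polynomial_function_has_derivative[OF rational_mult.hyps(1)] by metis
  show ?case
    by (intro exI[of _ "\<lambda>x v. c x *\<^sub>R D x v + E x v *\<^sub>R G x"] conjI allI impI has_derivative_scaleR
        rational_function.rational_add rational_function.rational_mult DE rational_mult.hyps)
next
  case (rational_divide G)
  then obtain D E where DE: "\<And>x. q x \<noteq> 0 \<Longrightarrow> (G has_derivative D x) (at x)" "\<And>v. rational_function q (\<lambda>x. D x v)"
    "\<And>x. (q has_derivative E x) (at x)" "\<And>v. real_polynomial_function (\<lambda>x. E x v)"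
    using real_polynomial_function_has_derivative[OF q] by metis
  define F where "F x v = inverse (q x) *\<^sub>R D x v + inverse (q x) *\<^sub>R inverse (q x) *\<^sub>R (- E x v) *\<^sub>R G x" for x v
  have "((\<lambda>x. inverse (q x) *\<^sub>R G x) has_derivative F x) (at x)" if "q x \<noteq> 0" for x
  proof -
    have "((\<lambda>x. inverse (q x) *\<^sub>R G x) has_derivative
        (\<lambda>v. inverse (q x) *\<^sub>R D x v + (- (inverse (q x) * E x v * inverse (q x))) *\<^sub>R G x)) (at x)"
      using that by (intro has_derivative_scaleR Deriv.has_derivative_inverse DE)
    then show ?thesis by (simp add: F_def[abs_def] mult_ac)
  qed
  moreover have "rational_function q (\<lambda>x. F x v)" for v
    unfolding F_def
    by (intro rational_function.rational_add rational_function.rational_mult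
        rational_function.rational_divide real_polynomial_function_minus DE rational_divide.hyps)
  ultimately show ?case by blast
qed

lemma frechet_derivative_eq: "(f has_derivative f') (at x) \<Longrightarrow> frechet_derivative f (at x) = f'"
  by (metis frechet_derivative_at)

lemma Ck_on_cong:
  assumes "open U" "\<And>x. x \<in> U \<Longrightarrow> f x = g x" "Ck_on k f U"
  shows "Ck_on k g U"
  using assms(2,3)
proof (induction k arbitrary: f g)
  case 0
  then show ?case by (metis Ck_on.simps(1) continuous_on_cong)
next
  case (Suc k)
  have d: "(g has_derivative frechet_derivative f (at x)) (at x)" if "x \<in> U" for x
    using Suc.prems that assms(1)
    by (intro has_derivative_transform_within_open[of f _ x UNIV U g])
      (auto simp: frechet_derivative_works)
  have "Ck_on k (\<lambda>x. frechet_derivative g (at x) v) U" for v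
  proof (rule Suc.IH[of "\<lambda>x. frechet_derivative f (at x) v"])
    show "frechet_derivative f (at x) v = frechet_derivative g (at x) v" if "x \<in> U" for x
      by (simp only: frechet_derivative_eq[OF d[OF that]])
    show "Ck_on k (\<lambda>x. frechet_derivative f (at x) v) U" using Suc.prems(2) by simp
  qed
  then show ?case using d by (auto simp: differentiable_def)
qed

text \<open>The derivative of \<open>\<psi>\<close> is a rational expression in
  \<open>\<psi>\<close> itself, so every directional derivative of \<open>G\<close> composed with
  \<open>\<psi>\<close> is again a rational function composed with \<open>\<psi>\<close>, and
  induction on \<open>k\<close> applies. This gives smoothness of an inverse chart; the identity is
  covered by \<open>c = 0\<close>.\<close>

lemma Ck_on_rational_compose:
  fixes \<psi> :: "'a::euclidean_space \<Rightarrow> 'a" and G :: "'a \<Rightarrow> 'b::euclidean_space"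
  assumes "open W" and q: "real_polynomial_function q" and nz: "\<And>w. w \<in> W \<Longrightarrow> q (\<psi> w) \<noteq> 0"
    and c: "\<And>v. real_polynomial_function (c v)"
    and \<psi>: "\<And>w. w \<in> W \<Longrightarrow> (\<psi> has_derivative (\<lambda>v. v + (inverse (q (\<psi> w)) * c v (\<psi> w)) *\<^sub>R e)) (at w)"
    and "rational_function q G"
  shows "Ck_on k (\<lambda>w. G (\<psi> w)) W"
  using assms(6)
proof (induction k arbitrary: G)
  case (0 G)
  obtain D where D: "\<And>x. q x \<noteq> 0 \<Longrightarrow> (G has_derivative D x) (at x)"
    using rational_function_has_derivative[OF 0 q] by blast
  have "isCont (\<lambda>w. G (\<psi> w)) w" if w: "w \<in> W" for w
    using has_derivative_continuous[OF has_derivative_compose[OF \<psi>[OF w] D[OF nz[OF w]]]]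
    by simp
  then show ?case by (simp add: continuous_at_imp_continuous_on)
next
  case (Suc k)
  obtain D where D: "\<And>x. q x \<noteq> 0 \<Longrightarrow> (G has_derivative D x) (at x)" "\<And>v. rational_function q (\<lambda>x. D x v)"
    using rational_function_has_derivative[OF Suc.prems q] by blast
  define H where "H v x = D x v + inverse (q x) *\<^sub>R c v x *\<^sub>R D x e" for v x
  have H: "((\<lambda>w. G (\<psi> w)) has_derivative (\<lambda>v. H v (\<psi> w))) (at w)" if w: "w \<in> W" for w
  proof -
    have "linear (D (\<psi> w))" using D(1)[OF nz[OF w]] by (rule has_derivative_linear)
    then have "D (\<psi> w) (v + (inverse (q (\<psi> w)) * c v (\<psi> w)) *\<^sub>R e) = H v (\<psi> w)" for v
      by (simp add: H_def linear_add linear_scale)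
    then show ?thesis
      using has_derivative_compose[OF \<psi>[OF w] D(1)[OF nz[OF w]]] by simp
  qed
  have "rational_function q (H v)" for v
    unfolding H_def
    by (intro rational_add rational_divide rational_mult D(2) c)
  then have "Ck_on k (\<lambda>w. H v (\<psi> w)) W" for v by (rule Suc.IH)
  then have "Ck_on k (\<lambda>w. frechet_derivative (\<lambda>w. G (\<psi> w)) (at w) v) W" for v
    by (rule Ck_on_cong[OF \<open>open W\<close>, rotated]) (simp add: frechet_derivative_eq[OF H])
  then show ?case using H by (auto simp: differentiable_def)
qed

text \<open>The slice chart replaces the \<open>b\<close>-coordinate of a point by the value of
  \<open>Q\<close>. It moves points only along \<open>b\<close>, and on a ball where
  \<open>D x b\<close> has no zero \<open>Q\<close> is injective along each chord in this direction.
  So the chart is injective there, and invariance of domain provides the open image and the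
  continuous inverse.\<close>

lemma embedded_submanifold_hypersurface:
  fixes Q :: "'a::euclidean_space \<Rightarrow> real"
  assumes Q: "real_polynomial_function Q" and b: "b \<in> Basis"
    and D: "\<And>x. (Q has_derivative D x) (at x)" "\<And>v. real_polynomial_function (\<lambda>x. D x v)"
  shows "embedded_submanifold (DIM('a) - 1) {x. Q x = 0 \<and> D x b \<noteq> 0}"
  unfolding embedded_submanifold_def
proof
  fix x0 assume x0: "x0 \<in> {x. Q x = 0 \<and> D x b \<noteq> 0}"
  let ?M = "{x. Q x = 0 \<and> D x b \<noteq> 0}"
  have "open {x. D x b \<noteq> 0}" by (rule open_ne_0[OF D(2)])
  then obtain r where r: "r > 0" "ball x0 r \<subseteq> {x. D x b \<noteq> 0}"
    using x0 by (metis (mono_tags, lifting) mem_Collect_eq openE)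
  define U where "U = ball x0 r"
  have nz: "D x b \<noteq> 0" if "x \<in> U" for x using that r by (auto simp: U_def)
  define \<phi> where "\<phi> x = x + (Q x - inner x b) *\<^sub>R b" for x
  have \<phi>b: "inner (\<phi> x) b = Q x" for x
    using b by (simp add: \<phi>_def inner_add_left)
  have lin: "linear (D x)" for x using D(1) by (rule has_derivative_linear)
  have pQ: "polynomial_function (\<lambda>x. (Q x - inner x b) *\<^sub>R b)"
    using Q b unfolding polynomial_function_iff_Basis_inner
    by (auto intro!: real_polynomial_function_diff real_polynomial_function.intros(2,4) polynomial_intros)
  have pol: "polynomial_function \<phi>"
    unfolding \<phi>_def[abs_def] by (intro polynomial_function_add polynomial_function_id pQ)
  have der: "(\<phi> has_derivative (\<lambda>v. v + (D x v - inner v b) *\<^sub>R b)) (at x)" for x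
    unfolding \<phi>_def[abs_def] by (auto intro!: derivative_eq_intros D(1))
  then have cont: "continuous_on U \<phi>"
    using has_derivative_continuous by (blast intro: continuous_at_imp_continuous_on)
  \<comment> \<open>Points with the same image differ by a multiple of \<open>b\<close> and share
    the value of \<open>Q\<close>. The mean value theorem on their segment, which stays in the ball,
    would give a zero of \<open>D x b\<close>.\<close>
  have inj: "inj_on \<phi> U"
  proof (rule inj_onI, rule ccontr)
    fix x y assume xy: "x \<in> U" "y \<in> U" "\<phi> x = \<phi> y" "x \<noteq> y"
    define s where "s = (Q y - inner y b) - (Q x - inner x b)"
    have "x = y + s *\<^sub>R b" using xy(3) by (simp add: \<phi>_def s_def algebra_simps)
    then have "s \<noteq> 0" using xy(4) by auto
    have "Q x = Q y" using \<phi>b xy(3) by metis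
    have "((\<lambda>t. Q (y + (t * s) *\<^sub>R b)) has_real_derivative s * D (y + (t * s) *\<^sub>R b) b) (at t)" for t
    proof -
      have "((\<lambda>t. y + (t * s) *\<^sub>R b) has_derivative (\<lambda>h. (h * s) *\<^sub>R b)) (at t)"
        by (auto intro!: derivative_eq_intros)
      then have "((\<lambda>t. Q (y + (t * s) *\<^sub>R b)) has_derivative (\<lambda>h. D (y + (t * s) *\<^sub>R b) ((h * s) *\<^sub>R b))) (at t)"
        by (rule has_derivative_compose) (rule D(1))
      then show ?thesis
        unfolding has_field_derivative_def
        by (rule has_derivative_eq_rhs) (auto simp: fun_eq_iff linear_scale[OF lin])
    qed
    then obtain t where t: "0 < t" "t < 1"
      "Q (y + (1 * s) *\<^sub>R b) - Q (y + (0 * s) *\<^sub>R b) = (1 - 0) * (s * D (y + (t * s) *\<^sub>R b) b)"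
      using MVT2[of 0 1 "\<lambda>t. Q (y + (t * s) *\<^sub>R b)" "\<lambda>t. s * D (y + (t * s) *\<^sub>R b) b"] by auto
    have "y + (t * s) *\<^sub>R b = (1 - t) *\<^sub>R y + t *\<^sub>R x"
      using \<open>x = y + s *\<^sub>R b\<close> by (simp add: algebra_simps)
    then have "y + (t * s) *\<^sub>R b \<in> U"
      using xy t convex_ball[of x0 r] unfolding U_def by (simp add: convex_alt)
    then show False
      using t(3) nz \<open>s \<noteq> 0\<close> \<open>Q x = Q y\<close> \<open>x = y + s *\<^sub>R b\<close> by simp
  qed
  define W where "W = \<phi> ` U"
  have "open U" by (simp add: U_def)
  then have "open W" unfolding W_def using cont inj by (intro invariance_of_domain)
  obtain \<psi> where hom: "homeomorphism U W \<phi> \<psi>"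
    unfolding W_def using invariance_of_domain_homeomorphism[OF \<open>open U\<close> cont _ inj] by blast
  have \<psi>U: "\<psi> w \<in> U" "\<phi> (\<psi> w) = w" if "w \<in> W" for w
    using hom that by (auto simp: homeomorphism_def)
  \<comment> \<open>The inverse of the linear map \<open>v + (D x v - inner v b) b\<close>, found by
    solving for the \<open>b\<close>-component of the preimage.\<close>
  have \<psi>der: "(\<psi> has_derivative (\<lambda>v. v + (inverse (D (\<psi> w) b) * (inner v b - D (\<psi> w) v)) *\<^sub>R b)) (at w)"
    (is "(_ has_derivative ?g) _") if w: "w \<in> W" for w
  proof (rule has_derivative_inverse_basic[OF der _ _ _ \<open>open W\<close> w \<psi>U(2)])
    note lin = lin[of "\<psi> w"]
    have "linear ?g"
      by (rule linearI) (simp_all add: linear_add[OF lin] linear_scale[OF lin] algebra_simps)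
    then show "bounded_linear ?g" by (simp add: linear_conv_bounded_linear)
    show "?g \<circ> (\<lambda>v. v + (D (\<psi> w) v - inner v b) *\<^sub>R b) = id"
    proof
      fix v
      define s where "s = D (\<psi> w) v - inner v b"
      have "inner (v + s *\<^sub>R b) b = D (\<psi> w) v"
        using b by (simp add: inner_add_left s_def)
      moreover have "D (\<psi> w) (v + s *\<^sub>R b) = D (\<psi> w) v + s * D (\<psi> w) b"
        by (simp add: linear_add[OF lin] linear_scale[OF lin])
      ultimately have "?g (v + s *\<^sub>R b) = v + s *\<^sub>R b + (inverse (D (\<psi> w) b) * (- (s * D (\<psi> w) b))) *\<^sub>R b"
        by simp
      also have "inverse (D (\<psi> w) b) * (- (s * D (\<psi> w) b)) = - s"
        using nz[OF \<psi>U(1)[OF w]] by (simp add: field_simps)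
      also have "v + s *\<^sub>R b + (- s) *\<^sub>R b = v" by simp
      finally show "(?g \<circ> (\<lambda>v. v + (D (\<psi> w) v - inner v b) *\<^sub>R b)) v = id v"
        by (simp only: o_apply id_apply s_def)
    qed
    show "continuous (at w) \<psi>"
      using hom \<open>open W\<close> w by (simp add: homeomorphism_def continuous_on_eq_continuous_at)
  qed
  have "smooth_on U \<phi>"
    unfolding smooth_on_def
  proof
    fix k
    show "Ck_on k \<phi> U"
      using Ck_on_rational_compose[OF \<open>open U\<close> D(2)[of b], of "\<lambda>x. x" "\<lambda>_ _. 0" b \<phi> k] nz
        rational_poly[OF pol] by auto
  qed
  moreover have "smooth_on W \<psi>"
    unfolding smooth_on_def
  proof
    fix k
    have "rational_function (\<lambda>x. D x b) (\<lambda>x :: 'a. x)"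
      by (rule rational_poly[OF polynomial_function_id])
    moreover have "real_polynomial_function (\<lambda>x. inner v b - D x v)" for v
      by (intro real_polynomial_function_diff real_polynomial_function.intros(2) D(2))
    ultimately show "Ck_on k \<psi> W"
      using Ck_on_rational_compose[OF \<open>open W\<close> D(2)[of b], of \<psi> "\<lambda>v x. inner v b - D x v" b "\<lambda>x. x" k]
        nz \<psi>U \<psi>der by auto
  qed
  ultimately have "diffeomorphism U W \<phi> \<psi>"
    using \<open>open U\<close> \<open>open W\<close> hom by (simp add: diffeomorphism_def)
  moreover have "\<phi> ` (U \<inter> ?M) = W \<inter> {x. inner b x = 0}"
    using nz \<phi>b by (auto simp: W_def inner_commute)
  moreover have "x0 \<in> U" using r by (simp add: U_def)
  ultimately have "x0 \<in> U \<and> diffeomorphism U W \<phi> \<psi> \<and> subspace {x. inner b x = 0} \<and>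
      dim {x. inner b x = 0} = DIM('a) - 1 \<and> \<phi> ` (U \<inter> ?M) = W \<inter> {x. inner b x = 0}"
    using subspace_hyperplane[of b] dim_special_hyperplane[OF b] by simp
  then show "\<exists>U W \<phi> \<psi> L. x0 \<in> U \<and> diffeomorphism U W \<phi> \<psi> \<and> subspace (L :: 'a set) \<and>
      dim L = DIM('a) - 1 \<and> \<phi> ` (U \<inter> ?M) = W \<inter> L"
    by (intro exI)
qed

section \<open>Iterated partial derivatives\<close>

definition partial :: "'a::euclidean_space \<Rightarrow> ('a \<Rightarrow> real) \<Rightarrow> 'a \<Rightarrow> real" where
  "partial b P x = frechet_derivative P (at x) b"

lemma partial_eq: "(\<And>x. (P has_derivative D x) (at x)) \<Longrightarrow> partial b P = (\<lambda>x. D x b)"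
  by (rule ext) (metis frechet_derivative_eq partial_def)

lemma real_polynomial_function_partial:
  assumes "real_polynomial_function P" shows "real_polynomial_function (partial b P)"
proof -
  obtain D where D: "\<forall>x. (P has_derivative D x) (at x)" "\<forall>v. real_polynomial_function (\<lambda>x. D x v)"
    using real_polynomial_function_has_derivative[OF assms] by (elim exE conjE)
  have "partial b P = (\<lambda>x. D x b)" by (rule partial_eq) (use D(1) in blast)
  then show ?thesis using D(2) by simp
qed

lemma partial_0: "partial b (\<lambda>x. 0) = (\<lambda>x. 0)"
  using partial_eq[of "\<lambda>x. 0" "\<lambda>x v. 0" b] by simp

lemma partial_add_mult:
  assumes "real_polynomial_function P" "real_polynomial_function Q"
  shows "partial b (\<lambda>x. P x + Q x) = (\<lambda>x. partial b P x + partial b Q x)"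
    "partial b (\<lambda>x. P x * Q x) = (\<lambda>x. P x * partial b Q x + partial b P x * Q x)"
proof -
  obtain D where D: "\<And>x. (P has_derivative D x) (at x)"
    using real_polynomial_function_has_derivative[OF assms(1)] by blast
  obtain E where E: "\<And>x. (Q has_derivative E x) (at x)"
    using real_polynomial_function_has_derivative[OF assms(2)] by blast
  note eqs = partial_eq[OF D, of b] partial_eq[OF E, of b]
  show "partial b (\<lambda>x. P x + Q x) = (\<lambda>x. partial b P x + partial b Q x)"
    unfolding eqs by (rule partial_eq[OF has_derivative_add[OF D E]])
  show "partial b (\<lambda>x. P x * Q x) = (\<lambda>x. P x * partial b Q x + partial b P x * Q x)"
    unfolding eqs by (rule partial_eq[OF has_derivative_mult[OF D E]])
qed

text \<open>For a polynomial this amounts to degree below \<open>n\<close>, without an expansion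
  into monomials; it is the measure for an induction that passes to partial derivatives.\<close>

primrec partials_vanish :: "nat \<Rightarrow> ('a::euclidean_space \<Rightarrow> real) \<Rightarrow> bool" where
  "partials_vanish 0 P \<longleftrightarrow> P = (\<lambda>x. 0)"
| "partials_vanish (Suc n) P \<longleftrightarrow> (\<forall>b\<in>Basis. partials_vanish n (partial b P))"

lemma partials_vanish_0: "partials_vanish n (\<lambda>x. 0)"
  by (induction n) (auto simp: partial_0)

lemma partials_vanish_mono: "partials_vanish n P \<Longrightarrow> n \<le> m \<Longrightarrow> partials_vanish m P"
proof (induction n arbitrary: m P)
  case 0
  then show ?case by (simp add: partials_vanish_0)
next
  case (Suc n)
  then show ?case by (cases m) auto
qed

lemma partials_vanish_add:
  assumes "real_polynomial_function P" "real_polynomial_function Q" "partials_vanish n P" "partials_vanish n Q"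
  shows "partials_vanish n (\<lambda>x. P x + Q x)"
  using assms
proof (induction n arbitrary: P Q)
  case (Suc n)
  then show ?case by (auto simp: partial_add_mult real_polynomial_function_partial)
qed auto

text \<open>Each summand of the Leibniz rule lowers one of the two indices, so their sum is the
  induction measure. The bound is generous, but only its finiteness matters.\<close>

lemma partials_vanish_mult:
  assumes "real_polynomial_function P" "real_polynomial_function Q" "partials_vanish n P" "partials_vanish m Q"
  shows "partials_vanish (n + m) (\<lambda>x. P x * Q x)"
  using assms
proof (induction "n + m" arbitrary: n m P Q rule: less_induct)
  case less
  show ?case
  proof (cases "n = 0 \<or> m = 0")
    case True
    then have "(\<lambda>x. P x * Q x) = (\<lambda>x. 0)" using less.prems by auto
    then show ?thesis by (simp only: partials_vanish_0)
  next
    case False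
    then obtain n' m' where nm: "n = Suc n'" "m = Suc m'" by (metis not0_implies_Suc)
    have "partials_vanish (n' + m) (\<lambda>x. P x * partial b Q x + partial b P x * Q x)" if "b \<in> Basis" for b
    proof (rule partials_vanish_add)
      have "partials_vanish (n + m') (\<lambda>x. P x * partial b Q x)"
        using less.prems nm that by (intro less.hyps) (auto simp: real_polynomial_function_partial)
      then show "partials_vanish (n' + m) (\<lambda>x. P x * partial b Q x)" using nm by simp
      show "partials_vanish (n' + m) (\<lambda>x. partial b P x * Q x)"
        using less.prems nm that by (intro less.hyps) (auto simp: real_polynomial_function_partial)
    qed (use less.prems in \<open>auto intro: real_polynomial_function_partial\<close>)
    then show ?thesis
      using nm less.prems by (auto simp: partial_add_mult(2))
  qed
qed

lemma ex_partials_vanish: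
  fixes P :: "'a::euclidean_space \<Rightarrow> real"
  assumes "real_polynomial_function P" shows "\<exists>n. partials_vanish n P"
  using assms
proof induction
  case (const c)
  have "partials_vanish 1 (\<lambda>x :: 'a. c)"
    using partial_eq[of "\<lambda>x :: 'a. c" "\<lambda>x v. 0"] by simp
  then show ?case by blast
next
  case (linear f)
  then have "partial b f = (\<lambda>x. f b)" for b
    using partial_eq[of f "\<lambda>x. f" b] bounded_linear_imp_has_derivative by blast
  moreover have "partial b (\<lambda>x :: 'a. c) = (\<lambda>x. 0)" for b c
    using partial_eq[of "\<lambda>x :: 'a. c" "\<lambda>x v. 0"] by simp
  ultimately have "partials_vanish 2 f" by (simp add: numeral_2_eq_2)
  then show ?case by blast
next
  case (add f g)
  then obtain n m where "partials_vanish n f" "partials_vanish m g" by blast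
  then have "partials_vanish (max n m) f" "partials_vanish (max n m) g"
    using partials_vanish_mono max.cobounded1 max.cobounded2 by blast+
  then show ?case using partials_vanish_add add.hyps by blast
next
  case (mult f g)
  then show ?case using partials_vanish_mult by blast
qed

text \<open>At a zero of \<open>P\<close> some iterated partial derivative vanishes while one of its own partial
  derivatives does not, since the iterated partial derivatives are not all zero there.\<close>

lemma zero_set_covered_by_hypersurfaces:
  assumes "real_polynomial_function P" "partials_vanish n P" "P x1 \<noteq> 0"
  shows "\<exists>\<Q>. finite \<Q> \<and> (\<forall>Q\<in>\<Q>. real_polynomial_function Q) \<and>
    {x. P x = 0} \<subseteq> (\<Union>Q\<in>\<Q>. \<Union>b\<in>Basis. {x. Q x = 0 \<and> partial b Q x \<noteq> 0})"
  using assms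
proof (induction n arbitrary: P x1)
  case 0
  then show ?case by simp
next
  case (Suc n)
  show ?case
  proof (cases "\<exists>b\<in>Basis. \<exists>x. partial b P x \<noteq> 0")
    case True
    then obtain b x where b: "b \<in> Basis" "partial b P x \<noteq> 0" by blast
    obtain \<Q> where \<Q>: "finite \<Q>" "\<forall>Q\<in>\<Q>. real_polynomial_function Q"
      "{x. partial b P x = 0} \<subseteq> (\<Union>Q\<in>\<Q>. \<Union>b\<in>Basis. {x. Q x = 0 \<and> partial b Q x \<noteq> 0})"
      using Suc.IH[OF real_polynomial_function_partial[OF Suc.prems(1)] _ b(2)] Suc.prems(2) b(1) by auto
    have "{x. P x = 0} \<subseteq> (\<Union>Q\<in>insert P \<Q>. \<Union>b\<in>Basis. {x. Q x = 0 \<and> partial b Q x \<noteq> 0})"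
    proof
      fix x assume x: "x \<in> {x. P x = 0}"
      show "x \<in> (\<Union>Q\<in>insert P \<Q>. \<Union>b\<in>Basis. {x. Q x = 0 \<and> partial b Q x \<noteq> 0})"
      proof (cases "partial b P x = 0")
        case True
        then show ?thesis using \<Q>(3) by blast
      next
        case False
        then show ?thesis using x b by blast
      qed
    qed
    then show ?thesis
      using \<Q>(1,2) Suc.prems(1) by (intro exI[of _ "insert P \<Q>"]) auto
  next
    \<comment> \<open>All partial derivatives vanish identically, so \<open>P\<close> is a nonzero
      constant and has no zeros.\<close>
    case False
    obtain D where D: "\<And>x. (P has_derivative D x) (at x)"
      using real_polynomial_function_has_derivative[OF Suc.prems(1)] by blast
    have "D x = (\<lambda>v. 0)" for x
    proof
      fix v
      have lin: "linear (D x)" using D by (rule has_derivative_linear)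
      have "D x b = 0" if "b \<in> Basis" for b
        using False that by (simp add: partial_eq[OF D])
      then show "D x v = 0"
        using linear_eq_on_span[OF lin linear_zero, of Basis v] by simp
    qed
    then obtain c where "\<And>x. P x = c"
      using D has_derivative_zero_constant[of UNIV P] by (metis convex_UNIV iso_tuple_UNIV_I)
    then have "{x. P x = 0} = {}" using Suc.prems(3) by auto
    then show ?thesis by (intro exI[of _ "{}"]) auto
  qed
qed

theorem thin_covered_by_submanifolds:
  fixes A :: "'a::euclidean_space set"
  assumes "thin A"
  shows "\<exists>\<M>. finite \<M> \<and> A \<subseteq> \<Union>\<M> \<and>
    (\<forall>M\<in>\<M>. semialgebraic M \<and> embedded_submanifold (DIM('a) - 1) M)"
proof -
  obtain P x where P: "real_polynomial_function P" "P x \<noteq> 0" "A \<subseteq> {x. P x = 0}"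
    using assms unfolding thin_def by blast
  obtain n where n: "partials_vanish n P" using ex_partials_vanish[OF P(1)] by blast
  obtain \<Q> where \<Q>: "finite \<Q>" "\<forall>Q\<in>\<Q>. real_polynomial_function Q"
    "{x. P x = 0} \<subseteq> (\<Union>Q\<in>\<Q>. \<Union>b\<in>Basis. {x. Q x = 0 \<and> partial b Q x \<noteq> 0})"
    using zero_set_covered_by_hypersurfaces[OF P(1) n P(2)] by (elim exE conjE)
  define \<M> where "\<M> = (\<lambda>(Q, b). {x. Q x = 0 \<and> partial b Q x \<noteq> 0}) ` (\<Q> \<times> Basis)"
  have "semialgebraic M \<and> embedded_submanifold (DIM('a) - 1) M" if "M \<in> \<M>" for M
  proof -
    from \<open>M \<in> \<M>\<close> obtain Q b where Qb: "Q \<in> \<Q>" "b \<in> Basis" "M = {x. Q x = 0 \<and> partial b Q x \<noteq> 0}"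
      by (auto simp: \<M>_def)
    have Q: "real_polynomial_function Q" using \<Q>(2) Qb(1) by blast
    obtain D where D: "\<And>x. (Q has_derivative D x) (at x)" "\<And>v. real_polynomial_function (\<lambda>x. D x v)"
      using real_polynomial_function_has_derivative[OF Q] by blast
    have "M = {x. Q x = 0 \<and> D x b \<noteq> 0}" using Qb(3) partial_eq[OF D(1)] by simp
    then show ?thesis
      using embedded_submanifold_hypersurface[OF Q Qb(2) D]
        semialgebraic_conj[OF semialgebraic_eq_0[OF Q] semialgebraic_not[OF semialgebraic_eq_0[OF D(2)]]]
      by simp
  qed
  moreover have "(\<Union>Q\<in>\<Q>. \<Union>b\<in>Basis. {x. Q x = 0 \<and> partial b Q x \<noteq> 0}) \<subseteq> \<Union>\<M>"
    by (auto simp: \<M>_def)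
  then have "A \<subseteq> \<Union>\<M>" using P(3) \<Q>(3) by (meson order_trans)
  moreover have "finite \<M>" using \<Q>(1) by (simp add: \<M>_def)
  ultimately show ?thesis by blast
qed

section \<open>Generic fibres of stationary points are finite\<close>

text \<open>The last point \<open>m\<close> with \<open>g a - e * (m - a) \<le> g m\<close> must be
  \<open>b\<close>, since the lower bound at \<open>m\<close> would carry the inequality a little
  further. Then \<open>e\<close> tends to 0.\<close>

lemma lower_flat_le:
  fixes g :: "real \<Rightarrow> real"
  assumes "a \<le> b" and cont: "continuous_on {a..b} g"
    and low: "\<And>s e. \<lbrakk>s \<in> {a..b}; e > 0\<rbrakk> \<Longrightarrow> \<exists>d>0. \<forall>s'\<in>{a..b}. \<bar>s' - s\<bar> < d \<longrightarrow> g s' - g s \<ge> - e * \<bar>s' - s\<bar>"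
  shows "g a \<le> g b"
proof -
  have bound: "g a - e * (b - a) \<le> g b" if "e > 0" for e
  proof -
    define T where "T = {s\<in>{a..b}. g a - e * (s - a) \<le> g s}"
    have "closed T"
      unfolding T_def using cont
      by (intro continuous_on_closed_Collect_le continuous_intros) auto
    moreover have "T \<subseteq> {a..b}" by (auto simp: T_def)
    ultimately have "compact T" by (metis compact_Icc compact_Int_closed inf.absorb_iff2)
    moreover have "a \<in> T" using \<open>a \<le> b\<close> by (simp add: T_def)
    ultimately obtain m where m: "m \<in> T" "\<And>s. s \<in> T \<Longrightarrow> s \<le> m"
      using compact_attains_sup[of T] by blast
    have "m = b"
    proof (rule ccontr)
      assume "m \<noteq> b"
      then have mb: "a \<le> m" "m < b" "g a - e * (m - a) \<le> g m" using m(1) by (auto simp: T_def)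
      then obtain d where d: "d > 0" "\<forall>s'\<in>{a..b}. \<bar>s' - m\<bar> < d \<longrightarrow> g s' - g m \<ge> - e * \<bar>s' - m\<bar>"
        using low[of m e] \<open>e > 0\<close> by auto
      define s where "s = min b (m + d / 2)"
      have s: "m < s" "s \<le> b" "\<bar>s - m\<bar> < d" using d mb by (auto simp: s_def min_def)
      then have "g s - g m \<ge> - e * (s - m)" using bspec[OF d(2), of s] mb by auto
      then have "g a - e * (s - a) \<le> g s" using mb(3) by (simp add: algebra_simps)
      then have "s \<in> T" using s mb by (simp add: T_def)
      then show False using m(2) s(1) by force
    qed
    then show ?thesis using m(1) by (simp add: T_def)
  qed
  show ?thesis
  proof (rule field_le_epsilon)
    fix e :: real assume "e > 0"
    \<comment> \<open>The added 1 keeps the denominator positive when \<open>a = b\<close>.\<close>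
    define e' where "e' = e / (b - a + 1)"
    have "e' > 0" using \<open>e > 0\<close> \<open>a \<le> b\<close> by (simp add: e'_def)
    have "e' * (b - a) \<le> e' * (b - a + 1)" using \<open>e' > 0\<close> by (intro mult_left_mono) auto
    also have "\<dots> = e" using \<open>a \<le> b\<close> by (simp add: e'_def)
    finally show "g a \<le> g b + e" using bound[OF \<open>e' > 0\<close>] by linarith
  qed
qed

text \<open>The hypothesis bounds \<open>g\<close> from below on both sides of each point, so it
  survives reversal of the interval and the inequality holds in both directions.\<close>

lemma lower_flat_eq:
  fixes g :: "real \<Rightarrow> real"
  assumes "a \<le> b" and cont: "continuous_on {a..b} g"
    and low: "\<And>s e. \<lbrakk>s \<in> {a..b}; e > 0\<rbrakk> \<Longrightarrow> \<exists>d>0. \<forall>s'\<in>{a..b}. \<bar>s' - s\<bar> < d \<longrightarrow> g s' - g s \<ge> - e * \<bar>s' - s\<bar>"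
  shows "g a = g b"
proof -
  have "g (a + b - a) \<le> g (a + b - b)"
  proof (rule lower_flat_le[of a b "\<lambda>s. g (a + b - s)"])
    show "continuous_on {a..b} (\<lambda>s. g (a + b - s))"
      by (rule continuous_on_compose2[OF cont]) (auto intro!: continuous_intros)
    fix s e :: real assume s: "s \<in> {a..b}" "e > 0"
    then obtain d where d: "d > 0"
      "\<forall>s'\<in>{a..b}. \<bar>s' - (a + b - s)\<bar> < d \<longrightarrow> g s' - g (a + b - s) \<ge> - e * \<bar>s' - (a + b - s)\<bar>"
      using low[of "a + b - s" e] by auto
    have "g (a + b - s') - g (a + b - s) \<ge> - e * \<bar>s' - s\<bar>" if "s' \<in> {a..b}" "\<bar>s' - s\<bar> < d" for s'
    proof -
      have "\<bar>(a + b - s') - (a + b - s)\<bar> = \<bar>s' - s\<bar>" by simp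
      then show ?thesis using bspec[OF d(2), of "a + b - s'"] that by auto
    qed
    then show "\<exists>d>0. \<forall>s'\<in>{a..b}. \<bar>s' - s\<bar> < d \<longrightarrow> g (a + b - s') - g (a + b - s) \<ge> - e * \<bar>s' - s\<bar>"
      using d(1) by blast
  qed (rule \<open>a \<le> b\<close>)
  moreover have "g a \<le> g b" by (rule lower_flat_le[OF assms])
  ultimately show ?thesis by simp
qed

text \<open>
  Frechet stationarity without the gradient, so that only the graph of \<open>f\<close> enters its definition.
\<close>

definition frechet_min :: "('a::euclidean_space \<Rightarrow> real) \<Rightarrow> 'a set \<Rightarrow> 'a \<Rightarrow> 'a \<Rightarrow> bool" where
  "frechet_min f C v x \<longleftrightarrow> x \<in> C \<and> (\<forall>e>0. \<exists>d>0. \<forall>y\<in>C. dist y x < d \<longrightarrow>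
     f x + inner v x \<le> f y + inner v y + e * dist y x)"

text \<open>
  Envelope argument. Along a Lipschitz family of stationary points, \<open>g\<close> is flat in \<open>t\<close>, and
  \<open>g - s t\<close> is flat in \<open>s\<close>: the derivative of the critical value with respect to the parameter
  \<open>v\<close> is the critical point, whose \<open>b\<close>-coordinate is \<open>t\<close>. Both cannot hold.
\<close>

lemma no_lipschitz_family_of_frechet_min:
  fixes f :: "'a::euclidean_space \<Rightarrow> real" and x :: "real \<times> real \<Rightarrow> 'a"
  assumes f: "continuous_on UNIV f" and U: "open U" "U \<noteq> {}" and L: "L-lipschitz_on U x"
    and min: "\<And>s t. (s, t) \<in> U \<Longrightarrow> frechet_min f C (v + s *\<^sub>R b) (x (s, t))"
    and coord: "\<And>s t. (s, t) \<in> U \<Longrightarrow> inner b (x (s, t)) = t"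
  shows False
proof -
  define g where "g s t = f (x (s, t)) + inner (v + s *\<^sub>R b) (x (s, t))" for s t
  have low: "\<exists>d>0. \<forall>s' t'. (s', t') \<in> U \<longrightarrow> dist (s', t') (s, t) < d \<longrightarrow>
      g s' t' - g s t \<ge> (s' - s) * t' - e * dist (s', t') (s, t)"
    if st: "(s, t) \<in> U" and "e > 0" for s t e
  proof -
    have "L \<ge> 0" using L by (rule lipschitz_on_nonneg)
    \<comment> \<open>Stationarity measures errors by distances between points; dividing by
      \<open>L + 1\<close>, which is positive even for \<open>L = 0\<close>, converts them into
      errors in the parameters.\<close>
    define e1 where "e1 = e / (L + 1)"
    have "e1 > 0" using \<open>e > 0\<close> \<open>L \<ge> 0\<close> by (simp add: e1_def)
    then obtain d1 where d1: "d1 > 0" "\<forall>y\<in>C. dist y (x (s, t)) < d1 \<longrightarrow>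
        f (x (s, t)) + inner (v + s *\<^sub>R b) (x (s, t)) \<le> f y + inner (v + s *\<^sub>R b) y + e1 * dist y (x (s, t))"
      using min[OF st] unfolding frechet_min_def by blast
    define d where "d = d1 / (L + 1)"
    have "d > 0" using d1(1) \<open>L \<ge> 0\<close> by (simp add: d_def)
    have "g s' t' - g s t \<ge> (s' - s) * t' - e * dist (s', t') (s, t)"
      if st': "(s', t') \<in> U" and dist: "dist (s', t') (s, t) < d" for s' t'
    proof -
      let ?D = "dist (s', t') (s, t)"
      have lip: "dist (x (s', t')) (x (s, t)) \<le> L * ?D" by (rule lipschitz_onD[OF L st' st])
      also have "\<dots> \<le> (L + 1) * ?D" by (simp add: mult_right_mono)
      finally have 1: "dist (x (s', t')) (x (s, t)) \<le> (L + 1) * ?D" .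
      also have "\<dots> < d1" using dist \<open>L \<ge> 0\<close> by (simp add: d_def pos_less_divide_eq mult.commute)
      finally have "f (x (s, t)) + inner (v + s *\<^sub>R b) (x (s, t)) \<le>
          f (x (s', t')) + inner (v + s *\<^sub>R b) (x (s', t')) + e1 * dist (x (s', t')) (x (s, t))"
        using d1(2) min[OF st'] unfolding frechet_min_def by blast
      moreover have "e1 * dist (x (s', t')) (x (s, t)) \<le> e1 * ((L + 1) * ?D)"
        using 1 \<open>e1 > 0\<close> by (intro mult_left_mono) auto
      moreover have "e1 * ((L + 1) * ?D) = e * ?D" using \<open>L \<ge> 0\<close> by (simp add: e1_def)
      \<comment> \<open>With the point \<open>x (s', t')\<close> held fixed, passing from
        \<open>s\<close> to \<open>s'\<close> changes the value by \<open>s' - s\<close> times its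
        \<open>b\<close>-coordinate.\<close>
      moreover have "inner (v + s' *\<^sub>R b) (x (s', t')) = inner (v + s *\<^sub>R b) (x (s', t')) + (s' - s) * t'"
        using coord[OF st'] by (simp add: inner_add_left algebra_simps)
      ultimately show ?thesis unfolding g_def by linarith
    qed
    then show ?thesis using \<open>d > 0\<close> by blast
  qed
  obtain s0 t0 where "(s0, t0) \<in> U" using U by auto
  then obtain A B where AB: "open A" "open B" "s0 \<in> A" "t0 \<in> B" "A \<times> B \<subseteq> U"
    using U(1) open_prod_elim by (metis mem_Sigma_iff)
  obtain r where r: "r > 0" "cball s0 r \<subseteq> A" using AB open_contains_cball by blast
  obtain r' where r': "r' > 0" "cball t0 r' \<subseteq> B" using AB open_contains_cball by blast
  define s1 where "s1 = s0 + r"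
  define t1 where "t1 = t0 + r'"
  have box: "(s, t) \<in> U" if "s \<in> {s0..s1}" "t \<in> {t0..t1}" for s t
  proof -
    have "s \<in> A" using that r by (intro subsetD[OF r(2)]) (auto simp: s1_def dist_real_def)
    moreover have "t \<in> B" using that r' by (intro subsetD[OF r'(2)]) (auto simp: t1_def dist_real_def)
    ultimately show ?thesis using AB(5) by auto
  qed
  have contx: "continuous_on U x" using L by (rule lipschitz_on_continuous_on)
  have contf: "continuous_on {s0..s1} (\<lambda>s. f (x (s, t)))" "continuous_on {s0..s1} (\<lambda>s. x (s, t))"
    if "t \<in> {t0..t1}" for t
    using box that by (auto intro!: continuous_on_compose2[OF f] continuous_on_compose2[OF contx] continuous_intros)
  have contf': "continuous_on {t0..t1} (\<lambda>t. f (x (s, t)))" "continuous_on {t0..t1} (\<lambda>t. x (s, t))"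
    if "s \<in> {s0..s1}" for s
    using box that by (auto intro!: continuous_on_compose2[OF f] continuous_on_compose2[OF contx] continuous_intros)
  \<comment> \<open>Only \<open>t\<close> varies, so the term \<open>(s' - s) * t'\<close> of the
    lower bound disappears.\<close>
  have flat_t: "g s t0 = g s t1" if s: "s \<in> {s0..s1}" for s
  proof (rule lower_flat_eq[of t0 t1 "g s"])
    show "t0 \<le> t1" using r' by (simp add: t1_def)
    show "continuous_on {t0..t1} (g s)"
      unfolding g_def[abs_def] using contf'[OF s] by (intro continuous_intros)
    fix t e :: real assume t: "t \<in> {t0..t1}" "e > 0"
    obtain d where d: "d > 0" "\<forall>s' t'. (s', t') \<in> U \<longrightarrow> dist (s', t') (s, t) < d \<longrightarrow>
        g s' t' - g s t \<ge> (s' - s) * t' - e * dist (s', t') (s, t)"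
      using low[OF box[OF s t(1)] t(2)] by blast
    have "g s t' - g s t \<ge> - e * \<bar>t' - t\<bar>" if "t' \<in> {t0..t1}" "\<bar>t' - t\<bar> < d" for t'
      using d(2)[rule_format, OF box[OF s that(1)]] that(2) by (simp add: dist_Pair_Pair dist_real_def)
    then show "\<exists>d>0. \<forall>t'\<in>{t0..t1}. \<bar>t' - t\<bar> < d \<longrightarrow> g s t' - g s t \<ge> - e * \<bar>t' - t\<bar>"
      using d(1) by blast
  qed
  \<comment> \<open>With \<open>t\<close> fixed, subtracting \<open>s * t\<close> absorbs the linear
    term of the lower bound.\<close>
  have flat_s: "g s0 t - s0 * t = g s1 t - s1 * t" if t: "t \<in> {t0..t1}" for t
  proof (rule lower_flat_eq[of s0 s1 "\<lambda>s. g s t - s * t"])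
    show "s0 \<le> s1" using r by (simp add: s1_def)
    show "continuous_on {s0..s1} (\<lambda>s. g s t - s * t)"
      unfolding g_def using contf[OF t] by (intro continuous_intros)
    fix s e :: real assume s: "s \<in> {s0..s1}" "e > 0"
    obtain d where d: "d > 0" "\<forall>s' t'. (s', t') \<in> U \<longrightarrow> dist (s', t') (s, t) < d \<longrightarrow>
        g s' t' - g s t \<ge> (s' - s) * t' - e * dist (s', t') (s, t)"
      using low[OF box[OF s(1) t] s(2)] by blast
    have "(g s' t - s' * t) - (g s t - s * t) \<ge> - e * \<bar>s' - s\<bar>" if "s' \<in> {s0..s1}" "\<bar>s' - s\<bar> < d" for s'
      using d(2)[rule_format, OF box[OF that(1) t]] that(2)
      by (simp add: dist_Pair_Pair dist_real_def algebra_simps)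
    then show "\<exists>d>0. \<forall>s'\<in>{s0..s1}. \<bar>s' - s\<bar> < d \<longrightarrow> (g s' t - s' * t) - (g s t - s * t) \<ge> - e * \<bar>s' - s\<bar>"
      using d(1) by blast
  qed
  have "s0 \<in> {s0..s1}" "s1 \<in> {s0..s1}" "t0 \<in> {t0..t1}" "t1 \<in> {t0..t1}"
    using r(1) r'(1) by (auto simp: s1_def t1_def)
  \<comment> \<open>Compare two opposite sides of the rectangle: from \<open>s0\<close> to
    \<open>s1\<close> the value \<open>g\<close> gains \<open>(s1 - s0) * t0\<close> on one and
    \<open>(s1 - s0) * t1\<close> on the other, while it agrees at the corresponding
    corners.\<close>
  then have "(s1 - s0) * t0 = (s1 - s0) * t1"
    using flat_t[of s0] flat_t[of s1] flat_s[of t0] flat_s[of t1] by (simp add: algebra_simps)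
  then show False using r(1) r'(1) by (simp add: s1_def t1_def)
qed

section \<open>Semialgebraicity and generic finiteness\<close>

lemma semialgebraic_frechet_min:
  fixes f :: "'a::euclidean_space \<Rightarrow> real"
  assumes f: "semialgebraic_function f" and C: "semialgebraic C"
  shows "semialgebraic {z. frechet_min f C (fst z) (snd z)}"
proof -
  define \<Gamma> where "\<Gamma> = range (\<lambda>x. (x, f x))"
  have \<Gamma>: "semialgebraic \<Gamma>" using f by (simp add: \<Gamma>_def semialgebraic_function_def)
  have mem: "(x, c) \<in> \<Gamma> \<longleftrightarrow> c = f x" for x c by (auto simp: \<Gamma>_def)
  \<comment> \<open>All atoms must be polynomial or refer to a given semialgebraic set: the distance
    enters as a nonnegative square root \<open>r\<close>, the values of \<open>f\<close> as second
    components \<open>p\<close> and \<open>q\<close> of graph points.\<close>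
  have eq: "frechet_min f C v x \<longleftrightarrow> x \<in> C \<and> (\<forall>e::real. 0 < e \<longrightarrow> (\<exists>d::real. 0 < d \<and>
      (\<forall>y. y \<in> C \<longrightarrow> (\<forall>r::real. 0 \<le> r \<longrightarrow> r^2 = inner (y - x) (y - x) \<longrightarrow> r < d \<longrightarrow>
        (\<forall>p::real. \<forall>q::real. (x, p) \<in> \<Gamma> \<longrightarrow> (y, q) \<in> \<Gamma> \<longrightarrow> p + inner v x \<le> q + inner v y + e * r)))))" for v x
  proof -
    have r: "0 \<le> r \<Longrightarrow> r^2 = inner (y - x) (y - x) \<longleftrightarrow> r = dist y x" for r :: real and y
      by (simp add: dist_norm norm_eq_sqrt_inner) (metis inner_ge_zero real_sqrt_pow2 real_sqrt_unique)
    show ?thesis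
      unfolding frechet_min_def mem using r by (simp add: Ball_def cong: imp_cong)
  qed
  show ?thesis
    unfolding eq
    by (intro semialgebraic_intros semialgebraic_vimage[OF _ \<Gamma>] semialgebraic_vimage[OF _ C] polynomial_intros)
qed

lemma thin_real_finite: "thin (A :: real set) \<Longrightarrow> finite A"
proof -
  assume "thin A"
  then obtain P x where P: "real_polynomial_function P" "P x \<noteq> 0" "A \<subseteq> {x. P x = 0}"
    unfolding thin_def by blast
  obtain n p where p: "\<And>w t. P (w + t *\<^sub>R 1) = poly (p w) t"
    using param_poly_along_line[OF P(1), of 1] by blast
  have "P t = poly (p 0) t" for t using p[of 0 t] by simp
  moreover have "p 0 \<noteq> 0" using P(2) calculation by auto
  ultimately have "A \<subseteq> {t. poly (p 0) t = 0}" "finite {t. poly (p 0) t = 0}"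
    using P(3) poly_roots_finite by auto
  then show ?thesis by (rule finite_subset)
qed

lemma finite_if_coordinates_finite:
  fixes T :: "'b::euclidean_space set"
  assumes "\<And>b. b \<in> Basis \<Longrightarrow> finite (inner b ` T)"
  shows "finite T"
proof -
  have "T \<subseteq> (\<lambda>g. \<Sum>b\<in>Basis. g b *\<^sub>R b) ` (Pi\<^sub>E Basis (\<lambda>b. inner b ` T))"
  proof
    fix x assume "x \<in> T"
    define g where "g = (\<lambda>b\<in>Basis. inner b x)"
    have "x = (\<Sum>b\<in>Basis. g b *\<^sub>R b)"
      using euclidean_representation[of x] by (simp add: g_def inner_commute)
    moreover have "g \<in> Pi\<^sub>E Basis (\<lambda>b. inner b ` T)" using \<open>x \<in> T\<close> by (auto simp: g_def)
    ultimately show "x \<in> (\<lambda>g. \<Sum>b\<in>Basis. g b *\<^sub>R b) ` (Pi\<^sub>E Basis (\<lambda>b. inner b ` T))" by blast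
  qed
  then show ?thesis using assms by (meson finite_PiE finite_Basis finite_imageI finite_subset)
qed

context
  fixes f :: "'a::euclidean_space \<Rightarrow> real" and C :: "'a set"
  assumes f: "continuous_on UNIV f" and sf: "semialgebraic_function f" and sC: "semialgebraic C"
begin

text \<open>Moving \<open>v\<close> along \<open>b\<close> inside an open set of such parameters
  adds a parameter \<open>s\<close> that is independent of \<open>t\<close>. Over a rectangle in
  \<open>(s, t)\<close> there are stationary points with \<open>b\<close>-coordinate
  \<open>t\<close>, and a Lipschitz choice of them contradicts the envelope argument.\<close>

lemma thin_interval_of_frechet_min:
  assumes "c < d"
  shows "thin {v. \<forall>t. c < t \<and> t < d \<longrightarrow> (\<exists>x. frechet_min f C v x \<and> inner b x = t)}" (is "thin ?V")
proof (rule semialgebraic_empty_interior_thin)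
  define S where "S = {z. frechet_min f C (fst z) (snd z)}"
  have S: "semialgebraic S" unfolding S_def by (rule semialgebraic_frechet_min[OF sf sC])
  have V: "?V = {v. \<forall>t::real. c < t \<and> t < d \<longrightarrow> (\<exists>x. (v, x) \<in> S \<and> inner b x = t)}"
    by (simp add: S_def)
  show "semialgebraic ?V"
    unfolding V by (intro semialgebraic_intros semialgebraic_vimage[OF _ S] polynomial_intros)
  show "interior ?V = {}"
  proof (rule ccontr)
    assume "interior ?V \<noteq> {}"
    then obtain v where "v \<in> interior ?V" by blast
    then obtain r where r: "r > 0" "ball v r \<subseteq> ?V" by (meson mem_interior)
    define X where "X = {z :: (real \<times> real) \<times> 'a. (v + fst (fst z) *\<^sub>R b, snd z) \<in> S \<and> inner b (snd z) = snd (fst z)}"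
    have "semialgebraic X"
      unfolding X_def
      by (intro semialgebraic_intros semialgebraic_vimage[OF _ S] polynomial_intros)
    moreover have "interior (fst ` X) \<noteq> {}"
    proof -
      \<comment> \<open>Keeps the shifted parameter in the ball; the added 1 avoids a zero
        denominator.\<close>
      define \<delta> where "\<delta> = r / (norm b + 1)"
      have "\<delta> > 0" using r(1) by (simp add: \<delta>_def add_nonneg_pos)
      have "{- \<delta><..<\<delta>} \<times> {c<..<d} \<subseteq> fst ` X"
      proof
        fix w assume w: "w \<in> {- \<delta><..<\<delta>} \<times> {c<..<d}"
        obtain s t where st: "w = (s, t)" by (cases w)
        have s: "\<bar>s\<bar> < \<delta>" and t: "c < t" "t < d" using w st by auto
        have "\<bar>s\<bar> * norm b \<le> \<bar>s\<bar> * (norm b + 1)" by (simp add: mult_left_mono)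
        also have "\<dots> < r" using s by (simp add: \<delta>_def pos_less_divide_eq add_nonneg_pos)
        finally have "v + s *\<^sub>R b \<in> ball v r" by (simp add: dist_norm)
        then have "v + s *\<^sub>R b \<in> ?V" using r(2) by blast
        then obtain x where x: "frechet_min f C (v + s *\<^sub>R b) x" "inner b x = t" using t by blast
        then have "(w, x) \<in> X" by (simp add: X_def S_def st)
        then show "w \<in> fst ` X" by (metis fst_conv image_eqI)
      qed
      moreover have "open ({- \<delta><..<\<delta>} \<times> {c<..<d})" by (intro open_Times) auto
      ultimately have "{- \<delta><..<\<delta>} \<times> {c<..<d} \<subseteq> interior (fst ` X)" by (rule interior_maximal)
      moreover have "(0, (c + d) / 2) \<in> {- \<delta><..<\<delta>} \<times> {c<..<d}"
        using \<open>\<delta> > 0\<close> \<open>c < d\<close> by simp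
      ultimately show ?thesis by blast
    qed
    ultimately obtain U x L where U: "open U" "U \<noteq> {}" "L-lipschitz_on U x" "\<And>u. u \<in> U \<Longrightarrow> (u, x u) \<in> X"
      using lipschitz_section by metis
    show False
    proof (rule no_lipschitz_family_of_frechet_min[OF f U(1-3)])
      fix s t assume "(s, t) \<in> U"
      then have "((s, t), x (s, t)) \<in> X" by (rule U(4))
      then show "frechet_min f C (v + s *\<^sub>R b) (x (s, t))" "inner b (x (s, t)) = t"
        by (auto simp: X_def S_def)
    qed
  qed
qed

text \<open>An infinite fibre has an infinite projection to some coordinate. Being a semialgebraic
  subset of the line, this projection contains an interval, hence one with rational endpoints, and
  there are only countably many of these.\<close>

lemma meagre_infinite_frechet_min: "meagre {v. infinite {x. frechet_min f C v x}}"
proof -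
  define V where "V = (\<lambda>(b, c, d). {v. \<forall>t. of_rat c < t \<and> t < of_rat d \<longrightarrow>
     (\<exists>x. frechet_min f C v x \<and> inner b x = t)})"
  define I where "I = {(b, c, d). b \<in> (Basis :: 'a set) \<and> (c :: rat) < d}"
  have "countable (Basis \<times> UNIV \<times> UNIV :: ('a \<times> rat \<times> rat) set)"
    by (intro countable_SIGMA) (auto simp: countable_finite)
  then have "countable I" by (rule countable_subset[rotated]) (auto simp: I_def)
  then have "meagre (\<Union>i\<in>I. V i)"
    by (rule meagre_countable_UN) (auto simp: I_def V_def of_rat_less intro: thin_interval_of_frechet_min)
  moreover have "{v. infinite {x. frechet_min f C v x}} \<subseteq> (\<Union>i\<in>I. V i)"
  proof
    fix v assume "v \<in> {v. infinite {x. frechet_min f C v x}}"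
    then obtain b where b: "b \<in> Basis" "infinite (inner b ` {x. frechet_min f C v x})"
      using finite_if_coordinates_finite by blast
    let ?T = "inner b ` {x. frechet_min f C v x}"
    have "?T = {t. \<exists>x. (v, x) \<in> {z. frechet_min f C (fst z) (snd z)} \<and> inner b x = t}" by auto
    moreover have "semialgebraic {t. \<exists>x. (v, x) \<in> {z. frechet_min f C (fst z) (snd z)} \<and> inner b x = t}"
      by (intro semialgebraic_intros semialgebraic_vimage[OF _ semialgebraic_frechet_min[OF sf sC]] polynomial_intros)
    ultimately have "semialgebraic ?T" by simp
    then have "interior ?T \<noteq> {}" using b(2) semialgebraic_empty_interior_thin thin_real_finite by blast
    then obtain t where "t \<in> interior ?T" by blast
    then obtain e where e: "e > 0" "ball t e \<subseteq> ?T" by (meson mem_interior)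
    obtain c where c: "t < real_of_rat c" "real_of_rat c < t + e" using of_rat_dense[of t "t + e"] e by auto
    obtain d where d: "real_of_rat c < real_of_rat d" "real_of_rat d < t + e"
      using of_rat_dense[OF c(2)] by auto
    have "(b, c, d) \<in> I" using b d by (simp add: I_def of_rat_less)
    moreover have "v \<in> V (b, c, d)"
    proof -
      have "\<exists>x. frechet_min f C v x \<and> inner b x = u" if "of_rat c < u" "u < of_rat d" for u
      proof -
        have "u \<in> ball t e" using that c d by (auto simp: dist_real_def)
        then show ?thesis using e(2) by auto
      qed
      then show ?thesis by (simp add: V_def)
    qed
    ultimately show "v \<in> (\<Union>i\<in>I. V i)" by blast
  qed
  ultimately show ?thesis using meagre_subset by blast
qed

lemma thin_limits_of_frechet_min:
  defines "S \<equiv> {z. frechet_min f C (fst z) (snd z)}"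
  shows "thin {v. \<exists>x. (v, x) \<in> closure S \<and> (v, x) \<notin> S}" (is "thin ?V")
proof (rule semialgebraic_empty_interior_thin)
  have S: "semialgebraic S" unfolding S_def by (rule semialgebraic_frechet_min[OF sf sC])
  show "semialgebraic ?V"
    by (intro semialgebraic_intros semialgebraic_vimage[OF _ S]
        semialgebraic_vimage[OF _ semialgebraic_closure[OF S]] polynomial_intros)
  have "?V \<subseteq> {v. \<exists>x. (v, x) \<in> closure S \<and> x \<notin> closure {x. (v, x) \<in> S}} \<union>
      {v. infinite {x. frechet_min f C v x}}"
  proof
    fix v assume "v \<in> ?V"
    then obtain x where x: "(v, x) \<in> closure S" "(v, x) \<notin> S" by blast
    have "closed {x. (v, x) \<in> S}" if "finite {x. frechet_min f C v x}"
      using finite_imp_closed[OF that] by (simp add: S_def)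
    then show "v \<in> {v. \<exists>x. (v, x) \<in> closure S \<and> x \<notin> closure {x. (v, x) \<in> S}} \<union>
      {v. infinite {x. frechet_min f C v x}}"
      using x by (metis (mono_tags, lifting) UnI1 UnI2 closure_closed mem_Collect_eq)
  qed
  then have "meagre ?V"
    using meagre_subset meagre_Un[OF meagre_closure_fibre[OF S] meagre_infinite_frechet_min] by blast
  then show "interior ?V = {}" by (rule meagre_interior)
qed

end

section \<open>Stationary points and normal cones\<close>

text \<open>The quotient excludes \<open>y = x\<close>, where the product form reads
  \<open>0 \<le> 0\<close>. Weak and strict bounds for every \<open>e\<close> are equivalent, as
  \<open>e\<close> may be halved.\<close>

lemma regular_normal_cone_iff:
  fixes C :: "'a::euclidean_space set"
  shows "w \<in> regular_normal_cone C x \<longleftrightarrow>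
    (\<forall>e>0. \<exists>d>0. \<forall>y\<in>C. dist y x < d \<longrightarrow> inner w (y - x) \<le> e * dist y x)"
proof -
  have quot: "inner w (y - x) / norm (y - x) < e \<longleftrightarrow> inner w (y - x) < e * dist y x" if "y \<noteq> x" for y e
    using that by (simp add: dist_norm pos_divide_less_eq)
  have "w \<in> regular_normal_cone C x \<longleftrightarrow>
    (\<forall>e>0. eventually (\<lambda>y. ereal (inner w (y - x) / norm (y - x)) < e) (at x within C))"
    unfolding regular_normal_cone_def by (simp add: Limsup_le_iff)
  also have "\<dots> \<longleftrightarrow> (\<forall>e>0. eventually (\<lambda>y. inner w (y - x) / norm (y - x) < e) (at x within C))"
    (is "?L \<longleftrightarrow> ?R")
  proof
    assume ?L
    show ?R
    proof (intro allI impI)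
      fix e :: real assume "e > 0"
      then show "\<forall>\<^sub>F y in at x within C. inner w (y - x) / norm (y - x) < e"
        using \<open>?L\<close>[rule_format, of "ereal e"] by simp
    qed
  next
    assume ?R
    show ?L
    proof (intro allI impI)
      fix e :: ereal assume "e > 0"
      then show "\<forall>\<^sub>F y in at x within C. ereal (inner w (y - x) / norm (y - x)) < e"
        using \<open>?R\<close> by (cases e) auto
    qed
  qed
  also have "\<dots> \<longleftrightarrow> (\<forall>e>0. \<exists>d>0. \<forall>y\<in>C. dist y x < d \<longrightarrow> inner w (y - x) \<le> e * dist y x)"
    (is "?L \<longleftrightarrow> ?R")
  proof
    assume ?L
    show ?R
    proof (intro allI impI)
      fix e :: real assume "e > 0"
      then obtain d where d: "d > 0" "\<And>y. \<lbrakk>y \<in> C; y \<noteq> x; dist y x < d\<rbrakk> \<Longrightarrow> inner w (y - x) / norm (y - x) < e"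
        using \<open>?L\<close> unfolding eventually_at by blast
      have "inner w (y - x) \<le> e * dist y x" if "y \<in> C" "dist y x < d" for y
        using d(2)[of y] quot[of y e] that by (cases "y = x") auto
      then show "\<exists>d>0. \<forall>y\<in>C. dist y x < d \<longrightarrow> inner w (y - x) \<le> e * dist y x"
        using d(1) by blast
    qed
  next
    assume ?R
    show ?L
    proof (intro allI impI)
      fix e :: real assume "e > 0"
      have "\<exists>d>0. \<forall>y\<in>C. dist y x < d \<longrightarrow> inner w (y - x) \<le> e / 2 * dist y x"
        by (rule \<open>?R\<close>[rule_format]) (use \<open>e > 0\<close> in simp)
      then obtain d where d: "d > 0" "\<And>y. \<lbrakk>y \<in> C; dist y x < d\<rbrakk> \<Longrightarrow> inner w (y - x) \<le> e / 2 * dist y x"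
        by blast
      have "inner w (y - x) / norm (y - x) < e" if "y \<in> C" "y \<noteq> x" "dist y x < d" for y
      proof -
        have "e / 2 * dist y x < e * dist y x" using \<open>e > 0\<close> that by simp
        then show ?thesis using d(2)[of y] that quot[of y e] by auto
      qed
      then show "\<forall>\<^sub>F y in at x within C. inner w (y - x) / norm (y - x) < e"
        unfolding eventually_at using d(1) by blast
    qed
  qed
  finally show ?thesis .
qed

text \<open>Near \<open>x\<close> the function \<open>f\<close> differs from its linearisation by at
  most \<open>e / 2\<close> times the distance. The inequality for values and the one for linear
  parts therefore imply each other, the other half of \<open>e\<close> being left for the
  hypothesis.\<close>

lemma frechet_min_iff_regular_normal:
  fixes f :: "'a::euclidean_space \<Rightarrow> real"
  assumes G: "GDERIV f x :> G"
  shows "frechet_min f C v x \<longleftrightarrow> x \<in> C \<and> - (G + v) \<in> regular_normal_cone C x"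
proof -
  have der: "\<exists>d>0. \<forall>y. dist y x < d \<longrightarrow> \<bar>f y - f x - inner (y - x) G\<bar> \<le> e * dist y x" if "e > 0" for e
    using G that unfolding gderiv_def has_derivative_at_alt dist_norm by auto
  have lin: "inner (- (G + v)) (y - x) = - inner (y - x) G - inner v y + inner v x" for y
    by (simp add: inner_add_left inner_diff_right inner_diff_left inner_commute)
  have "(\<forall>e>0. \<exists>d>0. \<forall>y\<in>C. dist y x < d \<longrightarrow> f x + inner v x \<le> f y + inner v y + e * dist y x) \<longleftrightarrow>
    (\<forall>e>0. \<exists>d>0. \<forall>y\<in>C. dist y x < d \<longrightarrow> inner (- (G + v)) (y - x) \<le> e * dist y x)" (is "?L \<longleftrightarrow> ?R")
  proof
    assume ?L
    show ?R
    proof (intro allI impI)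
      fix e :: real assume "e > 0"
      obtain d1 where d1: "d1 > 0" "\<forall>y. dist y x < d1 \<longrightarrow> \<bar>f y - f x - inner (y - x) G\<bar> \<le> e / 2 * dist y x"
        using der[of "e / 2"] \<open>e > 0\<close> by auto
      have "\<exists>d>0. \<forall>y\<in>C. dist y x < d \<longrightarrow> f x + inner v x \<le> f y + inner v y + e / 2 * dist y x"
        by (rule \<open>?L\<close>[rule_format]) (use \<open>e > 0\<close> in simp)
      then obtain d2 where d2: "d2 > 0" "\<forall>y\<in>C. dist y x < d2 \<longrightarrow> f x + inner v x \<le> f y + inner v y + e / 2 * dist y x"
        by blast
      have "inner (- (G + v)) (y - x) \<le> e * dist y x" if "y \<in> C" "dist y x < min d1 d2" for y
      proof -
        have "\<bar>f y - f x - inner (y - x) G\<bar> \<le> e / 2 * dist y x"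
          "f x + inner v x \<le> f y + inner v y + e / 2 * dist y x" using d1(2) d2(2) that by auto
        then show ?thesis unfolding lin abs_le_iff by linarith
      qed
      then show "\<exists>d>0. \<forall>y\<in>C. dist y x < d \<longrightarrow> inner (- (G + v)) (y - x) \<le> e * dist y x"
        using d1(1) d2(1) by (intro exI[of _ "min d1 d2"]) auto
    qed
  next
    assume ?R
    show ?L
    proof (intro allI impI)
      fix e :: real assume "e > 0"
      obtain d1 where d1: "d1 > 0" "\<forall>y. dist y x < d1 \<longrightarrow> \<bar>f y - f x - inner (y - x) G\<bar> \<le> e / 2 * dist y x"
        using der[of "e / 2"] \<open>e > 0\<close> by auto
      have "\<exists>d>0. \<forall>y\<in>C. dist y x < d \<longrightarrow> inner (- (G + v)) (y - x) \<le> e / 2 * dist y x"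
        by (rule \<open>?R\<close>[rule_format]) (use \<open>e > 0\<close> in simp)
      then obtain d2 where d2: "d2 > 0" "\<forall>y\<in>C. dist y x < d2 \<longrightarrow> inner (- (G + v)) (y - x) \<le> e / 2 * dist y x"
        by blast
      have "f x + inner v x \<le> f y + inner v y + e * dist y x" if "y \<in> C" "dist y x < min d1 d2" for y
      proof -
        have "\<bar>f y - f x - inner (y - x) G\<bar> \<le> e / 2 * dist y x"
          "inner (- (G + v)) (y - x) \<le> e / 2 * dist y x" using d1(2) d2(2) that by auto
        then show ?thesis unfolding lin abs_le_iff by linarith
      qed
      then show "\<exists>d>0. \<forall>y\<in>C. dist y x < d \<longrightarrow> f x + inner v x \<le> f y + inner v y + e * dist y x"
        using d1(1) d2(1) by (intro exI[of _ "min d1 d2"]) auto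
    qed
  qed
  then show ?thesis unfolding frechet_min_def regular_normal_cone_iff by simp
qed

lemma gradient_eq:
  fixes h :: "'a::euclidean_space \<Rightarrow> real"
  assumes "GDERIV h x :> g" shows "gradient h x = g"
  unfolding gradient_def
proof (rule the_equality)
  fix g' assume "GDERIV h x :> g'"
  then have "(\<lambda>v. inner v g') = (\<lambda>v. inner v g)"
    using assms has_derivative_unique unfolding gderiv_def by blast
  then show "g' = g" by (metis vector_eq_ldot)
qed (rule assms)

lemma Ck_on_1_gradient:
  fixes f :: "'a::euclidean_space \<Rightarrow> real"
  assumes "Ck_on 1 f UNIV"
  shows "\<exists>G. (\<forall>x. GDERIV f x :> G x) \<and> continuous_on UNIV G"
proof -
  have d: "f differentiable (at x)" and c: "continuous_on UNIV (\<lambda>x. frechet_derivative f (at x) v)" for x v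
    using assms by (auto simp: One_nat_def)
  define G where "G x = (\<Sum>b\<in>Basis. frechet_derivative f (at x) b *\<^sub>R b)" for x
  have "GDERIV f x :> G x" for x
  proof -
    have der: "(f has_derivative frechet_derivative f (at x)) (at x)"
      using d frechet_derivative_works by blast
    then have lin: "linear (frechet_derivative f (at x))" by (rule has_derivative_linear)
    have "frechet_derivative f (at x) h = inner h (G x)" for h
    proof -
      have "frechet_derivative f (at x) h = frechet_derivative f (at x) (\<Sum>b\<in>Basis. inner h b *\<^sub>R b)"
        by (simp add: euclidean_representation)
      also have "\<dots> = (\<Sum>b\<in>Basis. inner h b * frechet_derivative f (at x) b)"
        by (simp add: linear_sum[OF lin] linear_scale[OF lin])
      finally show ?thesis by (simp add: G_def inner_sum_right mult.commute)
    qed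
    then have "frechet_derivative f (at x) = (\<lambda>h. inner h (G x))" by (rule ext)
    then show ?thesis using der by (simp add: gderiv_def)
  qed
  moreover have "continuous_on UNIV G"
    unfolding G_def by (intro continuous_intros c)
  ultimately show ?thesis by blast
qed

theorem theorem1:
  fixes f :: "real ^ 'p \<Rightarrow> real" and C :: "(real ^ 'p) set"
  assumes "Ck_on 1 f UNIV" and "semialgebraic_function f"
    and "closed C" and "semialgebraic C"
  shows "\<exists>V. (\<exists>\<M>. finite \<M> \<and> V = \<Union>\<M> \<and>
                (\<forall>M\<in>\<M>. semialgebraic M \<and> (\<exists>d. d \<le> CARD('p) - 1 \<and> embedded_submanifold d M))) \<and>
             (\<forall>v. v \<notin> V \<longrightarrow>
                (\<forall>x. critical_on C (\<lambda>y. f y + inner v y) x \<longrightarrow>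
                     frechet_stationary_on C (\<lambda>y. f y + inner v y) x))"
proof -
  obtain G where G: "\<And>x. GDERIV f x :> G x" "continuous_on UNIV G"
    using Ck_on_1_gradient[OF assms(1)] by blast
  have contf: "continuous_on UNIV f"
    using G(1) has_derivative_continuous unfolding gderiv_def
    by (blast intro: continuous_at_imp_continuous_on)
  have grad: "gradient (\<lambda>y. f y + inner v y) x = G x + v" for v x
  proof (rule gradient_eq)
    have "GDERIV (inner v) x :> v"
      unfolding gderiv_def by (auto intro!: derivative_eq_intros simp: inner_commute)
    then show "GDERIV (\<lambda>y. f y + inner v y) x :> G x + v"
      using G(1) by (intro GDERIV_add)
  qed
  define S where "S = {z. frechet_min f C (fst z) (snd z)}"
  define V0 where "V0 = {v. \<exists>x. (v, x) \<in> closure S \<and> (v, x) \<notin> S}"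
  have "thin V0"
    unfolding V0_def S_def using thin_limits_of_frechet_min[OF contf assms(2,4)] .
  \<comment> \<open>The union of the hypersurfaces may exceed \<open>V0\<close>; enlarging the
    exceptional set only restricts \<open>v\<close> further.\<close>
  then obtain \<M> where \<M>: "finite \<M>" "V0 \<subseteq> \<Union>\<M>"
    "\<forall>M\<in>\<M>. semialgebraic M \<and> embedded_submanifold (CARD('p) - 1) M"
    using thin_covered_by_submanifolds[of V0] by auto
  have main: "frechet_stationary_on C (\<lambda>y. f y + inner v y) x"
    if v: "v \<notin> \<Union>\<M>" and crit: "critical_on C (\<lambda>y. f y + inner v y) x" for v x
  proof -
    have x: "x \<in> C" "- (G x + v) \<in> normal_cone C x"
      using crit by (auto simp: critical_on_def grad)
    then obtain xs ws where xw: "\<And>k. xs k \<in> C" "\<And>k. ws k \<in> regular_normal_cone C (xs k)"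
      "xs \<longlonglongrightarrow> x" "ws \<longlonglongrightarrow> - (G x + v)"
      unfolding normal_cone_def by blast
    \<comment> \<open>Chosen so that \<open>- (G (xs k) + vs k) = ws k\<close>: the point
      \<open>xs k\<close> is stationary for the perturbed parameter \<open>vs k\<close>, and
      continuity of \<open>G\<close> makes these parameters converge to \<open>v\<close>.\<close>
    define vs where "vs k = - ws k - G (xs k)" for k
    have "isCont G x" using G(2) by (simp add: continuous_on_eq_continuous_at)
    then have "(\<lambda>k. G (xs k)) \<longlonglongrightarrow> G x" using xw(3) by (rule isCont_tendsto_compose)
    then have "vs \<longlonglongrightarrow> - (- (G x + v)) - G x"
      unfolding vs_def using xw(4) by (intro tendsto_intros)
    then have "(\<lambda>k. (vs k, xs k)) \<longlonglongrightarrow> (v, x)"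
      using xw(3) by (intro tendsto_Pair) auto
    moreover have "(vs k, xs k) \<in> S" for k
      using frechet_min_iff_regular_normal[OF G(1)] xw(1,2) by (simp add: S_def vs_def)
    ultimately have "(v, x) \<in> closure S"
      unfolding closure_sequential by (intro exI[of _ "\<lambda>k. (vs k, xs k)"]) auto
    then have "(v, x) \<in> S" using v \<M>(2) by (auto simp: V0_def)
    then show ?thesis
      using frechet_min_iff_regular_normal[OF G(1), of C v x] grad
      by (simp add: S_def frechet_stationary_on_def)
  qed
  show ?thesis
    by (rule exI[of _ "\<Union>\<M>"], intro conjI, rule exI[of _ \<M>])
      (use \<M> main in auto)
qed

end
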